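(* Let $n\ge1$ and $W=\mathbb{S}_n$. There are nonnegative integers $b_{\lambda,\mu}$, independent of $r$, indexed by partitions $\lambda\vdash n$ and partitions $\mu$ of integers $d$ with $0\le d\le\binom{n}{2}$ having at most $n$ parts, such that for every $r\ge1$ the graded Frobenius characteristic of the space $\mathcal{H}_n^{(r)}$ of diagonally harmonic polynomials of $\mathbb{S}_n$ in $r$ sets of variables satisfies $$\mathcal{H}_n^{(r)}(\mathbf{w};\mathbf{q})=\sum_{\lambda\vdash n}\Big(\sum_{\mu} b_{\lambda,\mu}\, s_\mu(q_1,\ldots,q_r)\Big) S_\lambda(\mathbf{w}).$$
   Context: Let $X=(x_{ij})$ be an $r\times n$ matrix of variables, $\mathbb{C}[X]$ the polynomial ring, with $\sigma\in\mathbb{S}_n$ (viewed as a permutation matrix) acting by $f(X)\mapsto f(X\sigma)$, i.e. permuting columns simultaneously in all $r$ rows. Let $\mathcal{I}^{(r)}$ be the ideal generated by invariant polynomials with zero constant term, and $\mathcal{H}_n^{(r)}$ the space of $g\in\mathbb{C}[X]$ with $f(\partial X)g=0$ for all $f\in\mathcal{I}^{(r)}$ ($f(\partial X)$ obtained by substituting $\partial/\partial x_{ij}$ for $x_{ij}$). $\mathbb{C}[X]$ is $\mathbb{N}^r$-graded by $\deg\prod x_{ij}^{a_{ij}}=(\sum_j a_{1j},\ldots,\sum_j a_{rj})$, and $\mathcal{H}_n^{(r)}$ is a graded $\mathbb{S}_n$-module with homogeneous components $\mathcal{H}_{n;\mathbf d}^{(r)}$. The graded Frobenius characteristic is $\mathcal{H}_n^{(r)}(\mathbf{w};\mathbf{q})=\sum_{\mathbf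 d\in\mathbb{N}^r} q_1^{d_1}\cdots q_r^{d_r}\,\mathcal{F}_{\mathcal{H}_{n;\mathbf d}^{(r)}}(\mathbf{w})$, where for an $\mathbb{S}_n$-module $V$, $\mathcal{F}_V(\mathbf{w})=\sum_{\lambda\vdash n} m_\lambda S_\lambda(\mathbf{w})$ with $m_\lambda$ the multiplicity in $V$ of the irreducible indexed by $\lambda$, and $S_\lambda(\mathbf{w})$ the Schur function in auxiliary variables $\mathbf{w}=(w_1,w_2,\ldots)$. $s_\mu(q_1,\ldots,q_r)$ is the Schur polynomial in $r$ variables (zero if $\mu$ has more than $r$ parts). *)

theory Defs
  imports Complex_Main "HOL-Library.Poly_Mapping" "HOL-Library.FuncSet"
    "HOL-Combinatorics.Permutations"
begin

abbreviation "lookup \<equiv> Poly_Mapping.lookup"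
abbreviation "keys \<equiv> Poly_Mapping.keys"

section \<open>Free modules and their permutation actions\<close>

text \<open>
  The type \<open>'k \<Rightarrow>\<^sub>0 complex\<close> is the free complex vector space on \<open>'k\<close>.  It serves both for
  polynomials (\<open>'k\<close> = monomials) and for the span of tabloids.
\<close>

definition cscale :: "complex \<Rightarrow> ('k \<Rightarrow>\<^sub>0 complex) \<Rightarrow> ('k \<Rightarrow>\<^sub>0 complex)" where
  "cscale c p = Poly_Mapping.map ((*) c) p"

lemma lookup_cscale [simp]: "lookup (cscale c p) k = c * lookup p k"
  by (simp add: cscale_def Poly_Mapping.map.rep_eq when_def)

global_interpretation cvec: vector_space cscale
  by unfold_locales (auto intro!: poly_mapping_eqI simp: lookup_add algebra_simps)

definition pushforward :: "('k \<Rightarrow> 'l) \<Rightarrow> ('k \<Rightarrow>\<^sub>0 'b::comm_monoid_add) \<Rightarrow> ('l \<Rightarrow>\<^sub>0 'b)" where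
  "pushforward f p = (\<Sum>k\<in>keys p. Poly_Mapping.single (f k) (lookup p k))"


section \<open>Multiplicities in representations of the symmetric group\<close>

text \<open>The symmetric group is realised as the permutations of \<open>{..<n}\<close>; \<open>act\<close> is a left action.\<close>

definition submodule ::
    "nat \<Rightarrow> ((nat \<Rightarrow> nat) \<Rightarrow> ('k \<Rightarrow>\<^sub>0 complex) \<Rightarrow> ('k \<Rightarrow>\<^sub>0 complex)) \<Rightarrow> ('k \<Rightarrow>\<^sub>0 complex) set \<Rightarrow> bool" where
  "submodule n act U \<longleftrightarrow>
     cvec.subspace U \<and> (\<forall>\<sigma>. \<sigma> permutes {..<n} \<longrightarrow> (\<forall>u\<in>U. act \<sigma> u \<in> U))"

definition irreducible_module ::
    "nat \<Rightarrow> ((nat \<Rightarrow> nat) \<Rightarrow> ('k \<Rightarrow>\<^sub>0 complex) \<Rightarrow> ('k \<Rightarrow>\<^sub>0 complex)) \<Rightarrow> ('k \<Rightarrow>\<^sub>0 complex) set \<Rightarrow> bool" where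
  "irreducible_module n act U \<longleftrightarrow>
     submodule n act U \<and> U \<noteq> {0} \<and>
     (\<forall>W. submodule n act W \<and> W \<subseteq> U \<longrightarrow> W = {0} \<or> W = U)"

definition isomorphic_modules ::
    "nat \<Rightarrow> ((nat \<Rightarrow> nat) \<Rightarrow> ('k \<Rightarrow>\<^sub>0 complex) \<Rightarrow> ('k \<Rightarrow>\<^sub>0 complex)) \<Rightarrow> ('k \<Rightarrow>\<^sub>0 complex) set
         \<Rightarrow> ((nat \<Rightarrow> nat) \<Rightarrow> ('l \<Rightarrow>\<^sub>0 complex) \<Rightarrow> ('l \<Rightarrow>\<^sub>0 complex)) \<Rightarrow> ('l \<Rightarrow>\<^sub>0 complex) set \<Rightarrow> bool" where
  "isomorphic_modules n act U act' U' \<longleftrightarrow>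
     (\<exists>\<phi>. bij_betw \<phi> U U' \<and>
          (\<forall>u\<in>U. \<forall>v\<in>U. \<phi> (u + v) = \<phi> u + \<phi> v) \<and>
          (\<forall>c. \<forall>u\<in>U. \<phi> (cscale c u) = cscale c (\<phi> u)) \<and>
          (\<forall>\<sigma>. \<sigma> permutes {..<n} \<longrightarrow> (\<forall>u\<in>U. \<phi> (act \<sigma> u) = act' \<sigma> (\<phi> u))))"

definition direct_sum :: "nat \<Rightarrow> (nat \<Rightarrow> ('k \<Rightarrow>\<^sub>0 complex) set) \<Rightarrow> ('k \<Rightarrow>\<^sub>0 complex) set \<Rightarrow> bool" where
  "direct_sum k U V \<longleftrightarrow>
     bij_betw (\<lambda>u. \<Sum>i<k. u i) (\<Pi>\<^sub>E i\<in>{..<k}. U i) V"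

definition multiplicity_in ::
    "nat \<Rightarrow> ((nat \<Rightarrow> nat) \<Rightarrow> ('l \<Rightarrow>\<^sub>0 complex) \<Rightarrow> ('l \<Rightarrow>\<^sub>0 complex)) \<Rightarrow> ('l \<Rightarrow>\<^sub>0 complex) set
         \<Rightarrow> ((nat \<Rightarrow> nat) \<Rightarrow> ('k \<Rightarrow>\<^sub>0 complex) \<Rightarrow> ('k \<Rightarrow>\<^sub>0 complex)) \<Rightarrow> ('k \<Rightarrow>\<^sub>0 complex) set \<Rightarrow> nat" where
  "multiplicity_in n actS S actV V =
     (THE m. \<exists>k U. direct_sum k U V \<and> (\<forall>i<k. irreducible_module n actV (U i)) \<and>
                   m = card {i. i < k \<and> isomorphic_modules n actV (U i) actS S})"


section \<open>Partitions, tableaux and Schur functions\<close>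

definition partitions :: "nat \<Rightarrow> nat list set" where
  "partitions d = {\<nu>. sorted_wrt (\<ge>) \<nu> \<and> 0 \<notin> set \<nu> \<and> sum_list \<nu> = d}"

definition cells :: "nat list \<Rightarrow> (nat \<times> nat) set" where
  "cells \<nu> = {(i, j). i < length \<nu> \<and> j < \<nu> ! i}"

definition semistandard :: "nat list \<Rightarrow> (nat \<times> nat \<Rightarrow> nat) \<Rightarrow> bool" where
  "semistandard \<nu> T \<longleftrightarrow>
     (\<forall>i j. (i, j) \<in> cells \<nu> \<and> (i, Suc j) \<in> cells \<nu> \<longrightarrow> T (i, j) \<le> T (i, Suc j)) \<and>
     (\<forall>i j. (i, j) \<in> cells \<nu> \<and> (Suc i, j) \<in> cells \<nu> \<longrightarrow> T (i, j) < T (Suc i, j))"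

text \<open>
  The Schur function of shape \<open>\<nu>\<close> in variables indexed by \<open>A\<close>, as the formal power series
  \<open>\<Sum>T. z\<^sup>T\<close> over the semistandard tableaux \<open>T\<close> with entries in \<open>A\<close>: \<open>schur A \<nu> \<alpha>\<close> is the
  coefficient of \<open>z\<^sup>\<alpha>\<close>.
\<close>

definition schur :: "nat set \<Rightarrow> nat list \<Rightarrow> (nat \<Rightarrow>\<^sub>0 nat) \<Rightarrow> nat" where
  "schur A \<nu> \<alpha> =
     card {T \<in> cells \<nu> \<rightarrow>\<^sub>E A. semistandard \<nu> T \<and>
             (\<forall>k. card {c \<in> cells \<nu>. T c = k} = lookup \<alpha> k)}"

definition schur_function :: "nat list \<Rightarrow> (nat \<Rightarrow>\<^sub>0 nat) \<Rightarrow> nat" where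
  "schur_function = schur UNIV"

definition schur_polynomial :: "nat \<Rightarrow> nat list \<Rightarrow> (nat \<Rightarrow>\<^sub>0 nat) \<Rightarrow> nat" where
  "schur_polynomial r = schur {..<r}"


section \<open>Specht modules and the Frobenius characteristic\<close>

text \<open>
  A tabloid is the sequence of its row sets.  The Specht module is spanned by the polytabloids
  inside the free module on tabloids; in this convention \<open>[n]\<close> indexes the trivial module.
\<close>

definition tabloid :: "nat list \<Rightarrow> (nat \<times> nat \<Rightarrow> nat) \<Rightarrow> nat \<Rightarrow> nat set" where
  "tabloid \<nu> T i = T ` {c \<in> cells \<nu>. fst c = i}"

definition column_stabilizer :: "nat \<Rightarrow> nat list \<Rightarrow> (nat \<times> nat \<Rightarrow> nat) \<Rightarrow> (nat \<Rightarrow> nat) set" where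
  "column_stabilizer n \<nu> T =
     {\<kappa>. \<kappa> permutes {..<n} \<and>
         (\<forall>j. \<kappa> ` T ` {c \<in> cells \<nu>. snd c = j} = T ` {c \<in> cells \<nu>. snd c = j})}"

definition polytabloid ::
    "nat \<Rightarrow> nat list \<Rightarrow> (nat \<times> nat \<Rightarrow> nat) \<Rightarrow> ((nat \<Rightarrow> nat set) \<Rightarrow>\<^sub>0 complex)" where
  "polytabloid n \<nu> T =
     (\<Sum>\<kappa>\<in>column_stabilizer n \<nu> T.
        Poly_Mapping.single (tabloid \<nu> (\<kappa> \<circ> T)) (of_int (sign \<kappa>)))"

definition specht :: "nat \<Rightarrow> nat list \<Rightarrow> ((nat \<Rightarrow> nat set) \<Rightarrow>\<^sub>0 complex) set" where
  "specht n \<nu> = cvec.span {polytabloid n \<nu> T |T. bij_betw T (cells \<nu>) {..<n}}"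

definition act_tabloids ::
    "(nat \<Rightarrow> nat) \<Rightarrow> ((nat \<Rightarrow> nat set) \<Rightarrow>\<^sub>0 complex) \<Rightarrow> ((nat \<Rightarrow> nat set) \<Rightarrow>\<^sub>0 complex)" where
  "act_tabloids \<sigma> = pushforward (\<lambda>t i. \<sigma> ` t i)"

text \<open>\<open>frobenius n act V \<alpha>\<close> is the coefficient of \<open>w\<^sup>\<alpha>\<close> in the Frobenius characteristic.\<close>

definition frobenius ::
    "nat \<Rightarrow> ((nat \<Rightarrow> nat) \<Rightarrow> ('k \<Rightarrow>\<^sub>0 complex) \<Rightarrow> ('k \<Rightarrow>\<^sub>0 complex)) \<Rightarrow> ('k \<Rightarrow>\<^sub>0 complex) set
         \<Rightarrow> (nat \<Rightarrow>\<^sub>0 nat) \<Rightarrow> nat" where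
  "frobenius n act V \<alpha> =
     (\<Sum>\<nu>\<in>partitions n.
        multiplicity_in n act_tabloids (specht n \<nu>) act V * schur_function \<nu> \<alpha>)"


section \<open>Diagonally harmonic polynomials\<close>

text \<open>The variable in row \<open>i\<close> and column \<open>j\<close> of the matrix is \<open>(i, j)\<close>, counted from \<open>0\<close>.\<close>

type_synonym mono = "(nat \<times> nat) \<Rightarrow>\<^sub>0 nat"
type_synonym cpoly = "mono \<Rightarrow>\<^sub>0 complex"

definition poly_ring :: "nat \<Rightarrow> nat \<Rightarrow> cpoly set" where
  "poly_ring r n = {p. \<forall>m\<in>keys p. keys m \<subseteq> {..<r} \<times> {..<n}}"

text \<open>
  \<open>f(X) \<mapsto> f(X \<sigma>)\<close> replaces \<open>x\<^sub>i\<^sub>j\<close> by \<open>x\<^sub>i\<^sub>\<sigma>\<^sub>(\<^sub>j\<^sub>)\<close>: the inner pushforward does so in a monomial, the outer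
  one extends linearly.
\<close>

definition act_poly :: "(nat \<Rightarrow> nat) \<Rightarrow> cpoly \<Rightarrow> cpoly" where
  "act_poly \<sigma> = pushforward (pushforward (\<lambda>(i, j). (i, \<sigma> j)))"

definition invariants_pos :: "nat \<Rightarrow> nat \<Rightarrow> cpoly set" where
  "invariants_pos r n =
     {f \<in> poly_ring r n. (\<forall>\<sigma>. \<sigma> permutes {..<n} \<longrightarrow> act_poly \<sigma> f = f) \<and> lookup f 0 = 0}"

definition invariant_ideal :: "nat \<Rightarrow> nat \<Rightarrow> cpoly set" where
  "invariant_ideal r n =
     {\<Sum>f\<in>F. a f * f |F a. finite F \<and> F \<subseteq> invariants_pos r n \<and> (\<forall>f\<in>F. a f \<in> poly_ring r n)}"

definition partial :: "nat \<times> nat \<Rightarrow> cpoly \<Rightarrow> cpoly" where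
  "partial v g =
     (\<Sum>m\<in>keys g. Poly_Mapping.single (m - Poly_Mapping.single v 1)
                     (of_nat (lookup m v) * lookup g m))"

lemma lookup_partial:
  "lookup (partial v g) m = of_nat (lookup m v + 1) * lookup g (m + Poly_Mapping.single v 1)"
proof -
  let ?s = "Poly_Mapping.single v (1::nat)"
  have "lookup (partial v g) m =
      (\<Sum>k\<in>keys g. if k - ?s = m then of_nat (lookup k v) * lookup g k else 0)"
    unfolding partial_def lookup_sum by (intro sum.cong) (auto simp: lookup_single when_def)
  also have "\<dots> = (\<Sum>k\<in>keys g. if k = m + ?s then of_nat (lookup k v) * lookup g k else 0)"
  proof (intro sum.cong refl)
    fix k
    show "(if k - ?s = m then of_nat (lookup k v) * lookup g k else 0) =
          (if k = m + ?s then of_nat (lookup k v) * lookup g k else 0)"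
    proof (cases "lookup k v = 0")
      case False
      have "k = (k - ?s) + ?s"
        using False by (intro poly_mapping_eqI)
          (auto simp: lookup_add lookup_minus lookup_single when_def)
      hence "k - ?s = m \<longleftrightarrow> k = m + ?s" by (metis add_diff_cancel_right')
      thus ?thesis by simp
    qed simp
  qed
  also have "\<dots> = of_nat (lookup m v + 1) * lookup g (m + ?s)"
    by (auto simp: sum.delta lookup_add in_keys_iff)
  finally show ?thesis .
qed

lemma partial_commute: "partial u (partial v g) = partial v (partial u g)"
  by (intro poly_mapping_eqI)
     (auto simp: lookup_partial lookup_add lookup_single when_def ac_simps)

lemma comp_fun_commute_partial: "comp_fun_commute (\<lambda>v. partial v ^^ (e v :: nat))"
proof
  fix u v
  have 1: "partial a \<circ> (partial b ^^ k) = (partial b ^^ k) \<circ> partial a" for a b k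
    by (induction k) (auto simp: fun_eq_iff, metis partial_commute)
  have "(partial v ^^ l) \<circ> (partial u ^^ k) = (partial u ^^ k) \<circ> (partial v ^^ l)" for k l
    by (induction l) (auto simp: fun_eq_iff, metis 1 comp_apply)
  thus "(partial v ^^ e v) \<circ> (partial u ^^ e u) = (partial u ^^ e u) \<circ> (partial v ^^ e v)" .
qed

definition diff_mono :: "mono \<Rightarrow> cpoly \<Rightarrow> cpoly" where
  "diff_mono m g = Finite_Set.fold (\<lambda>v. partial v ^^ lookup m v) g (keys m)"

definition diff_op :: "cpoly \<Rightarrow> cpoly \<Rightarrow> cpoly" where
  "diff_op f g = (\<Sum>m\<in>keys f. cscale (lookup f m) (diff_mono m g))"

definition harmonics :: "nat \<Rightarrow> nat \<Rightarrow> cpoly set" where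
  "harmonics r n = {g \<in> poly_ring r n. \<forall>f\<in>invariant_ideal r n. diff_op f g = 0}"

definition harmonics_deg :: "nat \<Rightarrow> nat \<Rightarrow> (nat \<Rightarrow>\<^sub>0 nat) \<Rightarrow> cpoly set" where
  "harmonics_deg r n d =
     {g \<in> harmonics r n. \<forall>m\<in>keys g. \<forall>i<r. (\<Sum>j<n. lookup m (i, j)) = lookup d i}"

text \<open>
  \<open>graded_frobenius r n d \<alpha>\<close> is the coefficient of \<open>q\<^sup>d w\<^sup>\<alpha>\<close>; the multidegrees in \<open>\<nat>\<^sup>r\<close> are the
  \<open>d\<close> supported on \<open>{..<r}\<close>.
\<close>

definition graded_frobenius :: "nat \<Rightarrow> nat \<Rightarrow> (nat \<Rightarrow>\<^sub>0 nat) \<Rightarrow> (nat \<Rightarrow>\<^sub>0 nat) \<Rightarrow> nat" where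
  "graded_frobenius r n d \<alpha> =
     (if keys d \<subseteq> {..<r} then frobenius n act_poly (harmonics_deg r n d) \<alpha> else 0)"

end

theory Submission
  imports Defs "HOL-Computational_Algebra.Fundamental_Theorem_Algebra"
begin

text \<open>
  An irreducible module \<open>S\<close> generated by \<open>s\<close> occurs in \<open>V\<close> with multiplicity the dimension of the space of
  all \<open>v \<in> V\<close> that are annihilated by the annihilator of \<open>s\<close> in the group algebra.  With coefficients taken with
  respect to divided powers, differentiation shifts indices, and \<open>g\<close> is harmonic iff the sum of its coefficients
  at \<open>m + \<sigma> b\<close> over all \<open>\<sigma>\<close> vanishes whenever \<open>b \<noteq> 0\<close>.  Polarization therefore identifies the harmonics of
  multidegree \<open>d\<close> with the invariants, under the stabilizer of a word of content \<open>d\<close>, in a space of functions on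
  words of length \<open>k = |d|\<close> in \<open>n\<close> letters.  This space does not depend on \<open>r\<close>, and the permutations of the
  \<open>k\<close> positions acting on it commute with those of the \<open>n\<close> letters.

  For every module \<open>N\<close> of the symmetric group on \<open>k\<close> points, these invariants have dimension the sum over \<open>\<mu>\<close> of the
  Kostka number of \<open>\<mu>\<close> and \<open>d\<close> times the dimension of the image of \<open>N\<close> under the Young symmetrizer of \<open>\<mu>\<close>;
  the coefficients sought are these last dimensions.  Indeed the semistandard tableaux give independent vectors in the
  permutation module on the words of content \<open>d\<close>, and they exhaust it, because the number of pairs of a semistandard
  tableau of content \<open>d\<close> and a standard tableau of the same shape is the number of such words.

  Shapes with more than \<open>n\<close> rows contribute nothing, since an antisymmetrizer on \<open>n + 1\<close> positions kills
  every word in \<open>n\<close> letters.  In degree above \<open>n choose 2\<close> some letter \<open>i\<close>, counted from \<open>0\<close>, occurs at least \<open>n - i\<close>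
  times in a word, and the harmonicity relations express the value at that word by values at words with smaller sum.
\<close>

text \<open>A multiplicity is defined through a decomposition into irreducible summands, so it has a
  meaning only once the count is known to be the same for all decompositions. Identifying it with
  the dimension of a space that mentions no decomposition settles this, and dimensions are what
  polarization can transport. The parameter \<open>r\<close> then survives only in the content of
  the chosen word: the functions on words see \<open>n\<close> and \<open>k\<close> alone, and the
  Kostka numbers are the coefficients of Schur polynomials in \<open>r\<close> variables. The main
  obstacle is completeness. Independence of the vectors attached to tableaux is a triangularity, but
  spanning needs a dimension count in which the left ideal of a Young symmetrizer is only bounded
  below, by the number of standard tableaux. The count of pairs of tableaux, proved with growth
  diagrams, makes this bound suffice. The degree bound polarizes a fact about one set of variables:
  modulo the invariants, the power \<open>n - i\<close> of the variable with index \<open>i\<close>,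
  counted from 0, reduces to smaller monomials.\<close>

section \<open>Linear algebra in free modules\<close>

global_interpretation cpair: vector_space_pair cscale cscale ..

abbreviation clinear :: "(('k \<Rightarrow>\<^sub>0 complex) \<Rightarrow> ('l \<Rightarrow>\<^sub>0 complex)) \<Rightarrow> bool" where
  "clinear \<equiv> Vector_Spaces.linear cscale cscale"

lemma clinearI:
  assumes "\<And>u v. f (u + v) = f u + f v" "\<And>c u. f (cscale c u) = cscale c (f u)"
  shows "clinear f"
  using assms by (simp add: Vector_Spaces.linear_iff cvec.vector_space_axioms)

lemma clinear_sum_scale:
  "clinear f \<Longrightarrow> f (\<Sum>i\<in>I. cscale (s i) (v i)) = (\<Sum>i\<in>I. cscale (s i) (f (v i)))"
  by (simp add: cpair.linear_sum cpair.linear_scale)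

lemma cscale_sum_left: "cscale (sum c A) v = (\<Sum>a\<in>A. cscale (c a) v)"
  by (rule cvec.scale_sum_left)

text \<open>\<open>cvec.dim\<close> is the cardinality of a basis, hence 0 when a basis is infinite,
  and the ambient spaces may be infinite-dimensional. Dimension comparisons therefore carry this
  side condition.\<close>

definition fd :: "('k \<Rightarrow>\<^sub>0 complex) set \<Rightarrow> bool" where
  "fd V \<longleftrightarrow> (\<exists>B. finite B \<and> V \<subseteq> cvec.span B)"

lemma fd_subset: "fd V \<Longrightarrow> W \<subseteq> V \<Longrightarrow> fd W"
  unfolding fd_def by blast

lemma fd_indep:
  assumes "fd V" "cvec.independent s" "s \<subseteq> V"
  shows "finite s" "card s \<le> cvec.dim V"
proof -
  obtain B0 where B0: "finite B0" "V \<subseteq> cvec.span B0" using assms(1) unfolding fd_def by blast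
  show "finite s" using cvec.independent_span_bound[OF B0(1) assms(2)] assms(3) B0(2) by blast
  obtain B where B: "B \<subseteq> V" "cvec.independent B" "V \<subseteq> cvec.span B" "card B = cvec.dim V"
    using cvec.basis_exists by blast
  have "finite B" using cvec.independent_span_bound[OF B0(1) B(2)] B(1) B0(2) by blast
  thus "card s \<le> cvec.dim V"
    using cvec.independent_span_bound[OF _ assms(2), of B] assms(3) B by auto
qed

lemma fd_basis:
  assumes "fd V" "cvec.subspace V"
  obtains B where "finite B" "B \<subseteq> V" "cvec.independent B" "cvec.span B = V" "card B = cvec.dim V"
proof -
  obtain B where B: "B \<subseteq> V" "cvec.independent B" "V \<subseteq> cvec.span B" "card B = cvec.dim V"
    using cvec.basis_exists by blast
  thus ?thesis using that[of B] fd_indep[OF assms(1) B(2,1)] cvec.span_subspace assms(2) by blast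
qed

lemma fd_indep_spans:
  assumes "fd V" "cvec.subspace V" "cvec.independent s" "s \<subseteq> V" "cvec.dim V \<le> card s"
  shows "cvec.span s = V"
proof (rule ccontr)
  assume "cvec.span s \<noteq> V"
  moreover have "cvec.span s \<subseteq> V" using assms cvec.span_minimal by blast
  ultimately obtain a where a: "a \<in> V" "a \<notin> cvec.span s" by blast
  have "cvec.independent (insert a s)" using a assms cvec.independent_insertI by blast
  from fd_indep[OF assms(1) this] a assms have "finite s" "card (insert a s) \<le> cvec.dim V" by auto
  moreover have "a \<notin> s" using a cvec.span_base by blast
  ultimately show False using assms(5) by simp
qed

lemma fd_dim_less:
  assumes "fd V" "cvec.subspace V" "cvec.subspace W" "W \<subset> V"
  shows "cvec.dim W < cvec.dim V"
proof -
  obtain B where B: "finite B" "B \<subseteq> W" "cvec.independent B" "cvec.span B = W" "card B = cvec.dim W"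
    using fd_basis[of W] fd_subset assms by blast
  show ?thesis using fd_indep_spans[of V B] B assms by fastforce
qed

lemma dim_linear_inj:
  assumes "clinear f" "cvec.subspace V" "inj_on f V"
  shows "cvec.dim (f ` V) = cvec.dim V"
proof -
  obtain B where B: "B \<subseteq> V" "cvec.independent B" "V \<subseteq> cvec.span B" "card B = cvec.dim V"
    using cvec.basis_exists by blast
  have sp: "cvec.span B = V" using B assms(2) cvec.span_subspace by blast
  have "cvec.independent (f ` B)"
    using cpair.linear_independent_injective_image[OF assms(1) B(2)] sp assms(3) by simp
  moreover have "f ` V \<subseteq> cvec.span (f ` B)" using cpair.linear_span_image[OF assms(1), of B] sp by simp
  moreover have "card (f ` B) = card B" using card_image inj_on_subset[OF assms(3) B(1)] by blast
  moreover have "f ` B \<subseteq> f ` V" using B(1) by blast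
  ultimately show ?thesis using B(1,4) cvec.basis_card_eq_dim[of "f ` B" "f ` V"] by simp
qed

text \<open>A family may repeat a vector a priori, which a set of vectors cannot express. On finite
  index sets independence makes it injective, and \<open>indep_fam_independent\<close> returns to
  sets.\<close>

definition indep_fam :: "'i set \<Rightarrow> ('i \<Rightarrow> ('k \<Rightarrow>\<^sub>0 complex)) \<Rightarrow> bool" where
  "indep_fam I v \<longleftrightarrow> (\<forall>s. (\<Sum>i\<in>I. cscale (s i) (v i)) = 0 \<longrightarrow> (\<forall>i\<in>I. s i = 0))"

lemma indep_famD: "indep_fam I v \<Longrightarrow> (\<Sum>i\<in>I. cscale (s i) (v i)) = 0 \<Longrightarrow> i \<in> I \<Longrightarrow> s i = 0"
  unfolding indep_fam_def by blast

lemma indep_fam_inj: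
  assumes "finite I" "indep_fam I v"
  shows "inj_on v I"
proof (rule inj_onI, rule ccontr)
  fix i j assume ij: "i \<in> I" "j \<in> I" "v i = v j" "i \<noteq> j"
  let ?s = "\<lambda>l. if l = i then 1 else if l = j then -1 else (0::complex)"
  have "(\<Sum>l\<in>I. cscale (?s l) (v l)) = (\<Sum>l\<in>{i,j}. cscale (?s l) (v l))"
    using assms(1) ij by (intro sum.mono_neutral_right) auto
  also have "\<dots> = 0" using ij by simp
  finally show False using indep_famD[OF assms(2), of ?s i] ij by simp
qed

lemma indep_fam_independent:
  assumes "finite I" "indep_fam I v"
  shows "cvec.independent (v ` I)"
proof (rule cvec.independent_if_scalars_zero)
  fix f x assume f: "(\<Sum>x\<in>v ` I. cscale (f x) x) = 0" and x: "x \<in> v ` I"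
  have "(\<Sum>i\<in>I. cscale (f (v i)) (v i)) = 0"
    using f sum.reindex[OF indep_fam_inj[OF assms], of "\<lambda>x. cscale (f x) x"] by simp
  thus "f x = 0" using indep_famD[OF assms(2), of "\<lambda>i. f (v i)"] x by auto
qed (use assms in auto)

lemma indep_fam_card_le:
  assumes "finite I" "indep_fam I v" "v ` I \<subseteq> V" "fd V"
  shows "card I \<le> cvec.dim V"
  using fd_indep(2)[OF assms(4) indep_fam_independent[OF assms(1,2)] assms(3)]
    card_image[OF indep_fam_inj[OF assms(1,2)]] by simp

lemma indep_fam_spans:
  assumes "finite I" "indep_fam I v" "v ` I \<subseteq> V" "fd V" "cvec.subspace V" "cvec.dim V \<le> card I"
    and "x \<in> V"
  obtains s where "x = (\<Sum>i\<in>I. cscale (s i) (v i))"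
proof -
  have inj: "inj_on v I" using indep_fam_inj assms by blast
  have "cvec.span (v ` I) = V"
    using fd_indep_spans[OF assms(4,5) indep_fam_independent[OF assms(1,2)] assms(3)]
      assms(6) card_image[OF inj] by simp
  then obtain u where "x = (\<Sum>y\<in>v ` I. cscale (u y) y)"
    using assms(1,7) cvec.span_finite[of "v ` I"] by auto
  hence "x = (\<Sum>i\<in>I. cscale (u (v i)) (v i))" by (simp add: sum.reindex[OF inj])
  thus ?thesis by (rule that)
qed

lemma dim_eq_card_fam:
  assumes "finite I" "indep_fam I v" "v ` I \<subseteq> V"
    and "\<And>x. x \<in> V \<Longrightarrow> \<exists>s. x = (\<Sum>i\<in>I. cscale (s i) (v i))"
  shows "cvec.dim V = card I"
proof -
  have "V \<subseteq> cvec.span (v ` I)"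
  proof
    fix x assume "x \<in> V"
    then obtain s where s: "x = (\<Sum>i\<in>I. cscale (s i) (v i))" using assms(4) by blast
    show "x \<in> cvec.span (v ` I)"
      unfolding s by (intro cvec.span_sum cvec.span_scale cvec.span_base) auto
  qed
  thus ?thesis
    using cvec.basis_card_eq_dim[OF assms(3) _ indep_fam_independent[OF assms(1,2)]]
      card_image[OF indep_fam_inj[OF assms(1,2)]] by simp
qed

text \<open>Independence may be tested after applying a linear map; this moves it from spaces of
  words back into the group algebra.\<close>

lemma indep_fam_linear:
  assumes "clinear f" "indep_fam I (\<lambda>i. f (v i))"
  shows "indep_fam I v"
  unfolding indep_fam_def
proof (intro allI impI ballI)
  fix s i assume s: "(\<Sum>i\<in>I. cscale (s i) (v i)) = 0" and i: "i \<in> I"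
  have "(\<Sum>i\<in>I. cscale (s i) (f (v i))) = f (\<Sum>i\<in>I. cscale (s i) (v i))"
    using clinear_sum_scale[OF assms(1)] by metis
  also have "\<dots> = 0" using s cpair.linear_0[OF assms(1)] by simp
  finally show "s i = 0" using indep_famD[OF assms(2)] i by blast
qed

lemma indep_fam_id_basis:
  assumes "finite B" "cvec.independent B"
  shows "indep_fam B (\<lambda>b. b)"
  unfolding indep_fam_def using cvec.independentD[OF assms(2,1)] by blast

text \<open>The maps \<open>f i\<close> and \<open>g i\<close> are the injections and projections of
  an external direct sum, so different indices may carry the same subspace \<open>U i\<close>. In
  the application an index is a shape together with a tableau, and \<open>U\<close> depends on the
  shape only.\<close>

lemma dim_direct:
  fixes U :: "'i \<Rightarrow> ('k \<Rightarrow>\<^sub>0 complex) set"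
  assumes I: "finite I" and U: "\<And>i. i \<in> I \<Longrightarrow> cvec.subspace (U i)" "\<And>i. i \<in> I \<Longrightarrow> fd (U i)"
    and lin: "\<And>i. i \<in> I \<Longrightarrow> clinear (f i)" "\<And>i. i \<in> I \<Longrightarrow> clinear (g i)"
    and fV: "\<And>i u. i \<in> I \<Longrightarrow> u \<in> U i \<Longrightarrow> f i u \<in> V"
    and gU: "\<And>i v. i \<in> I \<Longrightarrow> v \<in> V \<Longrightarrow> g i v \<in> U i"
    and gf: "\<And>i j u. i \<in> I \<Longrightarrow> j \<in> I \<Longrightarrow> u \<in> U j \<Longrightarrow> g i (f j u) = (if i = j then u else 0)"
    and fg: "\<And>v. v \<in> V \<Longrightarrow> v = (\<Sum>i\<in>I. f i (g i v))"
  shows "cvec.dim V = (\<Sum>i\<in>I. cvec.dim (U i))"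
proof -
  have "\<forall>i\<in>I. \<exists>B. finite B \<and> B \<subseteq> U i \<and> cvec.independent B \<and> cvec.span B = U i \<and> card B = cvec.dim (U i)"
    using U fd_basis by metis
  then obtain B where B: "\<And>i. i \<in> I \<Longrightarrow> finite (B i)" "\<And>i. i \<in> I \<Longrightarrow> B i \<subseteq> U i"
    "\<And>i. i \<in> I \<Longrightarrow> cvec.independent (B i)" "\<And>i. i \<in> I \<Longrightarrow> cvec.span (B i) = U i"
    "\<And>i. i \<in> I \<Longrightarrow> card (B i) = cvec.dim (U i)" by metis
  let ?J = "Sigma I B" and ?v = "\<lambda>(i, b). f i b"
  have fin: "finite ?J" using I B(1) by blast
  have split: "(\<Sum>x\<in>?J. cscale (s x) (?v x)) = (\<Sum>i\<in>I. f i (\<Sum>b\<in>B i. cscale (s (i, b)) b))" for s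
  proof -
    have "(\<Sum>x\<in>?J. cscale (s x) (?v x)) = (\<Sum>i\<in>I. \<Sum>b\<in>B i. cscale (s (i, b)) (f i b))"
      using I B(1) by (subst sum.Sigma) (auto intro!: sum.cong)
    also have "\<dots> = (\<Sum>i\<in>I. f i (\<Sum>b\<in>B i. cscale (s (i, b)) b))"
    proof (intro sum.cong refl)
      fix i assume "i \<in> I"
      thus "(\<Sum>b\<in>B i. cscale (s (i, b)) (f i b)) = f i (\<Sum>b\<in>B i. cscale (s (i, b)) b)"
        using clinear_sum_scale[OF lin(1), of i "\<lambda>b. s (i, b)" "\<lambda>b. b" "B i"] by simp
    qed
    finally show ?thesis .
  qed
  have inU: "(\<Sum>b\<in>B i. cscale (t b) b) \<in> U i" if "i \<in> I" for t i
    using that B(2) U by (intro cvec.subspace_sum cvec.subspace_scale) auto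
  have "cvec.dim V = card ?J"
  proof (rule dim_eq_card_fam[OF fin, of ?v])
    show "indep_fam ?J ?v" unfolding indep_fam_def
    proof (intro allI impI ballI)
      fix s x assume s: "(\<Sum>x\<in>?J. cscale (s x) (?v x)) = 0" and "x \<in> ?J"
      then obtain i b where x: "x = (i, b)" "i \<in> I" "b \<in> B i" by blast
      let ?u = "\<lambda>j. \<Sum>b\<in>B j. cscale (s (j, b)) b"
      have "0 = g i (\<Sum>j\<in>I. f j (?u j))"
        using s split[of s] cpair.linear_0[OF lin(2)[OF x(2)]] by simp
      also have "\<dots> = (\<Sum>j\<in>I. g i (f j (?u j)))" using cpair.linear_sum[OF lin(2)[OF x(2)]] by simp
      also have "\<dots> = (\<Sum>j\<in>I. if j = i then ?u i else 0)"
        using gf inU x(2) by (intro sum.cong refl) auto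
      also have "\<dots> = ?u i" using I x(2) by simp
      finally show "s x = 0"
        using indep_famD[OF indep_fam_id_basis[OF B(1,3)], of i "\<lambda>b. s (i, b)"] x by simp
    qed
    show "?v ` ?J \<subseteq> V" using fV B(2) by auto
    fix x assume x: "x \<in> V"
    have "\<forall>i\<in>I. \<exists>t. g i x = (\<Sum>b\<in>B i. cscale (t b) b)"
      using gU[OF _ x] B(4) cvec.span_finite[OF B(1)] by (metis (no_types, lifting) imageE)
    then obtain t where t: "\<And>i. i \<in> I \<Longrightarrow> g i x = (\<Sum>b\<in>B i. cscale (t i b) b)" by metis
    have "x = (\<Sum>x\<in>?J. cscale ((\<lambda>(i,b). t i b) x) (?v x))"
      using fg[OF x] split[of "\<lambda>(i,b). t i b"] t by simp
    thus "\<exists>s. x = (\<Sum>x\<in>?J. cscale (s x) (?v x))" by blast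
  qed
  thus ?thesis using B(1,5) I by simp
qed

section \<open>Coordinates in free modules and actions that permute a basis\<close>

lemma poly_mapping_sum_single:
  assumes "finite A" "keys p \<subseteq> A"
  shows "p = (\<Sum>k\<in>A. Poly_Mapping.single k (lookup p k))"
proof (rule poly_mapping_eqI)
  fix j
  have "(\<Sum>k\<in>A. lookup (Poly_Mapping.single k (lookup p k)) j) = (\<Sum>k\<in>A. if k = j then lookup p j else 0)"
    by (intro sum.cong) (auto simp: lookup_single when_def)
  also have "\<dots> = lookup p j" using assms by (auto simp: in_keys_iff)
  finally show "lookup p j = lookup (\<Sum>k\<in>A. Poly_Mapping.single k (lookup p k)) j"
    by (simp add: lookup_sum)
qed

lemma cscale_single: "cscale c (Poly_Mapping.single k x) = Poly_Mapping.single k (c * x)"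
  by (rule poly_mapping_eqI) (auto simp: lookup_single when_def)

lemma subspace_supported: "cvec.subspace {p. keys p \<subseteq> A}"
  by (rule cvec.subspaceI) (auto simp: in_keys_iff lookup_add subset_iff, metis add_0)

lemma indep_fam_single: "finite A \<Longrightarrow> indep_fam A (\<lambda>a. Poly_Mapping.single a 1)"
  unfolding indep_fam_def
proof (intro allI impI ballI)
  fix s a assume "finite A" and s: "(\<Sum>i\<in>A. cscale (s i) (Poly_Mapping.single i 1)) = 0" and a: "a \<in> A"
  have "0 = lookup (\<Sum>i\<in>A. cscale (s i) (Poly_Mapping.single i 1)) a" using s by simp
  also have "\<dots> = (\<Sum>i\<in>A. if i = a then s a else 0)"
    unfolding lookup_sum by (intro sum.cong) (auto simp: lookup_single when_def)
  finally show "s a = 0" using \<open>finite A\<close> a by simp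
qed

lemma dim_supported:
  assumes "finite A"
  shows "cvec.dim {p :: 'k \<Rightarrow>\<^sub>0 complex. keys p \<subseteq> A} = card A"
proof (rule dim_eq_card_fam[OF assms indep_fam_single[OF assms]])
  fix p :: "'k \<Rightarrow>\<^sub>0 complex" assume "p \<in> {p. keys p \<subseteq> A}"
  thus "\<exists>s. p = (\<Sum>i\<in>A. cscale (s i) (Poly_Mapping.single i 1))"
    using poly_mapping_sum_single[OF assms, of p] by (intro exI[of _ "lookup p"]) (simp add: cscale_single)
qed auto

lemma fd_supported:
  assumes "finite A" "\<And>p. p \<in> V \<Longrightarrow> keys p \<subseteq> A"
  shows "fd V"
  unfolding fd_def
proof (intro exI conjI subsetI)
  show "finite ((\<lambda>a. Poly_Mapping.single a (1::complex)) ` A)" using assms by simp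
  fix p assume "p \<in> V"
  hence "p = (\<Sum>a\<in>A. cscale (lookup p a) (Poly_Mapping.single a 1))"
    using poly_mapping_sum_single[OF assms(1) assms(2)] by (simp add: cscale_single)
  also have "\<dots> \<in> cvec.span ((\<lambda>a. Poly_Mapping.single a 1) ` A)"
    by (intro cvec.span_sum cvec.span_scale cvec.span_base) auto
  finally show "p \<in> cvec.span ((\<lambda>a. Poly_Mapping.single a 1) ` A)" .
qed

lemma lookup_pushforward:
  assumes "\<And>k. g (f k) = k" "\<And>l. f (g l) = l"
  shows "lookup (pushforward f p) l = lookup p (g l)"
proof -
  have "lookup (pushforward f p) l = (\<Sum>k\<in>keys p. if k = g l then lookup p (g l) else 0)"
    unfolding pushforward_def lookup_sum using assms
    by (intro sum.cong) (auto simp: lookup_single when_def)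
  thus ?thesis by (auto simp: in_keys_iff)
qed

lemma pushforward_single: "pushforward f (Poly_Mapping.single k x) = Poly_Mapping.single (f k) x"
  by (cases "x = 0") (auto simp: pushforward_def)

text \<open>The action is required for all bijections of the naturals rather than for the
  permutations of one interval, so that a single interpretation serves every number of letters or
  positions.\<close>

locale perm_rep =
  fixes act :: "(nat \<Rightarrow> nat) \<Rightarrow> ('k \<Rightarrow>\<^sub>0 complex) \<Rightarrow> ('k \<Rightarrow>\<^sub>0 complex)"
  assumes lin: "bij \<sigma> \<Longrightarrow> clinear (act \<sigma>)"
    and act_id: "act id v = v"
    and act_comp: "bij \<sigma> \<Longrightarrow> bij \<tau> \<Longrightarrow> act (\<sigma> \<circ> \<tau>) v = act \<sigma> (act \<tau> v)"
begin

lemmas act_add = cpair.linear_add[OF lin]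
  and act_scale = cpair.linear_scale[OF lin]
  and act_sum = cpair.linear_sum[OF lin]
  and act_0 = cpair.linear_0[OF lin]

lemma act_inv: "bij \<sigma> \<Longrightarrow> act (inv \<sigma>) (act \<sigma> v) = v" "bij \<sigma> \<Longrightarrow> act \<sigma> (act (inv \<sigma>) v) = v"
  by (metis act_comp act_id bij_imp_bij_inv bij_is_inj inv_o_cancel)
     (metis act_comp act_id bij_imp_bij_inv bij_is_surj surj_iff)

end

locale key_action =
  fixes F :: "(nat \<Rightarrow> nat) \<Rightarrow> 'k \<Rightarrow> 'k"
  assumes F_id: "F id k = k"
    and F_comp: "bij \<sigma> \<Longrightarrow> bij \<tau> \<Longrightarrow> F (\<sigma> \<circ> \<tau>) k = F \<sigma> (F \<tau> k)"
begin

lemma F_inv: "bij \<sigma> \<Longrightarrow> F (inv \<sigma>) (F \<sigma> v) = v" "bij \<sigma> \<Longrightarrow> F \<sigma> (F (inv \<sigma>) v) = v"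
  by (metis F_comp F_id bij_imp_bij_inv bij_is_inj inv_o_cancel)
     (metis F_comp F_id bij_imp_bij_inv bij_is_surj surj_iff)

lemma lookup_push: "bij \<sigma> \<Longrightarrow> lookup (pushforward (F \<sigma>) p) l = lookup p (F (inv \<sigma>) l)"
  by (rule lookup_pushforward) (auto simp: F_inv)

lemma perm_rep: "perm_rep (\<lambda>\<sigma>. pushforward (F \<sigma>) :: ('k \<Rightarrow>\<^sub>0 complex) \<Rightarrow> ('k \<Rightarrow>\<^sub>0 complex))"
proof (rule perm_rep.intro)
  fix \<sigma> :: "nat \<Rightarrow> nat" assume \<sigma>: "bij \<sigma>"
  show "clinear (pushforward (F \<sigma>) :: ('k \<Rightarrow>\<^sub>0 complex) \<Rightarrow> ('k \<Rightarrow>\<^sub>0 complex))"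
    by (rule clinearI) (auto intro!: poly_mapping_eqI simp: lookup_push[OF \<sigma>] lookup_add)
  fix \<tau> :: "nat \<Rightarrow> nat" and v :: "'k \<Rightarrow>\<^sub>0 complex" assume \<tau>: "bij \<tau>"
  show "pushforward (F (\<sigma> \<circ> \<tau>)) v = pushforward (F \<sigma>) (pushforward (F \<tau>) v)"
    using \<sigma> \<tau> by (intro poly_mapping_eqI)
      (simp add: lookup_push bij_comp o_inv_distrib F_comp bij_imp_bij_inv)
next
  fix v :: "'k \<Rightarrow>\<^sub>0 complex"
  show "pushforward (F id) v = v"
    by (rule poly_mapping_eqI) (simp add: lookup_push F_id)
qed

end

section \<open>Multiplicities as dimensions\<close>

abbreviation perms :: "nat \<Rightarrow> (nat \<Rightarrow> nat) set" where
  "perms n \<equiv> {\<sigma>. \<sigma> permutes {..<n}}"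

lemma finite_perms [simp]: "finite (perms n)"
  by (simp add: finite_permutations)

lemma card_perms: "card (perms n) = fact n"
  by (rule card_permutations) auto

lemma perms_bij: "\<sigma> \<in> perms n \<Longrightarrow> bij \<sigma>"
  by (simp add: permutes_bij)

lemma sum_perms_comp:
  assumes "\<tau> \<in> perms n"
  shows "(\<Sum>\<sigma>\<in>perms n. f (\<tau> \<circ> \<sigma>)) = (\<Sum>\<sigma>\<in>perms n. f \<sigma>)"
  by (rule sum.reindex_bij_witness[of _ "\<lambda>\<sigma>. inv \<tau> \<circ> \<sigma>" "\<lambda>\<sigma>. \<tau> \<circ> \<sigma>"])
     (use assms in \<open>auto simp: permutes_compose permutes_inv o_assoc permutes_inv_o\<close>)

text \<open>An element of the group algebra given as a bare coefficient function on permutations.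
  This is enough to speak of annihilators; the algebra with its product appears later as
  \<open>galg\<close>.\<close>

definition gact :: "nat \<Rightarrow> ((nat \<Rightarrow> nat) \<Rightarrow> ('k \<Rightarrow>\<^sub>0 complex) \<Rightarrow> ('k \<Rightarrow>\<^sub>0 complex)) \<Rightarrow>
    ((nat \<Rightarrow> nat) \<Rightarrow> complex) \<Rightarrow> ('k \<Rightarrow>\<^sub>0 complex) \<Rightarrow> ('k \<Rightarrow>\<^sub>0 complex)" where
  "gact n act x v = (\<Sum>\<sigma>\<in>perms n. cscale (x \<sigma>) (act \<sigma> v))"

text \<open>
  If \<open>S\<close> is generated by \<open>s\<close>, a homomorphism from \<open>S\<close> to \<open>V\<close> is determined by the image of \<open>s\<close>; so
  \<open>hom_image n actS s act V\<close> is a copy of the space of homomorphisms inside \<open>V\<close>.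
\<close>

definition hom_image :: "nat \<Rightarrow> ((nat \<Rightarrow> nat) \<Rightarrow> ('l \<Rightarrow>\<^sub>0 complex) \<Rightarrow> ('l \<Rightarrow>\<^sub>0 complex)) \<Rightarrow> ('l \<Rightarrow>\<^sub>0 complex) \<Rightarrow>
    ((nat \<Rightarrow> nat) \<Rightarrow> ('k \<Rightarrow>\<^sub>0 complex) \<Rightarrow> ('k \<Rightarrow>\<^sub>0 complex)) \<Rightarrow> ('k \<Rightarrow>\<^sub>0 complex) set \<Rightarrow> ('k \<Rightarrow>\<^sub>0 complex) set" where
  "hom_image n actS s act V = {v \<in> V. \<forall>x. gact n actS x s = 0 \<longrightarrow> gact n act x v = 0}"

context perm_rep
begin

lemma gact_linear: "clinear (gact n act x)"
proof (rule clinearI)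
  show "gact n act x (u + v) = gact n act x u + gact n act x v" for u v
    unfolding gact_def by (simp add: act_add perms_bij cvec.scale_right_distrib sum.distrib)
  show "gact n act x (cscale c u) = cscale c (gact n act x u)" for c u
    unfolding gact_def cvec.scale_sum_right
    by (intro sum.cong refl) (simp add: act_scale[OF perms_bij[of _ n]] mult.commute)
qed

lemma gact_add_left: "gact n act (\<lambda>\<sigma>. x \<sigma> + y \<sigma>) v = gact n act x v + gact n act y v"
  unfolding gact_def by (simp add: cvec.scale_left_distrib sum.distrib)

lemma gact_diff_left: "gact n act (\<lambda>\<sigma>. x \<sigma> - y \<sigma>) v = gact n act x v - gact n act y v"
  unfolding gact_def by (simp add: cvec.scale_left_diff_distrib sum_subtractf)

lemma gact_scale_left: "gact n act (\<lambda>\<sigma>. c * x \<sigma>) v = cscale c (gact n act x v)"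
  unfolding gact_def by (simp add: cvec.scale_sum_right)

lemma gact_delta: "\<tau> \<in> perms n \<Longrightarrow> gact n act (\<lambda>\<sigma>. if \<sigma> = \<tau> then 1 else 0) v = act \<tau> v"
  unfolding gact_def by (subst sum.mono_neutral_right[of _ "{\<tau>}"]) auto

lemma gact_delta_id: "gact n act (\<lambda>\<sigma>. if \<sigma> = id then 1 else 0) v = v"
  using gact_delta[of id n] by (simp add: permutes_id act_id)

lemma act_gact:
  assumes "\<tau> \<in> perms n"
  shows "act \<tau> (gact n act x v) = gact n act (\<lambda>\<sigma>. x (inv \<tau> \<circ> \<sigma>)) v"
proof -
  have "act \<tau> (gact n act x v) = (\<Sum>\<sigma>\<in>perms n. cscale (x (inv \<tau> \<circ> (\<tau> \<circ> \<sigma>))) (act (\<tau> \<circ> \<sigma>) v))"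
    unfolding gact_def act_sum[OF perms_bij[OF assms]]
    by (intro sum.cong refl)
       (use assms in \<open>auto simp: act_scale act_comp perms_bij o_assoc permutes_inv_o\<close>)
  also have "\<dots> = gact n act (\<lambda>\<sigma>. x (inv \<tau> \<circ> \<sigma>)) v"
    unfolding gact_def by (rule sum_perms_comp[OF assms, of "\<lambda>\<sigma>. cscale (x (inv \<tau> \<circ> \<sigma>)) (act \<sigma> v)"])
  finally show ?thesis .
qed

lemma submodule_gact: "submodule n act U \<Longrightarrow> v \<in> U \<Longrightarrow> gact n act x v \<in> U"
  unfolding gact_def submodule_def by (intro cvec.subspace_sum cvec.subspace_scale) auto

lemma submodule_orbit: "submodule n act (range (\<lambda>x. gact n act x v))"
  unfolding submodule_def
proof (intro conjI allI impI ballI)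
  show "cvec.subspace (range (\<lambda>x. gact n act x v))"
  proof (rule cvec.subspaceI)
    show "0 \<in> range (\<lambda>x. gact n act x v)"
      by (rule image_eqI[of _ _ "\<lambda>_. 0"]) (auto simp: gact_def)
  qed (auto simp: gact_add_left[symmetric] gact_scale_left[symmetric])
  fix \<tau> u assume "\<tau> permutes {..<n}" "u \<in> range (\<lambda>x. gact n act x v)"
  thus "act \<tau> u \<in> range (\<lambda>x. gact n act x v)" using act_gact[of \<tau> n] by auto
qed

lemma irreducible_orbit:
  assumes "irreducible_module n act U" "v \<in> U" "v \<noteq> 0"
  shows "U = range (\<lambda>x. gact n act x v)"
proof -
  have "range (\<lambda>x. gact n act x v) \<subseteq> U"
    using assms submodule_gact unfolding irreducible_module_def by blast
  moreover have "v \<in> range (\<lambda>x. gact n act x v)" using gact_delta_id[of n v] by (metis rangeI)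
  ultimately show ?thesis
    using assms submodule_orbit unfolding irreducible_module_def by blast
qed

lemma subspace_hom_image:
  assumes "cvec.subspace V"
  shows "cvec.subspace (hom_image n actS s act V)"
  unfolding hom_image_def
  by (rule cvec.subspaceI)
     (use assms in \<open>auto simp: cvec.subspace_0 cvec.subspace_add cvec.subspace_scale
        cpair.linear_0[OF gact_linear] cpair.linear_add[OF gact_linear] cpair.linear_scale[OF gact_linear]\<close>)

end

text \<open>Among the nonzero polynomials \<open>p\<close> of degree at most the dimension with
  \<open>p(T) w0 = 0\<close>, take one of least degree. It has a root \<open>z\<close>; with
  \<open>p = (X - z) q\<close> the vector \<open>q(T) w0\<close> is nonzero by minimality and is
  killed by \<open>T - z\<close>. Linearity of \<open>T\<close> is assumed on \<open>U\<close> only,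
  since the operator of the application is defined by choice.\<close>

lemma eigenvector_exists:
  fixes T :: "('k \<Rightarrow>\<^sub>0 complex) \<Rightarrow> ('k \<Rightarrow>\<^sub>0 complex)"
  assumes U: "cvec.subspace U" "fd U" and w0: "w0 \<in> U" "w0 \<noteq> 0"
    and TU: "\<And>u. u \<in> U \<Longrightarrow> T u \<in> U"
    and Tadd: "\<And>u v. u \<in> U \<Longrightarrow> v \<in> U \<Longrightarrow> T (u + v) = T u + T v"
    and Tscale: "\<And>c u. u \<in> U \<Longrightarrow> T (cscale c u) = cscale c (T u)"
  obtains c w where "w \<in> U" "w \<noteq> 0" "T w = cscale c w"
proof -
  define N where "N = cvec.dim U"
  have powU: "(T ^^ i) w0 \<in> U" for i by (induction i) (auto simp: w0 TU)
  \<comment> \<open>\<open>ev p\<close> stands for \<open>p(T) w0\<close>. The cut-off at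
    \<open>N\<close> is harmless because only degrees up to \<open>N\<close> occur.\<close>
  define ev where "ev = (\<lambda>p::complex poly. \<Sum>i\<le>N. cscale (coeff p i) ((T ^^ i) w0))"
  have T0: "T 0 = 0" using Tscale[OF w0(1), of 0] by simp
  have Tsum: "T (\<Sum>i\<in>A. f i) = (\<Sum>i\<in>A. T (f i))" if "finite A" "\<And>i. i \<in> A \<Longrightarrow> f i \<in> U"
    for A :: "nat set" and f
    using that by (induction A rule: finite_induct) (auto simp: T0 Tadd cvec.subspace_sum U)
  have "\<exists>p. p \<noteq> 0 \<and> degree p \<le> N \<and> ev p = 0"
  proof -
    have "\<not> indep_fam {..N} (\<lambda>i. (T ^^ i) w0)"
    proof
      assume "indep_fam {..N} (\<lambda>i. (T ^^ i) w0)"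
      hence "card {..N} \<le> cvec.dim U" using powU U by (intro indep_fam_card_le) auto
      thus False by (simp add: N_def)
    qed
    then obtain s j where s: "(\<Sum>i\<le>N. cscale (s i) ((T ^^ i) w0)) = 0" "j \<le> N" "s j \<noteq> 0"
      unfolding indep_fam_def by auto
    define p where "p = (\<Sum>i\<le>N. monom (s i) i)"
    have cp: "coeff p i = (if i \<le> N then s i else 0)" for i
      unfolding p_def coeff_sum by (auto simp: sum.delta)
    have "degree p \<le> N" by (rule degree_le) (auto simp: cp)
    moreover have "p \<noteq> 0" using cp[of j] s by auto
    moreover have "ev p = 0" using s(1) unfolding ev_def by (simp add: cp)
    ultimately show ?thesis by blast
  qed
  then obtain p where p: "p \<noteq> 0" "degree p \<le> N" "ev p = 0"
    and least: "\<And>q. q \<noteq> 0 \<and> degree q \<le> N \<and> ev q = 0 \<Longrightarrow> degree p \<le> degree q"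
    using ex_has_least_nat[of "\<lambda>p. p \<noteq> 0 \<and> degree p \<le> N \<and> ev p = 0" _ degree] by blast
  have "degree p \<noteq> 0"
  proof
    assume "degree p = 0"
    hence ev: "ev p = cscale (coeff p 0) w0"
      unfolding ev_def by (subst sum.mono_neutral_right[of _ "{0}"]) (auto simp: coeff_eq_0)
    have "coeff p 0 = 0" using p(3) w0(2) unfolding ev by simp
    thus False using p(1) \<open>degree p = 0\<close> by (metis leading_coeff_0_iff)
  qed
  then obtain z where "poly p z = 0" using alg_closed_imp_poly_has_root by blast
  then obtain q where q: "p = [:-z, 1:] * q" using poly_eq_0_iff_dvd by (metis dvdE)
  have q0: "q \<noteq> 0" using q p(1) by auto
  have dq: "Suc (degree q) = degree p" unfolding q using q0 by (subst degree_mult_eq) auto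
  have evU: "ev q \<in> U" unfolding ev_def using powU U by (intro cvec.subspace_sum cvec.subspace_scale) auto
  have "ev q \<noteq> 0" using least[of q] q0 dq p(2) by auto
  moreover have "T (ev q) = cscale z (ev q)"
  proof -
    have "T (ev q) = (\<Sum>i\<le>N. cscale (coeff q i) ((T ^^ Suc i) w0))"
      unfolding ev_def by (subst Tsum) (auto simp: Tscale powU U cvec.subspace_scale)
    also have "\<dots> = (\<Sum>i<N. cscale (coeff q i) ((T ^^ Suc i) w0))"
      using dq p(2) by (subst lessThan_Suc_atMost[symmetric]) (simp add: coeff_eq_0)
    \<comment> \<open>\<open>pCons 0 q\<close> is \<open>X q\<close>, which equals
      \<open>p + z q\<close>.\<close>
    also have "\<dots> = (\<Sum>i\<le>N. cscale (coeff (pCons 0 q) i) ((T ^^ i) w0))"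
      by (subst sum.atMost_shift) simp
    also have "\<dots> = ev p + cscale z (ev q)"
      unfolding ev_def q cvec.scale_sum_right sum.distrib[symmetric]
      by (intro sum.cong refl) (simp add: cvec.scale_left_distrib[symmetric])
    finally show ?thesis using p(3) by simp
  qed
  ultimately show ?thesis using that evU by blast
qed

context perm_rep
begin

text \<open>Schur's lemma for a generator: by \<open>ann\<close>, sending \<open>t\<close> to
  \<open>u\<close> extends to an endomorphism; it has an eigenvector, and the eigenspace is a
  nonzero submodule, hence everything.\<close>

lemma schur_scalar:
  assumes irr: "irreducible_module n act U" and fd: "fd U" and t: "t \<in> U" "t \<noteq> 0" and u: "u \<in> U"
    and ann: "\<And>x. gact n act x t = 0 \<Longrightarrow> gact n act x u = 0"
  shows "\<exists>l. u = cscale l t"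
proof -
  have U: "U = range (\<lambda>x. gact n act x t)" using irreducible_orbit[OF irr t] .
  have sub: "submodule n act U" using irr unfolding irreducible_module_def by blast
  hence ss: "cvec.subspace U" unfolding submodule_def by blast
  \<comment> \<open>An element of \<open>U\<close> is \<open>x t\<close> for some \<open>x\<close>,
    and its image is to be \<open>x u\<close>. Two choices of \<open>x\<close> differ by an
    annihilator of \<open>t\<close>, which also annihilates \<open>u\<close>.\<close>
  define T where "T = (\<lambda>w. gact n act (SOME x. gact n act x t = w) u)"
  have T: "T (gact n act x t) = gact n act x u" for x
  proof -
    let ?y = "SOME y. gact n act y t = gact n act x t"
    have "gact n act ?y t = gact n act x t" by (rule someI[of _ x]) simp
    hence "gact n act (\<lambda>\<sigma>. ?y \<sigma> - x \<sigma>) t = 0" by (simp add: gact_diff_left)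
    from ann[OF this] show ?thesis unfolding T_def by (simp add: gact_diff_left)
  qed
  have Tadd: "T (v + w) = T v + T w" if "v \<in> U" "w \<in> U" for v w
    using that unfolding U by (auto simp: gact_add_left[symmetric] T)
  have Tscale: "T (cscale c v) = cscale c (T v)" if "v \<in> U" for c v
    using that unfolding U by (auto simp: gact_scale_left[symmetric] T)
  have Tact: "T (act \<tau> v) = act \<tau> (T v)" if "v \<in> U" "\<tau> \<in> perms n" for v \<tau>
    using that unfolding U by (auto simp: act_gact T)
  have TU: "T v \<in> U" if "v \<in> U" for v
    using that u sub submodule_gact unfolding T_def by blast
  obtain l w where w: "w \<in> U" "w \<noteq> 0" "T w = cscale l w"
    using eigenvector_exists[OF ss fd t TU Tadd Tscale] by blast
  have "submodule n act {v \<in> U. T v = cscale l v}"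
    unfolding submodule_def
  proof (intro conjI allI impI ballI)
    show "cvec.subspace {v \<in> U. T v = cscale l v}"
    proof (rule cvec.subspaceI)
      show "0 \<in> {v \<in> U. T v = cscale l v}"
        using Tscale[OF t(1), of 0] cvec.subspace_0[OF ss] by simp
    qed (auto simp: Tadd Tscale cvec.subspace_add cvec.subspace_scale ss cvec.scale_right_distrib mult.commute)
    fix \<tau> v assume "\<tau> permutes {..<n}" "v \<in> {v \<in> U. T v = cscale l v}"
    thus "act \<tau> v \<in> {v \<in> U. T v = cscale l v}"
      using sub Tact act_scale perms_bij[of \<tau> n] unfolding submodule_def by auto
  qed
  hence "{v \<in> U. T v = cscale l v} = U"
    using irr w unfolding irreducible_module_def by blast
  hence "T t = cscale l t" using t by blast
  moreover have "T t = u" using T[of "\<lambda>\<sigma>. if \<sigma> = id then 1 else 0"] by (simp add: gact_delta_id)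
  ultimately show ?thesis by blast
qed

end

section \<open>Direct sums and complete reducibility\<close>

lemma direct_sum_iff:
  assumes "\<And>i. i < k \<Longrightarrow> cvec.subspace (U i)"
  shows "direct_sum k U V \<longleftrightarrow>
    V = (\<lambda>u. \<Sum>i<k. u i) ` {u. \<forall>i<k. u i \<in> U i} \<and>
    (\<forall>u. (\<forall>i<k. u i \<in> U i) \<and> (\<Sum>i<k. u i) = 0 \<longrightarrow> (\<forall>i<k. u i = 0))"
proof -
  let ?P = "\<Pi>\<^sub>E i\<in>{..<k}. U i" and ?f = "\<lambda>u. \<Sum>i<k. u i"
  have im: "?f ` ?P = ?f ` {u. \<forall>i<k. u i \<in> U i}"
  proof (intro equalityI subsetI)
    fix x assume "x \<in> ?f ` {u. \<forall>i<k. u i \<in> U i}"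
    then obtain u where u: "x = ?f u" "\<forall>i<k. u i \<in> U i" by blast
    have "x = ?f (restrict u {..<k})" "restrict u {..<k} \<in> ?P" using u by auto
    thus "x \<in> ?f ` ?P" by blast
  qed (auto simp: PiE_iff)
  have inj: "inj_on ?f ?P \<longleftrightarrow> (\<forall>u. (\<forall>i<k. u i \<in> U i) \<and> (\<Sum>i<k. u i) = 0 \<longrightarrow> (\<forall>i<k. u i = 0))"
  proof
    assume inj: "inj_on ?f ?P"
    show "\<forall>u. (\<forall>i<k. u i \<in> U i) \<and> (\<Sum>i<k. u i) = 0 \<longrightarrow> (\<forall>i<k. u i = 0)"
    proof (intro allI impI)
      fix u i assume u: "(\<forall>i<k. u i \<in> U i) \<and> (\<Sum>i<k. u i) = 0" and i: "i < k"
      have "restrict u {..<k} = restrict (\<lambda>_. 0) {..<k}"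
        by (rule inj_onD[OF inj]) (use u assms cvec.subspace_0 in auto)
      thus "u i = 0" using i by (metis lessThan_iff restrict_apply')
    qed
  next
    assume R: "\<forall>u. (\<forall>i<k. u i \<in> U i) \<and> (\<Sum>i<k. u i) = 0 \<longrightarrow> (\<forall>i<k. u i = 0)"
    show "inj_on ?f ?P"
    proof (rule inj_onI)
      fix u v assume uv: "u \<in> ?P" "v \<in> ?P" "?f u = ?f v"
      have "\<forall>i<k. u i - v i = 0"
        using R[rule_format, of "\<lambda>i. u i - v i"] uv assms
        by (auto simp: sum_subtractf PiE_iff intro!: cvec.subspace_diff)
      thus "u = v" using uv by (intro PiE_ext[of u "{..<k}" U v]) auto
    qed
  qed
  show ?thesis unfolding direct_sum_def bij_betw_def im inj by auto
qed

lemma direct_sumD: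
  assumes "\<And>i. i < k \<Longrightarrow> cvec.subspace (U i)" "direct_sum k U V"
  shows "V = (\<lambda>u. \<Sum>i<k. u i) ` {u. \<forall>i<k. u i \<in> U i}"
    and "\<And>u i. \<lbrakk>\<And>i. i < k \<Longrightarrow> u i \<in> U i; (\<Sum>i<k. u i) = 0; i < k\<rbrakk> \<Longrightarrow> u i = 0"
proof -
  note D = direct_sum_iff[THEN iffD1, OF _ assms(2), OF assms(1), simplified]
  show "V = (\<lambda>u. \<Sum>i<k. u i) ` {u. \<forall>i<k. u i \<in> U i}" using D by (rule conjunct1)
  show "u i = 0" if "\<And>i. i < k \<Longrightarrow> u i \<in> U i" "(\<Sum>i<k. u i) = 0" "i < k" for u i
    using conjunct2[OF D, rule_format, of u i] that by simp
qed

context perm_rep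
begin

text \<open>Maschke's argument: a linear projection onto \<open>W\<close> is summed over the group,
  and the complement is the kernel of the resulting equivariant map within \<open>V\<close>.\<close>

lemma complement_exists:
  assumes V: "submodule n act V" and W: "submodule n act W" "W \<subseteq> V"
  obtains W' where "submodule n act W'" "W' \<subseteq> V" "W \<inter> W' = {0}"
    "\<And>v. v \<in> V \<Longrightarrow> \<exists>w\<in>W. v - w \<in> W'"
proof -
  have ssW: "cvec.subspace W" and ssV: "cvec.subspace V" using V W unfolding submodule_def by auto
  obtain P where P: "range P \<subseteq> W" "clinear P" "\<And>v. v \<in> W \<Longrightarrow> P v = v"
    using cpair.linear_exists_left_inverse_on[OF cvec.module_hom_ident ssW] by auto
  \<comment> \<open>There is no division by the group order: on \<open>W\<close> the map is
    multiplication by \<open>fact n\<close>, which is corrected when a vector is split.\<close>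
  define Q where "Q = (\<lambda>v. \<Sum>\<sigma>\<in>perms n. act \<sigma> (P (act (inv \<sigma>) v)))"
  have Wact: "act \<sigma> w \<in> W" if "\<sigma> \<in> perms n" "w \<in> W" for \<sigma> w
    using W that unfolding submodule_def by blast
  have QW: "Q v \<in> W" for v
    unfolding Q_def using P(1) Wact by (intro cvec.subspace_sum[OF ssW]) blast
  have Qlin: "clinear Q"
  proof (rule clinearI)
    show "Q (u + v) = Q u + Q v" for u v
      unfolding Q_def
      by (simp add: act_add perms_bij permutes_inv bij_imp_bij_inv cpair.linear_add[OF P(2)] sum.distrib)
    show "Q (cscale c u) = cscale c (Q u)" for c u
      unfolding Q_def cvec.scale_sum_right
      by (intro sum.cong refl)
         (simp add: act_scale perms_bij permutes_inv bij_imp_bij_inv cpair.linear_scale[OF P(2)])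
  qed
  have Qw: "Q w = cscale (fact n) w" if "w \<in> W" for w
  proof -
    have "Q w = (\<Sum>\<sigma>\<in>perms n. w)" unfolding Q_def
    proof (intro sum.cong refl)
      fix \<sigma> assume s: "\<sigma> \<in> perms n"
      hence "act (inv \<sigma>) w \<in> W" using Wact that by (simp add: permutes_inv)
      thus "act \<sigma> (P (act (inv \<sigma>) w)) = w" using P(3) act_inv(2)[OF perms_bij[OF s]] by simp
    qed
    also have "\<dots> = cscale (fact n) w" by (simp only: cvec.sum_constant_scale card_perms of_nat_fact)
    finally show ?thesis .
  qed
  have Qact: "Q (act \<tau> v) = act \<tau> (Q v)" if t: "\<tau> \<in> perms n" for \<tau> v
  proof -
    have "Q (act \<tau> v) = (\<Sum>\<sigma>\<in>perms n. act (\<tau> \<circ> \<sigma>) (P (act (inv (\<tau> \<circ> \<sigma>)) (act \<tau> v))))"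
      unfolding Q_def
      by (rule sum_perms_comp[OF t, of "\<lambda>\<sigma>. act \<sigma> (P (act (inv \<sigma>) (act \<tau> v)))", symmetric])
    also have "\<dots> = (\<Sum>\<sigma>\<in>perms n. act \<tau> (act \<sigma> (P (act (inv \<sigma>) v))))"
    proof (intro sum.cong refl)
      fix \<sigma> assume s: "\<sigma> \<in> perms n"
      have "act (inv (\<tau> \<circ> \<sigma>)) (act \<tau> v) = act (inv \<sigma>) v"
        using perms_bij[OF s] perms_bij[OF t] by (simp add: o_inv_distrib act_comp bij_imp_bij_inv act_inv)
      thus "act (\<tau> \<circ> \<sigma>) (P (act (inv (\<tau> \<circ> \<sigma>)) (act \<tau> v))) = act \<tau> (act \<sigma> (P (act (inv \<sigma>) v)))"
        using perms_bij[OF s] perms_bij[OF t] by (simp add: act_comp)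
    qed
    also have "\<dots> = act \<tau> (Q v)" unfolding Q_def act_sum[OF perms_bij[OF t]] ..
    finally show ?thesis .
  qed
  let ?W' = "{v \<in> V. Q v = 0}"
  show ?thesis
  proof (rule that[of ?W'])
    show "submodule n act ?W'" unfolding submodule_def
    proof (intro conjI allI impI ballI)
      show "cvec.subspace ?W'"
        by (rule cvec.subspaceI) (auto simp: cpair.linear_0[OF Qlin] cpair.linear_add[OF Qlin]
            cpair.linear_scale[OF Qlin] cvec.subspace_0 cvec.subspace_add cvec.subspace_scale ssV)
      fix \<tau> v assume "\<tau> permutes {..<n}" "v \<in> ?W'"
      thus "act \<tau> v \<in> ?W'"
        using V Qact act_0[OF perms_bij[of \<tau> n]] unfolding submodule_def by auto
    qed
    show "W \<inter> ?W' = {0}"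
      using Qw cvec.subspace_0[OF ssW] cvec.subspace_0[OF ssV] cpair.linear_0[OF Qlin] by auto
    fix v assume v: "v \<in> V"
    let ?w = "cscale (1 / fact n) (Q v)"
    have "?w \<in> W" using QW ssW cvec.subspace_scale by blast
    moreover have "Q (v - ?w) = 0"
      using Qw[OF QW] by (simp add: cpair.linear_diff[OF Qlin] cpair.linear_scale[OF Qlin])
    ultimately show "\<exists>w\<in>W. v - w \<in> ?W'"
      using v W(2) ssV cvec.subspace_diff by blast
  qed auto
qed

lemma irreducible_exists:
  assumes "submodule n act V" "fd V" "V \<noteq> {0}"
  obtains U where "irreducible_module n act U" "U \<subseteq> V"
proof -
  obtain U where U: "submodule n act U \<and> U \<subseteq> V \<and> U \<noteq> {0}"
    and least: "\<And>W. submodule n act W \<and> W \<subseteq> V \<and> W \<noteq> {0} \<Longrightarrow> cvec.dim U \<le> cvec.dim W"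
    using ex_has_least_nat[of "\<lambda>U. submodule n act U \<and> U \<subseteq> V \<and> U \<noteq> {0}" V cvec.dim] assms by blast
  have "irreducible_module n act U" unfolding irreducible_module_def
  proof (intro conjI allI impI)
    fix W assume W: "submodule n act W \<and> W \<subseteq> U"
    show "W = {0} \<or> W = U"
    proof (rule ccontr)
      assume c: "\<not> (W = {0} \<or> W = U)"
      hence "cvec.dim W < cvec.dim U"
        using W U fd_subset[OF assms(2)] by (intro fd_dim_less) (auto simp: submodule_def)
      thus False using least[of W] W U c by auto
    qed
  qed (use U in auto)
  thus ?thesis using that U by blast
qed

text \<open>Induction on the dimension: an irreducible submodule is split off, and its complement
  has smaller dimension.\<close>

lemma decomposition_exists:
  assumes "submodule n act V" "fd V"
  shows "\<exists>k U. direct_sum k U V \<and> (\<forall>i<k. irreducible_module n act (U i))"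
  using assms
proof (induction "cvec.dim V" arbitrary: V rule: less_induct)
  case less
  show ?case
  proof (cases "V = {0}")
    case True
    have "direct_sum 0 (\<lambda>_. {0}) V" by (subst direct_sum_iff) (auto simp: True)
    thus ?thesis by (intro exI[of _ 0] exI[of _ "\<lambda>_. {0}"]) simp
  next
    case False
    obtain U0 where U0: "irreducible_module n act U0" "U0 \<subseteq> V"
      using irreducible_exists less.prems False by blast
    have subU0: "submodule n act U0" "U0 \<noteq> {0}" using U0 unfolding irreducible_module_def by auto
    obtain W where W: "submodule n act W" "W \<subseteq> V" "U0 \<inter> W = {0}"
      "\<And>v. v \<in> V \<Longrightarrow> \<exists>w\<in>U0. v - w \<in> W"
      using complement_exists[OF less.prems(1) subU0(1) U0(2)] by blast
    have ss: "cvec.subspace V" "cvec.subspace W" "cvec.subspace U0"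
      using less.prems W subU0 unfolding submodule_def by auto
    have "U0 \<noteq> {0}" "0 \<in> U0" using subU0 ss cvec.subspace_0 by auto
    hence "W \<noteq> V" using W(3) U0(2) by blast
    hence "cvec.dim W < cvec.dim V" using fd_dim_less[OF less.prems(2) ss(1,2)] W(2) by blast
    from less.hyps[OF this W(1)] fd_subset[OF less.prems(2) W(2)]
    obtain k U where U: "direct_sum k U W" "\<forall>i<k. irreducible_module n act (U i)" by blast
    have ssU: "cvec.subspace (U i)" if "i < k" for i
      using U(2) that unfolding irreducible_module_def submodule_def by blast
    have WU: "W = (\<lambda>u. \<Sum>i<k. u i) ` {u. \<forall>i<k. u i \<in> U i}"
      by (rule direct_sumD(1)) (use ssU U(1) in auto)
    have WI: "u i = 0" if "\<And>i. i < k \<Longrightarrow> u i \<in> U i" "(\<Sum>i<k. u i) = 0" "i < k" for u i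
      by (rule direct_sumD(2)[of k U W]) (use that ssU U(1) in auto)
    let ?U = "U(k := U0)"
    have "direct_sum (Suc k) ?U V"
    proof (subst direct_sum_iff)
      show "cvec.subspace (?U i)" if "i < Suc k" for i using that ssU ss by (cases "i = k") auto
      have "V = (\<lambda>u. \<Sum>i<Suc k. u i) ` {u. \<forall>i<Suc k. u i \<in> ?U i}"
      proof (intro equalityI subsetI)
        fix v assume v: "v \<in> V"
        obtain w where w: "w \<in> U0" "v - w \<in> W" using W(4)[OF v] by blast
        then obtain u where u: "v - w = (\<Sum>i<k. u i)" "\<forall>i<k. u i \<in> U i" using WU by auto
        have "v = (\<Sum>i<Suc k. (u(k := w)) i)" using u(1) by (simp add: algebra_simps)
        moreover have "u(k := w) \<in> {u. \<forall>i<Suc k. u i \<in> ?U i}" using u w by (auto simp: less_Suc_eq)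
        ultimately show "v \<in> (\<lambda>u. \<Sum>i<Suc k. u i) ` {u. \<forall>i<Suc k. u i \<in> ?U i}" by blast
      next
        fix v assume "v \<in> (\<lambda>u. \<Sum>i<Suc k. u i) ` {u. \<forall>i<Suc k. u i \<in> ?U i}"
        then obtain u where u: "v = (\<Sum>i<Suc k. u i)" "\<forall>i<Suc k. u i \<in> ?U i" by blast
        have "(\<Sum>i<k. u i) \<in> W" using u(2) unfolding WU by (auto simp: less_Suc_eq)
        moreover have "u k \<in> U0" using u(2) by auto
        ultimately show "v \<in> V"
          using u(1) W(2) U0(2) cvec.subspace_add[OF ss(1), of "\<Sum>i<k. u i" "u k"] by auto
      qed
      moreover have "u i = 0" if u: "\<forall>i<Suc k. u i \<in> ?U i" "(\<Sum>i<Suc k. u i) = 0" "i < Suc k" for u i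
      proof -
        have uk: "u k \<in> U0" using u(1) by auto
        have uU: "u i \<in> U i" if "i < k" for i using u(1) that by (auto simp: less_Suc_eq)
        have inW: "(\<Sum>i<k. u i) \<in> W" using uU unfolding WU by auto
        have eq: "u k = - (\<Sum>i<k. u i)" using u(2) by (simp add: add_eq_0_iff)
        hence "u k \<in> W" using inW ss cvec.subspace_neg by auto
        hence z: "u k = 0" using uk W(3) by blast
        hence "(\<Sum>i<k. u i) = 0" using eq by simp
        thus ?thesis using WI[of u i] uU z u(3) by (cases "i = k") auto
      qed
      ultimately show "V = (\<lambda>u. \<Sum>i<Suc k. u i) ` {u. \<forall>i<Suc k. u i \<in> ?U i} \<and>
        (\<forall>u. (\<forall>i<Suc k. u i \<in> ?U i) \<and> (\<Sum>i<Suc k. u i) = 0 \<longrightarrow> (\<forall>i<Suc k. u i = 0))" by blast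
    qed
    moreover have "\<forall>i<Suc k. irreducible_module n act (?U i)" using U(2) U0 by (auto simp: less_Suc_eq)
    ultimately show ?thesis by blast
  qed
qed

end

section \<open>Comparison of two representations and independence of the multiplicity from the
  decomposition\<close>

locale perm_rep_pair = S: perm_rep actS + V: perm_rep act
  for actS :: "(nat \<Rightarrow> nat) \<Rightarrow> ('l \<Rightarrow>\<^sub>0 complex) \<Rightarrow> ('l \<Rightarrow>\<^sub>0 complex)"
    and act :: "(nat \<Rightarrow> nat) \<Rightarrow> ('k \<Rightarrow>\<^sub>0 complex) \<Rightarrow> ('k \<Rightarrow>\<^sub>0 complex)"
begin

lemma hom_gact:
  assumes sub: "submodule n act U" and u: "u \<in> U"
    and add: "\<forall>u\<in>U. \<forall>v\<in>U. \<phi> (u + v) = \<phi> u + \<phi> v"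
    and scale: "\<forall>c. \<forall>u\<in>U. \<phi> (cscale c u) = cscale c (\<phi> u)"
    and equi: "\<forall>\<sigma>. \<sigma> permutes {..<n} \<longrightarrow> (\<forall>u\<in>U. \<phi> (act \<sigma> u) = actS \<sigma> (\<phi> u))"
  shows "\<phi> (gact n act x u) = gact n actS x (\<phi> u)"
proof -
  have ss: "cvec.subspace U" using sub unfolding submodule_def by blast
  have z: "\<phi> 0 = 0" using scale[rule_format, OF u, of 0] by simp
  have s: "\<phi> (\<Sum>i\<in>A. f i) = (\<Sum>i\<in>A. \<phi> (f i))" if "finite A" "\<And>i. i \<in> A \<Longrightarrow> f i \<in> U"
    for A :: "(nat \<Rightarrow> nat) set" and f
    using that by (induction A rule: finite_induct) (auto simp: z add cvec.subspace_sum ss)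
  have aU: "act \<sigma> u \<in> U" if "\<sigma> \<in> perms n" for \<sigma> using that sub u unfolding submodule_def by blast
  have "\<phi> (gact n act x u) = (\<Sum>\<sigma>\<in>perms n. \<phi> (cscale (x \<sigma>) (act \<sigma> u)))"
    unfolding gact_def using aU ss cvec.subspace_scale by (intro s) auto
  also have "\<dots> = gact n actS x (\<phi> u)"
    unfolding gact_def using aU scale equi u by (intro sum.cong refl) auto
  finally show ?thesis .
qed

text \<open>The preimage of a submodule of \<open>S\<close> is a submodule of \<open>U\<close>. Read
  contrapositively, no irreducible summand is isomorphic to a module that is not
  irreducible.\<close>

lemma isomorphic_irreducible:
  assumes irr: "irreducible_module n act U" and iso: "isomorphic_modules n act U actS S"
  shows "irreducible_module n actS S"
proof -
  obtain \<phi> where bij: "bij_betw \<phi> U S"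
    and add: "\<forall>u\<in>U. \<forall>v\<in>U. \<phi> (u + v) = \<phi> u + \<phi> v"
    and scale: "\<forall>c. \<forall>u\<in>U. \<phi> (cscale c u) = cscale c (\<phi> u)"
    and equi: "\<forall>\<sigma>. \<sigma> permutes {..<n} \<longrightarrow> (\<forall>u\<in>U. \<phi> (act \<sigma> u) = actS \<sigma> (\<phi> u))"
    using iso unfolding isomorphic_modules_def by blast
  have sub: "submodule n act U" and U0: "U \<noteq> {0}" using irr unfolding irreducible_module_def by auto
  have ss: "cvec.subspace U" using sub unfolding submodule_def by blast
  have z: "\<phi> 0 = 0" using scale[rule_format, OF cvec.subspace_0[OF ss], of 0] by simp
  have SU: "S = \<phi> ` U" and inj: "inj_on \<phi> U" using bij unfolding bij_betw_def by auto
  have S: "submodule n actS S" unfolding submodule_def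
  proof (intro conjI allI impI ballI)
    show "cvec.subspace S" unfolding SU
    proof (rule cvec.subspaceI)
      show "0 \<in> \<phi> ` U" using z cvec.subspace_0[OF ss] by (metis imageI)
      show "x + y \<in> \<phi> ` U" if "x \<in> \<phi> ` U" "y \<in> \<phi> ` U" for x y
        using that add cvec.subspace_add[OF ss] by (metis (no_types, lifting) imageE imageI)
      show "cscale c x \<in> \<phi> ` U" if "x \<in> \<phi> ` U" for c x
        using that scale cvec.subspace_scale[OF ss] by (metis (no_types, lifting) imageE imageI)
    qed
    fix \<sigma> x assume "\<sigma> permutes {..<n}" "x \<in> S"
    thus "actS \<sigma> x \<in> S" using equi sub unfolding SU submodule_def by (metis (no_types, lifting) imageE imageI)
  qed
  show ?thesis unfolding irreducible_module_def
  proof (intro conjI allI impI)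
    obtain u where "u \<in> U" "u \<noteq> 0" using U0 cvec.subspace_0[OF ss] by auto
    thus "S \<noteq> {0}" using inj z cvec.subspace_0[OF ss] unfolding SU inj_on_def by (metis imageI singletonD)
    fix W assume W: "submodule n actS W \<and> W \<subseteq> S"
    have ssW: "cvec.subspace W" using W unfolding submodule_def by blast
    let ?W = "{u \<in> U. \<phi> u \<in> W}"
    have "submodule n act ?W" unfolding submodule_def
    proof (intro conjI allI impI ballI)
      show "cvec.subspace ?W"
        by (rule cvec.subspaceI) (auto simp: z add scale cvec.subspace_0 cvec.subspace_add cvec.subspace_scale ss ssW)
      show "act \<sigma> u \<in> ?W" if "\<sigma> permutes {..<n}" "u \<in> ?W" for \<sigma> u
        using that W sub equi unfolding submodule_def by auto
    qed
    hence "?W = {0} \<or> ?W = U" using irr unfolding irreducible_module_def by blast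
    moreover have "W = \<phi> ` ?W" using W unfolding SU by auto
    ultimately show "W = {0} \<or> W = S" using z unfolding SU by auto
  qed (use S in auto)
qed

text \<open>Each summand isomorphic to \<open>S\<close> contributes one basis vector to
  \<open>hom_image\<close>, the element corresponding to \<open>s\<close>; by Schur's lemma it
  contributes only multiples of it, and other summands contribute nothing. The right-hand side does
  not mention the decomposition, so all decompositions give the same count.\<close>

lemma multiplicity_count:
  assumes S: "irreducible_module n actS S" "s \<in> S" "s \<noteq> 0"
    and V: "fd V" and ds: "direct_sum k U V" and irr: "\<forall>i<k. irreducible_module n act (U i)"
  shows "card {i. i < k \<and> isomorphic_modules n act (U i) actS S} = cvec.dim (hom_image n actS s act V)"
proof -
  let ?I = "{i. i < k \<and> isomorphic_modules n act (U i) actS S}"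
  have sub: "submodule n act (U i)" and ss: "cvec.subspace (U i)" if "i < k" for i
    using irr that unfolding irreducible_module_def submodule_def by auto
  have VU: "V = (\<lambda>u. \<Sum>i<k. u i) ` {u. \<forall>i<k. u i \<in> U i}"
    by (rule direct_sumD(1)) (use ss ds in auto)
  have VI: "u i = 0" if "\<And>i. i < k \<Longrightarrow> u i \<in> U i" "(\<Sum>i<k. u i) = 0" "i < k" for u i
    by (rule direct_sumD(2)[of k U V]) (use that ss ds in auto)
  have inV: "u \<in> V" if "u \<in> U i" "i < k" for u i
  proof -
    have "u = (\<Sum>j<k. if j = i then u else 0)" using that by simp
    moreover have "(\<lambda>j. if j = i then u else 0) \<in> {u. \<forall>i<k. u i \<in> U i}"
      using that ss cvec.subspace_0 by auto
    ultimately show ?thesis unfolding VU by blast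
  qed
  \<comment> \<open>The vector \<open>t\<close> is the preimage of \<open>s\<close> under an
    isomorphism, so the two have the same annihilator.\<close>
  have "\<forall>i\<in>?I. \<exists>t. t \<in> U i \<and> t \<noteq> 0 \<and> (\<forall>x. gact n act x t = 0 \<longleftrightarrow> gact n actS x s = 0)"
  proof
    fix i assume i: "i \<in> ?I"
    then obtain \<phi> where bij: "bij_betw \<phi> (U i) S"
      and add: "\<forall>u\<in>U i. \<forall>v\<in>U i. \<phi> (u + v) = \<phi> u + \<phi> v"
      and scale: "\<forall>c. \<forall>u\<in>U i. \<phi> (cscale c u) = cscale c (\<phi> u)"
      and equi: "\<forall>\<sigma>. \<sigma> permutes {..<n} \<longrightarrow> (\<forall>u\<in>U i. \<phi> (act \<sigma> u) = actS \<sigma> (\<phi> u))"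
      unfolding isomorphic_modules_def by blast
    obtain t where t: "t \<in> U i" "\<phi> t = s" using bij S(2) unfolding bij_betw_def by auto
    have z: "\<phi> 0 = 0" using scale[rule_format, OF t(1), of 0] by simp
    have u0: "0 \<in> U i" using ss i cvec.subspace_0 by auto
    have "gact n act x t = 0 \<longleftrightarrow> gact n actS x s = 0" for x
    proof -
      have "gact n act x t \<in> U i" using V.submodule_gact sub i t by auto
      hence "gact n act x t = 0 \<longleftrightarrow> \<phi> (gact n act x t) = \<phi> 0"
        using inj_on_eq_iff[OF bij_betw_imp_inj_on[OF bij]] u0 by blast
      thus ?thesis using hom_gact[OF sub t(1) add scale equi, of x] i t(2) z by simp
    qed
    thus "\<exists>t. t \<in> U i \<and> t \<noteq> 0 \<and> (\<forall>x. gact n act x t = 0 \<longleftrightarrow> gact n actS x s = 0)"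
      using t S(3) z by (intro exI[of _ t]) auto
  qed
  then obtain t where t: "\<And>i. i \<in> ?I \<Longrightarrow> t i \<in> U i" "\<And>i. i \<in> ?I \<Longrightarrow> t i \<noteq> 0"
    "\<And>i x. i \<in> ?I \<Longrightarrow> gact n act x (t i) = 0 \<longleftrightarrow> gact n actS x s = 0"
    using bchoice[of ?I "\<lambda>i t. t \<in> U i \<and> t \<noteq> 0 \<and> (\<forall>x. gact n act x t = 0 \<longleftrightarrow> gact n actS x s = 0)"] by blast
  have ext: "(\<Sum>i\<in>?I. f i) = (\<Sum>i<k. if i \<in> ?I then f i else 0)" for f :: "nat \<Rightarrow> 'k \<Rightarrow>\<^sub>0 complex"
    by (rule sum.mono_neutral_cong_left) auto
  have fin: "finite ?I" by simp
  have "cvec.dim (hom_image n actS s act V) = card ?I"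
  proof (rule dim_eq_card_fam[OF fin, of t])
    show "indep_fam ?I t" unfolding indep_fam_def
    proof (intro allI impI ballI)
      fix c i assume c: "(\<Sum>i\<in>?I. cscale (c i) (t i)) = 0" and i: "i \<in> ?I"
      let ?u = "\<lambda>i. if i \<in> ?I then cscale (c i) (t i) else 0"
      have "?u i = 0"
      proof (rule VI[of ?u])
        show "?u j \<in> U j" if "j < k" for j
          using that by (auto intro!: cvec.subspace_scale cvec.subspace_0 ss t(1))
        show "(\<Sum>i<k. ?u i) = 0" using c ext[of "\<lambda>i. cscale (c i) (t i)"] by simp
      qed (use i in auto)
      thus "c i = 0" using i t(2)[OF i] by simp
    qed
    show "t ` ?I \<subseteq> hom_image n actS s act V"
      unfolding hom_image_def by (auto intro: inV[OF t(1)] simp: t(3))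
    fix v assume v: "v \<in> hom_image n actS s act V"
    then obtain u where u: "v = (\<Sum>i<k. u i)" "\<And>i. i < k \<Longrightarrow> u i \<in> U i"
      unfolding hom_image_def VU by auto
    \<comment> \<open>Summands are stable under the group algebra, so \<open>x v = 0\<close> splits
      into components, and independence kills each of them.\<close>
    have ann: "gact n act x (u i) = 0" if x: "gact n actS x s = 0" and i: "i < k" for x i
    proof (rule VI[of "\<lambda>i. gact n act x (u i)"])
      show "gact n act x (u j) \<in> U j" if "j < k" for j using V.submodule_gact sub u(2) that by blast
      have "(\<Sum>i<k. gact n act x (u i)) = gact n act x v"
        unfolding u(1) cpair.linear_sum[OF V.gact_linear] ..
      thus "(\<Sum>i<k. gact n act x (u i)) = 0" using v x unfolding hom_image_def by simp
    qed (use i in auto)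
    \<comment> \<open>A nonzero component has the same annihilator as \<open>s\<close>. Its summand
      is therefore isomorphic to \<open>S\<close>, and Schur's lemma makes the component a multiple
      of \<open>t i\<close>.\<close>
    have "\<exists>c. u i = (if i \<in> ?I then cscale c (t i) else 0)" if i: "i < k" for i
    proof (cases "u i = 0")
      case True
      thus ?thesis by (intro exI[of _ 0]) auto
    next
      case False
      have Ui: "U i = range (\<lambda>x. gact n act x (u i))"
        using V.irreducible_orbit[of n "U i" "u i"] irr i u(2) False by blast
      have Si: "S = range (\<lambda>x. gact n actS x s)" using S.irreducible_orbit S by blast
      have ann': "gact n actS x s = 0" if x: "gact n act x (u i) = 0" for x
      proof (rule ccontr)
        assume nz: "gact n actS x s \<noteq> 0"
        \<comment> \<open>If this submodule of \<open>S\<close> is nonzero, it contains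
          \<open>s\<close>, so \<open>s = y s\<close> with \<open>y\<close> killing
          \<open>u i\<close>. Then \<open>y - 1\<close> kills \<open>s\<close>, hence also
          \<open>u i\<close>, which forces \<open>u i = 0\<close>.\<close>
        let ?K = "{gact n actS x s |x. gact n act x (u i) = 0}"
        have "submodule n actS ?K" unfolding submodule_def
        proof (intro conjI allI impI ballI)
          show "cvec.subspace ?K"
          proof (rule cvec.subspaceI)
            show "0 \<in> ?K" by (auto intro!: exI[of _ "\<lambda>_. 0"] simp: gact_def)
            fix a b assume "a \<in> ?K" "b \<in> ?K"
            then obtain x y where "a = gact n actS x s" "gact n act x (u i) = 0"
              "b = gact n actS y s" "gact n act y (u i) = 0" by blast
            thus "a + b \<in> ?K"
              by (auto intro!: exI[of _ "\<lambda>\<sigma>. x \<sigma> + y \<sigma>"] simp: S.gact_add_left V.gact_add_left)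
          next
            fix c a assume "a \<in> ?K"
            then obtain x where "a = gact n actS x s" "gact n act x (u i) = 0" by blast
            thus "cscale c a \<in> ?K"
              by (auto intro!: exI[of _ "\<lambda>\<sigma>. c * x \<sigma>"] simp: S.gact_scale_left V.gact_scale_left)
          qed
          fix \<tau> a assume tau: "\<tau> permutes {..<n}" and "a \<in> ?K"
          then obtain x where "a = gact n actS x s" "gact n act x (u i) = 0" by blast
          moreover have "act \<tau> (gact n act x (u i)) = gact n act (\<lambda>\<sigma>. x (inv \<tau> \<circ> \<sigma>)) (u i)"
            "actS \<tau> (gact n actS x s) = gact n actS (\<lambda>\<sigma>. x (inv \<tau> \<circ> \<sigma>)) s"
            using V.act_gact S.act_gact tau by auto
          ultimately show "actS \<tau> a \<in> ?K" using V.act_0[OF permutes_bij[OF tau]] by auto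
        qed
        moreover have "?K \<subseteq> S" using Si by auto
        moreover have "?K \<noteq> {0}" using nz x by auto
        ultimately have "?K = S" using S(1) unfolding irreducible_module_def by blast
        then obtain y where y: "s = gact n actS y s" "gact n act y (u i) = 0" using S(2) by auto
        have "gact n actS (\<lambda>\<sigma>. y \<sigma> - (if \<sigma> = id then 1 else 0)) s = 0"
          using y(1) by (simp add: S.gact_diff_left S.gact_delta_id)
        from ann[OF this i] have "u i = 0" using y(2) by (simp add: V.gact_diff_left V.gact_delta_id)
        thus False using False by simp
      qed
      have iff: "gact n act x (u i) = 0 \<longleftrightarrow> gact n actS x s = 0" for x using ann i ann' by blast
      define \<phi> where "\<phi> = (\<lambda>w. gact n actS (SOME x. gact n act x (u i) = w) s)"
      have \<phi>: "\<phi> (gact n act x (u i)) = gact n actS x s" for x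
      proof -
        let ?y = "SOME y. gact n act y (u i) = gact n act x (u i)"
        have "gact n act ?y (u i) = gact n act x (u i)" by (rule someI[of _ x]) simp
        hence "gact n act (\<lambda>\<sigma>. ?y \<sigma> - x \<sigma>) (u i) = 0" by (simp add: V.gact_diff_left)
        thus ?thesis unfolding iff \<phi>_def by (simp add: S.gact_diff_left)
      qed
      have "isomorphic_modules n act (U i) actS S" unfolding isomorphic_modules_def
      proof (intro exI[of _ \<phi>] conjI)
        have "inj_on \<phi> (U i)"
        proof (rule inj_onI)
          fix a b assume "a \<in> U i" "b \<in> U i" and eq: "\<phi> a = \<phi> b"
          then obtain x y where xy: "a = gact n act x (u i)" "b = gact n act y (u i)" unfolding Ui by blast
          hence "gact n actS (\<lambda>\<sigma>. x \<sigma> - y \<sigma>) s = 0" using eq by (simp add: \<phi> S.gact_diff_left)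
          thus "a = b" using xy unfolding iff[symmetric] by (simp add: V.gact_diff_left)
        qed
        moreover have "\<phi> ` U i = S" unfolding Si by (subst Ui) (auto simp: \<phi> image_image)
        ultimately show "bij_betw \<phi> (U i) S" unfolding bij_betw_def by blast
        show "\<forall>u\<in>U i. \<forall>v\<in>U i. \<phi> (u + v) = \<phi> u + \<phi> v"
          by (subst (1 2) Ui) (auto simp: V.gact_add_left[symmetric] \<phi> S.gact_add_left)
        show "\<forall>c. \<forall>u\<in>U i. \<phi> (cscale c u) = cscale c (\<phi> u)"
          by (subst Ui) (auto simp: V.gact_scale_left[symmetric] \<phi> S.gact_scale_left)
        show "\<forall>\<sigma>. \<sigma> permutes {..<n} \<longrightarrow> (\<forall>u\<in>U i. \<phi> (act \<sigma> u) = actS \<sigma> (\<phi> u))"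
          by (subst Ui) (auto simp: V.act_gact S.act_gact \<phi>)
      qed
      hence iI: "i \<in> ?I" using i by blast
      have "fd (U i)" using fd_subset[OF V] inV i by blast
      hence "\<exists>c. u i = cscale c (t i)"
        using V.schur_scalar[of n "U i" "t i" "u i"] irr i t[OF iI] u(2) ann by auto
      thus ?thesis using iI by auto
    qed
    then obtain c where c: "\<And>i. i < k \<Longrightarrow> u i = (if i \<in> ?I then cscale (c i) (t i) else 0)" by metis
    have "v = (\<Sum>i\<in>?I. cscale (c i) (t i))" unfolding u(1) ext using c by (intro sum.cong) auto
    thus "\<exists>c. v = (\<Sum>i\<in>?I. cscale (c i) (t i))" by blast
  qed
  thus ?thesis by simp
qed

lemma multiplicity_in_eq_dim:
  assumes S: "irreducible_module n actS S" "s \<in> S" "s \<noteq> 0" and V: "submodule n act V" "fd V"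
  shows "multiplicity_in n actS S act V = cvec.dim (hom_image n actS s act V)"
  unfolding multiplicity_in_def
proof (rule the_equality)
  show "\<exists>k U. direct_sum k U V \<and> (\<forall>i<k. irreducible_module n act (U i)) \<and>
    cvec.dim (hom_image n actS s act V) = card {i. i < k \<and> isomorphic_modules n act (U i) actS S}"
  proof -
    obtain k U where "direct_sum k U V" "\<forall>i<k. irreducible_module n act (U i)"
      using V.decomposition_exists[OF V] by blast
    thus ?thesis using multiplicity_count[OF S V(2)] by fastforce
  qed
  show "m = cvec.dim (hom_image n actS s act V)"
    if "\<exists>k U. direct_sum k U V \<and> (\<forall>i<k. irreducible_module n act (U i)) \<and>
      m = card {i. i < k \<and> isomorphic_modules n act (U i) actS S}" for m
    using that by (elim exE conjE) (simp add: multiplicity_count[OF S V(2)])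
qed

lemma multiplicity_in_eq_0:
  assumes S: "\<not> irreducible_module n actS S" and V: "submodule n act V" "fd V"
  shows "multiplicity_in n actS S act V = 0"
  unfolding multiplicity_in_def
proof (rule the_equality)
  have *: "{i. i < k \<and> isomorphic_modules n act (U i) actS S} = {}"
    if "\<forall>i<k. irreducible_module n act (U i)" for k U
    using that isomorphic_irreducible S by blast
  show "\<exists>k U. direct_sum k U V \<and> (\<forall>i<k. irreducible_module n act (U i)) \<and>
    0 = card {i. i < k \<and> isomorphic_modules n act (U i) actS S}"
  proof -
    obtain k U where "direct_sum k U V" "\<forall>i<k. irreducible_module n act (U i)"
      using V.decomposition_exists[OF V] by blast
    thus ?thesis using *[of k U] by (intro exI[of _ k] exI[of _ U]) simp
  qed
  show "m = 0" if "\<exists>k U. direct_sum k U V \<and> (\<forall>i<k. irreducible_module n act (U i)) \<and>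
    m = card {i. i < k \<and> isomorphic_modules n act (U i) actS S}" for m
    using that by (elim exE conjE) (simp add: *)
qed

end

section \<open>Counting semistandard tableaux\<close>

text \<open>In this section a partition is the function giving its row lengths.\<close>

definition is_part :: "(nat \<Rightarrow> nat) \<Rightarrow> bool" where
  "is_part f \<longleftrightarrow> antimono f \<and> (\<exists>N. f N = 0)"

definition psize :: "(nat \<Rightarrow> nat) \<Rightarrow> nat" where
  "psize f = (\<Sum>i | f i \<noteq> 0. f i)"

definition shapes :: "nat \<Rightarrow> (nat \<Rightarrow> nat) set" where
  "shapes k = {f. is_part f \<and> psize f = k}"

definition fcells :: "(nat \<Rightarrow> nat) \<Rightarrow> (nat \<times> nat) set" where
  "fcells f = {(i, j). j < f i}"

text \<open>Interlacing: the skew shape between \<open>\<nu>\<close> and \<open>\<mu>\<close> has at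
  most one cell in each column, that is, it is a horizontal strip.\<close>

definition hstrip :: "(nat \<Rightarrow> nat) \<Rightarrow> (nat \<Rightarrow> nat) \<Rightarrow> bool" where
  "hstrip \<nu> \<mu> \<longleftrightarrow> (\<forall>i. \<nu> i \<le> \<mu> i \<and> \<mu> (Suc i) \<le> \<nu> i)"

lemma is_part_antimono: "is_part f \<Longrightarrow> i \<le> j \<Longrightarrow> f j \<le> f i"
  unfolding is_part_def antimono_def by blast

lemma is_part_zero: "is_part f \<Longrightarrow> f N = 0 \<Longrightarrow> N \<le> i \<Longrightarrow> f i = 0"
  using is_part_antimono[of f N i] by simp

lemma psize_eq:
  assumes "is_part f" "f N = 0"
  shows "psize f = (\<Sum>i<N. f i)"
proof -
  have "{i. f i \<noteq> 0} \<subseteq> {..<N}" using is_part_zero[OF assms] by (metis (mono_tags) lessThan_iff mem_Collect_eq not_le subsetI)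
  thus ?thesis unfolding psize_def by (intro sum.mono_neutral_left) auto
qed

text \<open>Were the row of index \<open>psize f\<close> nonempty, the rows up to it would already
  hold more than \<open>psize f\<close> cells. The bound is uniform in the size, which the
  finiteness lemmas use.\<close>

lemma is_part_psize_zero:
  assumes "is_part f"
  shows "f (psize f) = 0"
proof (rule ccontr)
  assume nz: "f (psize f) \<noteq> 0"
  obtain N where N: "f N = 0" using assms unfolding is_part_def by blast
  have lt: "psize f < N" using nz is_part_zero[OF assms N] by (metis not_le)
  have "Suc (psize f) = (\<Sum>i<Suc (psize f). 1)" by simp
  also have "\<dots> \<le> (\<Sum>i<Suc (psize f). f i)"
    using nz is_part_antimono[OF assms] by (intro sum_mono) (metis One_nat_def Suc_leI gr0I le_zero_eq lessThan_iff less_Suc_eq_le)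
  also have "\<dots> \<le> (\<Sum>i<N. f i)" using lt by (intro sum_mono2) auto
  finally show False using psize_eq[OF assms N] by simp
qed

lemma hstrip_is_part_lower: "hstrip \<nu> \<mu> \<Longrightarrow> is_part \<mu> \<Longrightarrow> is_part \<nu>"
  unfolding hstrip_def is_part_def
  by (metis antimonoI decseq_SucI le_trans le_zero_eq)

lemma hstrip_is_part_upper: "hstrip \<nu> \<mu> \<Longrightarrow> is_part \<nu> \<Longrightarrow> is_part \<mu>"
  unfolding hstrip_def is_part_def
  by (metis decseq_SucI le_trans le_zero_eq)

lemma is_part_common_zero:
  assumes "is_part f" "is_part g"
  obtains N where "f N = 0" "g N = 0"
proof -
  obtain M N where "f M = 0" "g N = 0" using assms unfolding is_part_def by blast
  thus ?thesis using that[of "max M N"] is_part_zero[OF assms(1)] is_part_zero[OF assms(2)] by simp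
qed

lemma psize_mono:
  assumes "is_part f" "is_part g" "\<And>i. f i \<le> g i"
  shows "psize f \<le> psize g"
proof -
  obtain N where N: "f N = 0" "g N = 0" using is_part_common_zero[OF assms(1,2)] .
  show ?thesis using psize_eq[OF assms(1) N(1)] psize_eq[OF assms(2) N(2)] assms(3) by (simp add: sum_mono)
qed

lemma psize_eq_imp_eq:
  assumes "is_part f" "is_part g" "\<And>i. f i \<le> g i" "psize f = psize g"
  shows "f = g"
proof (rule ext, rule ccontr)
  fix i assume ne: "f i \<noteq> g i"
  obtain N where N: "f N = 0" "g N = 0" using is_part_common_zero[OF assms(1,2)] .
  have "i < N" using ne is_part_zero[OF assms(1) N(1)] is_part_zero[OF assms(2) N(2)] by (metis not_le)
  hence "(\<Sum>i<N. f i) < (\<Sum>i<N. g i)"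
    using ne assms(3) by (intro sum_strict_mono_ex1) (auto intro!: bexI[of _ i] simp: le_neq_implies_less)
  thus False using psize_eq[OF assms(1) N(1)] psize_eq[OF assms(2) N(2)] assms(4) by simp
qed

lemma finite_bounded_funs: "finite {f :: nat \<Rightarrow> nat. \<forall>i. f i \<le> (if i < N then M else 0)}"
proof (rule finite_subset)
  show "{f :: nat \<Rightarrow> nat. \<forall>i. f i \<le> (if i < N then M else 0)} \<subseteq>
    {f. \<forall>x. (x \<in> {..<N} \<longrightarrow> f x \<in> {..M}) \<and> (x \<notin> {..<N} \<longrightarrow> f x = 0)}"
    by (auto split: if_splits)
qed (rule finite_set_of_finite_funs, auto)

lemma finite_shapes_le: "finite {f. is_part f \<and> psize f \<le> k}"
proof (rule finite_subset[OF _ finite_bounded_funs[of k k]], intro subsetI CollectI allI)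
  fix f i assume "f \<in> {f. is_part f \<and> psize f \<le> k}"
  hence f: "is_part f" "psize f \<le> k" by auto
  have z: "f k = 0" using is_part_zero[OF f(1) is_part_psize_zero[OF f(1)] f(2)] .
  show "f i \<le> (if i < k then k else 0)"
  proof (cases "i < k")
    case True
    have "f i \<le> (\<Sum>i<k. f i)" using True by (intro member_le_sum) auto
    thus ?thesis using True f(2) psize_eq[OF f(1) z] by simp
  qed (use is_part_zero[OF f(1) z] in simp)
qed

lemma finite_shapes [simp]: "finite (shapes k)"
  by (rule finite_subset[OF _ finite_shapes_le[of k]]) (auto simp: shapes_def)

lemma finite_fcells [simp]: "is_part f \<Longrightarrow> finite (fcells f)"
proof -
  assume f: "is_part f"
  have "fcells f = Sigma {..<psize f} (\<lambda>i. {..<f i})"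
    using is_part_zero[OF f is_part_psize_zero[OF f]] unfolding fcells_def
    by auto (metis less_nat_zero_code not_le)
  thus ?thesis by simp
qed

lemma card_fcells:
  assumes "is_part f"
  shows "card (fcells f) = psize f"
proof -
  obtain N where N: "f N = 0" using assms unfolding is_part_def by blast
  have "fcells f = Sigma {..<N} (\<lambda>i. {..<f i})"
    using is_part_zero[OF assms N] unfolding fcells_def
    by auto (metis less_nat_zero_code not_le)
  thus ?thesis using psize_eq[OF assms N] by simp
qed

subsection \<open>The local rule\<close>

text \<open>
  The toggle \<open>\<nu> i + \<kappa> (i + 1) = min (a i) (b i) + max (a (i + 1)) (b (i + 1))\<close> turns the partitions above \<open>a\<close> and \<open>b\<close>
  into those below; this is the growth-diagram form of the Robinson--Schensted--Knuth correspondence.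
\<close>

lemma local_rule_size:
  assumes a: "is_part a" and b: "is_part b" and \<nu>: "is_part \<nu>" and \<kappa>: "is_part \<kappa>"
    and toggle: "\<And>i. \<nu> i + \<kappa> (Suc i) = min (a i) (b i) + max (a (Suc i)) (b (Suc i))"
  shows "psize \<nu> + psize \<kappa> + max (a 0) (b 0) = \<kappa> 0 + psize a + psize b"
proof -
  obtain M1 M2 where M: "a M1 = 0" "b M1 = 0" "\<nu> M2 = 0" "\<kappa> M2 = 0"
    using is_part_common_zero[OF a b] is_part_common_zero[OF \<nu> \<kappa>] by metis
  define N where "N = max M1 M2"
  have z: "a N = 0" "b N = 0" "\<nu> N = 0" "\<kappa> N = 0" "a (Suc N) = 0" "b (Suc N) = 0" "\<kappa> (Suc N) = 0"
    using is_part_zero[OF a M(1)] is_part_zero[OF b M(2)] is_part_zero[OF \<nu> M(3)] is_part_zero[OF \<kappa> M(4)]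
    by (auto simp: N_def)
  have "psize \<nu> + psize \<kappa> = (\<Sum>i<N. \<nu> i) + (\<kappa> 0 + (\<Sum>i<N. \<kappa> (Suc i)))"
    using psize_eq[OF \<nu> z(3)] psize_eq[OF \<kappa> z(7)] by (simp only: sum.lessThan_Suc_shift)
  also have "\<dots> = \<kappa> 0 + (\<Sum>i<N. \<nu> i + \<kappa> (Suc i))" by (simp add: sum.distrib)
  also have "\<dots> = \<kappa> 0 + (\<Sum>i<N. min (a i) (b i)) + (\<Sum>i<N. max (a (Suc i)) (b (Suc i)))"
    by (simp add: toggle sum.distrib)
  also have "\<dots> + max (a 0) (b 0) = \<kappa> 0 + (\<Sum>i<N. min (a i) (b i)) + (\<Sum>i<Suc N. max (a i) (b i))"
    by (simp only: sum.lessThan_Suc_shift)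
  also have "\<dots> = \<kappa> 0 + (\<Sum>i<N. min (a i) (b i) + max (a i) (b i))" using z by (simp add: sum.distrib)
  also have "\<dots> = \<kappa> 0 + (\<Sum>i<N. a i + b i)"
    by (intro arg_cong[where f = "\<lambda>x. \<kappa> 0 + x"] sum.cong) auto
  also have "\<dots> = \<kappa> 0 + psize a + psize b"
    using psize_eq[OF a z(1)] psize_eq[OF b z(2)] by (simp add: sum.distrib)
  finally show ?thesis .
qed

text \<open>The toggle determines every row of \<open>\<kappa>\<close> except the first from
  \<open>\<nu>\<close>, and the prescribed size determines the first. The inequality between sizes
  says exactly that this first row is at least \<open>max (a 0) (b 0)\<close>.\<close>

lemma local_rule:
  assumes a: "is_part a" and b: "is_part b"
  shows "card {\<kappa>. hstrip a \<kappa> \<and> hstrip b \<kappa> \<and> psize \<kappa> = s} =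
         card {\<nu>. hstrip \<nu> a \<and> hstrip \<nu> b \<and> psize a + psize b \<le> psize \<nu> + s}"
    (is "card ?U = card ?D")
proof -
  define m where "m = (\<lambda>i. min (a i) (b i) + max (a (Suc i)) (b (Suc i)))"
  let ?f = "\<lambda>\<kappa> i. m i - \<kappa> (Suc i)"
  \<comment> \<open>The first row exceeds its least possible value by the surplus that
    \<open>local_rule_size\<close> dictates.\<close>
  let ?g = "\<lambda>\<nu> i. case i of 0 \<Rightarrow> max (a 0) (b 0) + (psize \<nu> + s - (psize a + psize b)) | Suc i \<Rightarrow> m i - \<nu> i"
  have up: "max (a i) (b i) \<le> \<kappa> i" "\<kappa> (Suc i) \<le> min (a i) (b i)" if "\<kappa> \<in> ?U" for \<kappa> i
    using that unfolding hstrip_def by auto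
  have dn: "max (a (Suc i)) (b (Suc i)) \<le> \<nu> i" "\<nu> i \<le> min (a i) (b i)" if "\<nu> \<in> ?D" for \<nu> i
    using that unfolding hstrip_def by auto
  have f: "?f \<kappa> \<in> ?D" "?g (?f \<kappa>) = \<kappa>" if k: "\<kappa> \<in> ?U" for \<kappa>
  proof -
    have bnd: "max (a (Suc i)) (b (Suc i)) \<le> ?f \<kappa> i" "?f \<kappa> i \<le> min (a i) (b i)" "?f \<kappa> i + \<kappa> (Suc i) = m i" for i
      using up[OF k, of i] up[OF k, of "Suc i"] unfolding m_def by auto
    have hs: "hstrip (?f \<kappa>) a" "hstrip (?f \<kappa>) b" using bnd unfolding hstrip_def by auto
    have "is_part \<kappa>" using k hstrip_is_part_upper a by blast
    moreover have "is_part (?f \<kappa>)" using hs hstrip_is_part_lower a by blast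
    ultimately have sz: "psize (?f \<kappa>) + psize \<kappa> + max (a 0) (b 0) = \<kappa> 0 + psize a + psize b"
      using local_rule_size[OF a b] bnd(3) unfolding m_def by simp
    have s: "psize \<kappa> = s" using k by simp
    have "psize a + psize b \<le> psize (?f \<kappa>) + s" using sz up(1)[OF k, of 0] s by linarith
    thus "?f \<kappa> \<in> ?D" using hs by blast
    show "?g (?f \<kappa>) = \<kappa>"
    proof
      fix i show "?g (?f \<kappa>) i = \<kappa> i"
        using sz s up(1)[OF k, of 0] bnd(3)[of "i - 1"] by (cases i) auto
    qed
  qed
  have g: "?g \<nu> \<in> ?U" "?f (?g \<nu>) = \<nu>" if n: "\<nu> \<in> ?D" for \<nu>
  proof -
    have bnd: "max (a i) (b i) \<le> ?g \<nu> i" "?g \<nu> (Suc i) \<le> min (a i) (b i)" for i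
      using dn[OF n, of i] dn[OF n, of "i - 1"] unfolding m_def by (cases i; auto)+
    have tog: "\<nu> i + ?g \<nu> (Suc i) = m i" for i using dn[OF n, of i] unfolding m_def by auto
    have hs: "hstrip a (?g \<nu>)" "hstrip b (?g \<nu>)" using bnd unfolding hstrip_def by auto
    have "is_part (?g \<nu>)" using hs hstrip_is_part_upper a by blast
    moreover have "is_part \<nu>" using n hstrip_is_part_lower a by blast
    ultimately have sz: "psize \<nu> + psize (?g \<nu>) + max (a 0) (b 0) = ?g \<nu> 0 + psize a + psize b"
      using local_rule_size[OF a b, of \<nu> "?g \<nu>"] tog unfolding m_def by blast
    have "psize a + psize b \<le> psize \<nu> + s" using n by simp
    moreover have "?g \<nu> 0 = max (a 0) (b 0) + (psize \<nu> + s - (psize a + psize b))" by simp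
    ultimately have "psize (?g \<nu>) = s" using sz by linarith
    thus "?g \<nu> \<in> ?U" using hs by blast
    show "?f (?g \<nu>) = \<nu>" using tog by (intro ext) (metis add_diff_cancel_right')
  qed
  have "bij_betw ?f ?U ?D" by (rule bij_betw_byWitness[where f' = ?g]) (use f g in blast)+
  thus ?thesis by (rule bij_betw_same_card)
qed

text \<open>When \<open>\<kappa>\<close> has one cell more than \<open>b\<close>, the size condition
  leaves those \<open>\<nu>\<close> that lose at most one cell of \<open>a\<close>, and
  \<open>\<nu> = a\<close> is possible exactly if \<open>a\<close> and \<open>b\<close> interlace.
  Adding a cell thus commutes with removing a horizontal strip up to one extra term.\<close>

lemma local_rule_box:
  assumes a: "is_part a" and b: "is_part b"
  shows "card {\<kappa>. hstrip a \<kappa> \<and> hstrip b \<kappa> \<and> psize \<kappa> = psize b + 1} =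
         card {\<nu>. hstrip \<nu> a \<and> hstrip \<nu> b \<and> psize \<nu> + 1 = psize a} + (if hstrip a b then 1 else 0)"
proof -
  let ?A = "{\<nu>. hstrip \<nu> a \<and> hstrip \<nu> b \<and> psize \<nu> + 1 = psize a}"
  let ?B = "{\<nu>. \<nu> = a \<and> hstrip a b}"
  have "{\<nu>. hstrip \<nu> a \<and> hstrip \<nu> b \<and> psize a + psize b \<le> psize \<nu> + (psize b + 1)} = ?A \<union> ?B"
  proof (intro equalityI subsetI)
    fix \<nu> assume n: "\<nu> \<in> {\<nu>. hstrip \<nu> a \<and> hstrip \<nu> b \<and> psize a + psize b \<le> psize \<nu> + (psize b + 1)}"
    have p: "is_part \<nu>" using n hstrip_is_part_lower a by blast
    have le: "\<nu> i \<le> a i" for i using n unfolding hstrip_def by blast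
    have "psize \<nu> \<le> psize a" using psize_mono[OF p a le] .
    thus "\<nu> \<in> ?A \<union> ?B" using n psize_eq_imp_eq[OF p a le] by (cases "psize \<nu> = psize a") auto
  next
    fix \<nu> assume "\<nu> \<in> ?A \<union> ?B"
    thus "\<nu> \<in> {\<nu>. hstrip \<nu> a \<and> hstrip \<nu> b \<and> psize a + psize b \<le> psize \<nu> + (psize b + 1)}"
      using is_part_antimono[OF a] by (auto simp: hstrip_def)
  qed
  moreover have "finite ?A"
    by (rule finite_subset[OF _ finite_shapes_le[of "psize a"]]) (use hstrip_is_part_lower[OF _ a] in auto)
  moreover have "finite ?B" "card ?B = (if hstrip a b then 1 else 0)" by auto
  moreover have "?A \<inter> ?B = {}" by auto
  ultimately show ?thesis using local_rule[OF a b, of "psize b + 1"] by (simp add: card_Un_disjoint)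
qed

subsection \<open>Kostka numbers\<close>

definition sstd :: "(nat \<Rightarrow> nat) \<Rightarrow> (nat \<times> nat \<Rightarrow> nat) \<Rightarrow> bool" where
  "sstd f T \<longleftrightarrow> (\<forall>i j. Suc j < f i \<longrightarrow> T (i, j) \<le> T (i, Suc j)) \<and>
     (\<forall>i j. j < f (Suc i) \<longrightarrow> T (i, j) < T (Suc i, j))"

definition ssyt :: "(nat \<Rightarrow> nat) \<Rightarrow> nat \<Rightarrow> (nat \<Rightarrow> nat) \<Rightarrow> (nat \<times> nat \<Rightarrow> nat) set" where
  "ssyt f r d = {T \<in> fcells f \<rightarrow>\<^sub>E {..<r}. sstd f T \<and> (\<forall>k<r. card {c \<in> fcells f. T c = k} = d k)}"

definition kostka :: "(nat \<Rightarrow> nat) \<Rightarrow> nat \<Rightarrow> (nat \<Rightarrow> nat) \<Rightarrow> nat" where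
  "kostka f r d = card (ssyt f r d)"

lemma finite_ssyt: "is_part f \<Longrightarrow> finite (ssyt f r d)"
  unfolding ssyt_def by (rule finite_subset[of _ "fcells f \<rightarrow>\<^sub>E {..<r}"]) (auto intro: finite_PiE)

lemma kostka_cong: "(\<And>i. i < r \<Longrightarrow> d i = d' i) \<Longrightarrow> kostka f r d = kostka f r d'"
  unfolding kostka_def ssyt_def by (intro arg_cong[where f = card]) auto

lemma sstd_row_mono:
  assumes "sstd f T" "j \<le> j'" "j' < f i"
  shows "T (i, j) \<le> T (i, j')"
  using assms(2,3)
proof (induction j' rule: dec_induct)
  case (step m)
  thus ?case using assms(1) unfolding sstd_def by (meson Suc_lessD le_trans)
qed simp

lemma sstd_col_mono:
  assumes "sstd f T" "is_part f" "i < i'" "j < f i'"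
  shows "T (i, j) < T (i', j)"
  using assms(3,4)
proof (induction i' rule: less_Suc_induct)
  case (1 i)
  thus ?case using assms(1) unfolding sstd_def by blast
next
  case (2 i m l)
  have "j < f m" using 2 is_part_antimono[OF assms(2), of m l] by simp
  thus ?case using 2 by fastforce
qed

text \<open>The cells with the largest possible entry \<open>r\<close> form a horizontal strip of
  size \<open>d r\<close>; removing them leaves a tableau with entries below
  \<open>r\<close>.\<close>

lemma kostka_Suc:
  assumes f: "is_part f"
  shows "kostka f (Suc r) d = (\<Sum>\<nu> | hstrip \<nu> f \<and> psize \<nu> + d r = psize f. kostka \<nu> r d)"
proof -
  let ?B = "{\<nu>. hstrip \<nu> f \<and> psize \<nu> + d r = psize f}"
  let ?S = "ssyt f (Suc r) d"
  \<comment> \<open>Row lengths of the part with entries below \<open>r\<close>; as rows increase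
    weakly, that part consists of initial segments of the rows.\<close>
  let ?sh = "\<lambda>T i. card {j. j < f i \<and> T (i, j) < r}"
  have finB: "finite ?B"
    by (rule finite_subset[OF _ finite_shapes_le[of "psize f"]]) (use hstrip_is_part_lower[OF _ f] in auto)
  have sh: "j < ?sh T i \<longleftrightarrow> j < f i \<and> T (i, j) < r" if T: "T \<in> ?S" for T i j
  proof -
    have sT: "sstd f T" using T unfolding ssyt_def by blast
    have "\<exists>m. {j. j < f i \<and> T (i, j) < r} = {..<m}"
    proof -
      have "j \<in> {j. j < f i \<and> T (i, j) < r}" if "j' \<in> {j. j < f i \<and> T (i, j) < r}" "j \<le> j'" for j j'
        using that sstd_row_mono[OF sT, of j j' i] by auto
      hence dc: "\<And>j j'. j' \<in> {j. j < f i \<and> T (i, j) < r} \<Longrightarrow> j \<le> j' \<Longrightarrow> j \<in> {j. j < f i \<and> T (i, j) < r}" by blast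
      let ?m = "LEAST m. m \<notin> {j. j < f i \<and> T (i, j) < r}"
      have "?m \<notin> {j. j < f i \<and> T (i, j) < r}" by (rule LeastI[of _ "f i"]) simp
      hence "{j. j < f i \<and> T (i, j) < r} = {..<?m}"
        using dc not_less_Least[of _ "\<lambda>m. m \<notin> {j. j < f i \<and> T (i, j) < r}"]
        by (metis (no_types, lifting) lessThan_iff not_le subsetI subset_antisym)
      thus ?thesis by blast
    qed
    then obtain m where "{j. j < f i \<and> T (i, j) < r} = {..<m}" by blast
    thus ?thesis by (metis (mono_tags, lifting) card_lessThan lessThan_iff mem_Collect_eq)
  qed
  have cells: "fcells (?sh T) = {c \<in> fcells f. T c < r}" if "T \<in> ?S" for T
    unfolding fcells_def using sh[OF that] by auto
  have shB: "?sh T \<in> ?B" if T: "T \<in> ?S" for T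
  proof -
    have T': "T \<in> fcells f \<rightarrow>\<^sub>E {..<Suc r}" "sstd f T" "card {c \<in> fcells f. T c = r} = d r"
      using T unfolding ssyt_def by auto
    have hs: "hstrip (?sh T) f" unfolding hstrip_def
    proof (intro allI conjI)
      fix i
      show "?sh T i \<le> f i" using sh[OF T, of "f i" i] by (metis less_irrefl not_le)
      show "f (Suc i) \<le> ?sh T i"
      proof (rule ccontr)
        assume "\<not> f (Suc i) \<le> ?sh T i"
        hence j: "?sh T i < f (Suc i)" by simp
        hence "T (i, ?sh T i) < T (Suc i, ?sh T i)" using T'(2) unfolding sstd_def by blast
        moreover have "T (Suc i, ?sh T i) < Suc r" using T'(1) j by (auto simp: fcells_def PiE_iff)
        moreover have "?sh T i < f i" using j is_part_antimono[OF f, of i "Suc i"] by simp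
        ultimately show False using sh[OF T, of "?sh T i" i] by simp
      qed
    qed
    have p: "is_part (?sh T)" using hstrip_is_part_lower[OF hs f] .
    have "fcells f = {c \<in> fcells f. T c < r} \<union> {c \<in> fcells f. T c = r}"
      using T'(1) by (auto simp: PiE_iff less_Suc_eq)
    hence "card (fcells f) = card {c \<in> fcells f. T c < r} + card {c \<in> fcells f. T c = r}"
      using finite_fcells[OF f] by (subst card_Un_disjoint[symmetric]) auto
    hence "psize f = psize (?sh T) + d r"
      using card_fcells[OF f] card_fcells[OF p] cells[OF T] T'(3) by simp
    thus ?thesis using hs by simp
  qed
  have fibre: "card {T \<in> ?S. ?sh T = \<nu>} = kostka \<nu> r d" if n: "\<nu> \<in> ?B" for \<nu>
  proof -
    let ?r = "\<lambda>T. restrict T (fcells \<nu>)"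
    \<comment> \<open>Inverse of restriction: all cells of the strip receive the entry
      \<open>r\<close>.\<close>
    let ?e = "\<lambda>T c. if c \<in> fcells \<nu> then T c else if c \<in> fcells f then r else undefined"
    have p: "is_part \<nu>" using n hstrip_is_part_lower[OF _ f] by blast
    have hs: "\<nu> i \<le> f i" "f (Suc i) \<le> \<nu> i" for i using n unfolding hstrip_def by auto
    have sub: "fcells \<nu> \<subseteq> fcells f" unfolding fcells_def using hs(1) by (auto intro: less_le_trans)
    have r: "?r T \<in> ssyt \<nu> r d" "?e (?r T) = T" if T: "T \<in> {T \<in> ?S. ?sh T = \<nu>}" for T
    proof -
      have T': "T \<in> fcells f \<rightarrow>\<^sub>E {..<Suc r}" "sstd f T" "\<And>k. k < r \<Longrightarrow> card {c \<in> fcells f. T c = k} = d k"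
        using T unfolding ssyt_def by auto
      have TS: "T \<in> ?S" "?sh T = \<nu>" using T by auto
      have c: "fcells \<nu> = {c \<in> fcells f. T c < r}" using cells[OF TS(1)] TS(2) by simp
      have "sstd \<nu> (?r T)" unfolding sstd_def
      proof (intro conjI allI impI)
        fix i j assume "Suc j < \<nu> i"
        thus "?r T (i, j) \<le> ?r T (i, Suc j)"
          using T'(2) hs(1)[of i] unfolding sstd_def fcells_def by auto
      next
        fix i j assume "j < \<nu> (Suc i)"
        thus "?r T (i, j) < ?r T (Suc i, j)"
          using T'(2) hs(1)[of "Suc i"] is_part_antimono[OF p, of i "Suc i"] unfolding sstd_def fcells_def by auto
      qed
      moreover have "card {x \<in> fcells \<nu>. ?r T x = k} = d k" if "k < r" for k
      proof -
        have "{x \<in> fcells \<nu>. ?r T x = k} = {x \<in> fcells f. T x = k}" using that c by auto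
        thus ?thesis using T'(3)[OF that] by simp
      qed
      ultimately show "?r T \<in> ssyt \<nu> r d" unfolding ssyt_def using c by auto
      show "?e (?r T) = T"
      proof
        fix x show "?e (?r T) x = T x"
          using c T'(1) by (cases x) (auto simp: PiE_iff extensional_def less_Suc_eq)
      qed
    qed
    have e: "?e T \<in> {T \<in> ?S. ?sh T = \<nu>}" "?r (?e T) = T" if T: "T \<in> ssyt \<nu> r d" for T
    proof -
      have T': "T \<in> fcells \<nu> \<rightarrow>\<^sub>E {..<r}" "sstd \<nu> T" "\<And>k. k < r \<Longrightarrow> card {c \<in> fcells \<nu>. T c = k} = d k"
        using T unfolding ssyt_def by auto
      have lt: "T x < r" if "x \<in> fcells \<nu>" for x using T'(1) that by auto
      have "sstd f (?e T)" unfolding sstd_def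
      proof (intro conjI allI impI)
        fix i j assume j: "Suc j < f i"
        show "?e T (i, j) \<le> ?e T (i, Suc j)"
          using j T'(2) lt[of "(i, j)"] unfolding sstd_def fcells_def by auto
      next
        fix i j assume j: "j < f (Suc i)"
        hence "(i, j) \<in> fcells \<nu>" using hs(2)[of i] unfolding fcells_def by auto
        thus "?e T (i, j) < ?e T (Suc i, j)"
          using j T'(2) lt[of "(i, j)"] unfolding sstd_def fcells_def by auto
      qed
      moreover have "?e T \<in> fcells f \<rightarrow>\<^sub>E {..<Suc r}" using lt sub by (auto simp: PiE_iff extensional_def less_Suc_eq)
      moreover have "card {c \<in> fcells f. ?e T c = k} = d k" if "k < Suc r" for k
      proof (cases "k = r")
        case True
        have "{c \<in> fcells f. ?e T c = k} = fcells f - fcells \<nu>" using True lt by auto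
        thus ?thesis
          using True n card_Diff_subset[OF finite_fcells[OF p] sub] card_fcells[OF f] card_fcells[OF p] by auto
      next
        case False
        have "{c \<in> fcells f. ?e T c = k} = {c \<in> fcells \<nu>. T c = k}" using False sub by auto
        thus ?thesis using T'(3) that False by simp
      qed
      ultimately have eS: "?e T \<in> ?S" unfolding ssyt_def by blast
      have "fcells (?sh (?e T)) = {c \<in> fcells f. ?e T c < r}" using cells[OF eS] .
      also have "\<dots> = fcells \<nu>" using lt sub by auto
      finally have eq: "fcells (?sh (?e T)) = fcells \<nu>" .
      have "?sh (?e T) i = \<nu> i" for i
      proof -
        have jj: "j < ?sh (?e T) i \<longleftrightarrow> j < \<nu> i" for j
        proof -
          have "(i, j) \<in> fcells (?sh (?e T)) \<longleftrightarrow> (i, j) \<in> fcells \<nu>" by (simp only: eq)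
          thus ?thesis unfolding fcells_def by (simp only: mem_Collect_eq case_prod_conv)
        qed
        show ?thesis using jj[of "\<nu> i"] jj[of "?sh (?e T) i"] by linarith
      qed
      thus "?e T \<in> {T \<in> ?S. ?sh T = \<nu>}" using eS by auto
      show "?r (?e T) = T" using T'(1) by (auto simp: PiE_iff extensional_def fun_eq_iff)
    qed
    have "bij_betw ?r {T \<in> ?S. ?sh T = \<nu>} (ssyt \<nu> r d)"
      by (rule bij_betw_byWitness[where f' = ?e]) (use r e in blast)+
    thus ?thesis unfolding kostka_def by (rule bij_betw_same_card)
  qed
  have im: "?sh ` ?S \<subseteq> ?B" using shB by blast
  have "card ?S = (\<Sum>\<nu>\<in>?B. \<Sum>T\<in>{T \<in> ?S. ?sh T = \<nu>}. 1)"
    using sum.group[OF finite_ssyt[OF f, of "Suc r" d] finB im, of "\<lambda>_. 1 :: nat"] by simp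
  also have "\<dots> = (\<Sum>\<nu>\<in>?B. kostka \<nu> r d)"
    by (intro sum.cong refl) (use fibre in simp)
  finally show ?thesis unfolding kostka_def .
qed

lemma sum_indicator_mult_swap:
  fixes g :: "'b \<Rightarrow> nat"
  assumes "finite A" "finite B"
  shows "(\<Sum>a\<in>A. \<Sum>b | b \<in> B \<and> R a b. g b) = (\<Sum>b\<in>B. card {a \<in> A. R a b} * g b)"
proof -
  have "(\<Sum>a\<in>A. \<Sum>b | b \<in> B \<and> R a b. g b) = (\<Sum>b\<in>B. \<Sum>a | a \<in> A \<and> R a b. g b)"
    by (rule sum.swap_restrict[OF assms])
  thus ?thesis by simp
qed

lemma finite_hstrip_below:
  assumes f: "is_part f"
  shows "finite {\<nu>. hstrip \<nu> f \<and> P \<nu>}"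
proof (rule finite_subset[OF _ finite_shapes_le[of "psize f"]], intro subsetI CollectI)
  fix \<nu> assume "\<nu> \<in> {\<nu>. hstrip \<nu> f \<and> P \<nu>}"
  hence h: "hstrip \<nu> f" by blast
  hence p: "is_part \<nu>" using hstrip_is_part_lower f by blast
  thus "is_part \<nu> \<and> psize \<nu> \<le> psize f" using psize_mono[OF p f] h unfolding hstrip_def by blast
qed

lemma finite_hstrip_above: "is_part f \<Longrightarrow> finite {\<kappa>. hstrip f \<kappa> \<and> psize \<kappa> = s}"
  by (rule finite_subset[OF _ finite_shapes_le[of s]]) (auto intro: hstrip_is_part_upper)

text \<open>Pieri's rule for a single cell at the coefficient of content \<open>d\<close>: the right
  side belongs to the product of the Schur polynomial of \<open>p\<close> with the sum of the
  variables. Stripping the entries \<open>r\<close> reduces it to the local rule and to fewer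
  variables.\<close>

lemma kostka_add_box:
  assumes "is_part p"
  shows "(\<Sum>\<kappa> | hstrip p \<kappa> \<and> psize \<kappa> = psize p + 1. kostka \<kappa> r d) =
         (\<Sum>i | i < r \<and> 0 < d i. kostka p r (d(i := d i - 1)))"
  using assms
proof (induction r arbitrary: p)
  case 0
  have "kostka \<kappa> 0 d = 0" if "hstrip p \<kappa> \<and> psize \<kappa> = psize p + 1" for \<kappa>
  proof -
    have "card (fcells \<kappa>) \<noteq> 0" using that card_fcells hstrip_is_part_upper 0 by auto
    hence "fcells \<kappa> \<noteq> {}" by auto
    thus ?thesis unfolding kostka_def ssyt_def by (auto simp: PiE_eq_empty_iff)
  qed
  thus ?case by simp
next
  case (Suc r)
  let ?up = "\<lambda>p. {\<kappa>. hstrip p \<kappa> \<and> psize \<kappa> = psize p + 1}"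
  \<comment> \<open>\<open>L\<close> contains the shapes that can remain when the strip of largest
    entries is removed from an enlargement of \<open>p\<close>; \<open>D\<close> contains those that
    remain when it is removed from \<open>p\<close> itself.\<close>
  define L where "L = {a. is_part a \<and> psize a + d r = psize p + 1}"
  define D where "D = {\<nu>. hstrip \<nu> p \<and> psize \<nu> + d r = psize p}"
  have finL: "finite L"
    by (rule finite_subset[OF _ finite_shapes_le[of "psize p + 1"]]) (auto simp: L_def)
  have finU: "finite (?up q)" if "is_part q" for q using finite_hstrip_above[OF that] .
  have finD: "finite D" unfolding D_def by (rule finite_hstrip_below[OF Suc.prems])
  have partD: "is_part \<nu>" if "\<nu> \<in> D" for \<nu> using that hstrip_is_part_lower[OF _ Suc.prems] unfolding D_def by blast
  have "(\<Sum>\<kappa>\<in>?up p. kostka \<kappa> (Suc r) d) = (\<Sum>\<kappa>\<in>?up p. \<Sum>a | a \<in> L \<and> hstrip a \<kappa>. kostka a r d)"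
  proof (intro sum.cong refl)
    fix \<kappa> assume k: "\<kappa> \<in> ?up p"
    have pk: "is_part \<kappa>" using k hstrip_is_part_upper Suc.prems by blast
    have "{\<nu>. hstrip \<nu> \<kappa> \<and> psize \<nu> + d r = psize \<kappa>} = {a. a \<in> L \<and> hstrip a \<kappa>}"
      using k hstrip_is_part_lower[OF _ pk] unfolding L_def by auto
    thus "kostka \<kappa> (Suc r) d = (\<Sum>a | a \<in> L \<and> hstrip a \<kappa>. kostka a r d)"
      using kostka_Suc[OF pk] by simp
  qed
  also have "\<dots> = (\<Sum>a\<in>L. card {\<kappa> \<in> ?up p. hstrip a \<kappa>} * kostka a r d)"
    by (rule sum_indicator_mult_swap[OF finU[OF Suc.prems] finL])
  \<comment> \<open>The local rule trades a common enlargement of \<open>a\<close> and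
    \<open>p\<close> for a common reduction; the extra term belongs to those \<open>a\<close> that
    already interlace with \<open>p\<close>.\<close>
  also have "\<dots> = (\<Sum>a\<in>L. card {\<nu> \<in> D. a \<in> ?up \<nu>} * kostka a r d + (if hstrip a p then kostka a r d else 0))"
  proof (intro sum.cong refl)
    fix a assume a: "a \<in> L"
    have pa: "is_part a" using a unfolding L_def by blast
    have e1: "{\<kappa> \<in> ?up p. hstrip a \<kappa>} = {\<kappa>. hstrip a \<kappa> \<and> hstrip p \<kappa> \<and> psize \<kappa> = psize p + 1}" by auto
    have e2: "{\<nu> \<in> D. a \<in> ?up \<nu>} = {\<nu>. hstrip \<nu> a \<and> hstrip \<nu> p \<and> psize \<nu> + 1 = psize a}"
      using a unfolding D_def L_def by auto
    show "card {\<kappa> \<in> ?up p. hstrip a \<kappa>} * kostka a r d =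
      card {\<nu> \<in> D. a \<in> ?up \<nu>} * kostka a r d + (if hstrip a p then kostka a r d else 0)"
      unfolding e1 e2 using local_rule_box[OF pa Suc.prems] by (simp add: algebra_simps)
  qed
  also have "\<dots> = (\<Sum>a\<in>L. card {\<nu> \<in> D. a \<in> ?up \<nu>} * kostka a r d) + (\<Sum>a\<in>L. if hstrip a p then kostka a r d else 0)"
    by (rule sum.distrib)
  also have "(\<Sum>a\<in>L. card {\<nu> \<in> D. a \<in> ?up \<nu>} * kostka a r d) = (\<Sum>\<nu>\<in>D. \<Sum>a | a \<in> L \<and> a \<in> ?up \<nu>. kostka a r d)"
    by (rule sum_indicator_mult_swap[OF finD finL, symmetric])
  also have "\<dots> = (\<Sum>\<nu>\<in>D. \<Sum>i | i < r \<and> 0 < d i. kostka \<nu> r (d(i := d i - 1)))"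
  proof (intro sum.cong refl)
    fix \<nu> assume n: "\<nu> \<in> D"
    have "{a. a \<in> L \<and> a \<in> ?up \<nu>} = ?up \<nu>"
      using n partD[OF n] hstrip_is_part_upper unfolding L_def D_def by auto
    thus "(\<Sum>a | a \<in> L \<and> a \<in> ?up \<nu>. kostka a r d) = (\<Sum>i | i < r \<and> 0 < d i. kostka \<nu> r (d(i := d i - 1)))"
      using Suc.IH[OF partD[OF n]] by (simp only:)
  qed
  also have "\<dots> = (\<Sum>i | i < r \<and> 0 < d i. \<Sum>\<nu>\<in>D. kostka \<nu> r (d(i := d i - 1)))" by (rule sum.swap)
  also have "\<dots> = (\<Sum>i | i < r \<and> 0 < d i. kostka p (Suc r) (d(i := d i - 1)))"
    by (intro sum.cong refl) (simp add: kostka_Suc[OF Suc.prems] D_def)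
  \<comment> \<open>The extra term of the local rule is the summand \<open>i = r\<close> of Pieri's
    rule.\<close>
  also have "(\<Sum>a\<in>L. if hstrip a p then kostka a r d else 0) =
    (\<Sum>i | i = r \<and> 0 < d i. kostka p (Suc r) (d(i := d i - 1)))"
  proof (cases "0 < d r")
    case True
    have "kostka p (Suc r) (d(r := d r - 1)) = (\<Sum>\<nu> | hstrip \<nu> p \<and> psize \<nu> + (d r - 1) = psize p. kostka \<nu> r d)"
      unfolding kostka_Suc[OF Suc.prems] by (intro sum.cong kostka_cong) auto
    also have "{\<nu>. hstrip \<nu> p \<and> psize \<nu> + (d r - 1) = psize p} = {a \<in> L. hstrip a p}"
      using hstrip_is_part_lower[OF _ Suc.prems] True unfolding L_def by auto
    also have "(\<Sum>\<nu>\<in>{a \<in> L. hstrip a p}. kostka \<nu> r d) = (\<Sum>a\<in>L. if hstrip a p then kostka a r d else 0)"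
      using finL by (simp add: sum.inter_filter)
    finally have "kostka p (Suc r) (d(r := d r - 1)) = (\<Sum>a\<in>L. if hstrip a p then kostka a r d else 0)" .
    moreover have "{i. i = r \<and> 0 < d i} = {r}" using True by auto
    ultimately show ?thesis by (simp del: fun_upd_apply)
  next
    case False
    have "\<not> hstrip a p" if "a \<in> L" for a
      using that False psize_mono[of a p] Suc.prems unfolding L_def hstrip_def by fastforce
    moreover have "{i. i = r \<and> 0 < d i} = {}" using False by auto
    ultimately show ?thesis by simp
  qed
  also have "(\<Sum>i | i < r \<and> 0 < d i. kostka p (Suc r) (d(i := d i - 1))) +
      (\<Sum>i | i = r \<and> 0 < d i. kostka p (Suc r) (d(i := d i - 1))) =
    (\<Sum>i | i < Suc r \<and> 0 < d i. kostka p (Suc r) (d(i := d i - 1)))"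
    by (subst sum.union_disjoint[symmetric]) (auto intro!: sum.cong simp: less_Suc_eq)
  finally show ?case .
qed

section \<open>Words of given content and their count by pairs of tableaux\<close>

definition words :: "nat \<Rightarrow> (nat \<Rightarrow> nat) \<Rightarrow> nat \<Rightarrow> (nat \<Rightarrow> nat) set" where
  "words r d k = {w \<in> {..<k} \<rightarrow>\<^sub>E {..<r}. \<forall>i<r. card {a \<in> {..<k}. w a = i} = d i}"

lemma finite_words: "finite (words r d k)"
  unfolding words_def by (rule finite_subset[of _ "{..<k} \<rightarrow>\<^sub>E {..<r}"]) (auto intro: finite_PiE)

lemma card_words_Suc:
  "card (words r d (Suc k)) = (\<Sum>i | i < r \<and> 0 < d i. card (words r (d(i := d i - 1)) k))"
proof -
  have cnt: "card {a \<in> {..<Suc k}. w a = i} = card {a \<in> {..<k}. w a = i} + (if w k = i then 1 else 0)"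
    for w :: "nat \<Rightarrow> nat" and i
  proof -
    have "{a \<in> {..<Suc k}. w a = i} = {a \<in> {..<k}. w a = i} \<union> (if w k = i then {k} else {})"
      by (auto simp: less_Suc_eq)
    thus ?thesis by auto
  qed
  let ?I = "{i. i < r \<and> 0 < d i}"
  have fib: "card {w \<in> words r d (Suc k). w k = i} = card (words r (d(i := d i - 1)) k)" if i: "i \<in> ?I" for i
  proof (rule bij_betw_same_card[of "\<lambda>w. restrict w {..<k}"], rule bij_betw_byWitness[where f' = "\<lambda>w. w(k := i)"])
    show "\<forall>w\<in>{w \<in> words r d (Suc k). w k = i}. (restrict w {..<k})(k := i) = w"
      by (auto simp: words_def PiE_iff extensional_def fun_eq_iff less_Suc_eq)
    show "\<forall>w\<in>words r (d(i := d i - 1)) k. restrict (w(k := i)) {..<k} = w"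
      by (auto simp: words_def PiE_iff extensional_def fun_eq_iff)
    show "(\<lambda>w. restrict w {..<k}) ` {w \<in> words r d (Suc k). w k = i} \<subseteq> words r (d(i := d i - 1)) k"
    proof (rule image_subsetI)
      fix w assume w: "w \<in> {w \<in> words r d (Suc k). w k = i}"
      have "card {a \<in> {..<k}. restrict w {..<k} a = j} = (d(i := d i - 1)) j" if "j < r" for j
      proof -
        have "{a \<in> {..<k}. restrict w {..<k} a = j} = {a \<in> {..<k}. w a = j}" by auto
        moreover have "card {a \<in> {..<Suc k}. w a = j} = d j" using w that unfolding words_def by blast
        moreover have "w k = i" using w by blast
        ultimately have "card {a \<in> {..<k}. restrict w {..<k} a = j} + (if i = j then 1 else 0) = d j"
          using cnt[of w j] by (simp only:)
        thus ?thesis by (cases "i = j") simp_all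
      qed
      thus "restrict w {..<k} \<in> words r (d(i := d i - 1)) k" using w by (auto simp: words_def PiE_iff)
    qed
    show "(\<lambda>w. w(k := i)) ` words r (d(i := d i - 1)) k \<subseteq> {w \<in> words r d (Suc k). w k = i}"
    proof (rule image_subsetI)
      fix w assume w: "w \<in> words r (d(i := d i - 1)) k"
      have "card {a \<in> {..<Suc k}. (w(k := i)) a = j} = d j" if "j < r" for j
      proof -
        have "{a \<in> {..<k}. (w(k := i)) a = j} = {a \<in> {..<k}. w a = j}" by auto
        moreover have "card {a \<in> {..<k}. w a = j} = (d(i := d i - 1)) j" using w that unfolding words_def by blast
        ultimately have "card {a \<in> {..<Suc k}. (w(k := i)) a = j} = (d(i := d i - 1)) j + (if i = j then 1 else 0)"
          using cnt[of "w(k := i)" j] by (simp only: fun_upd_same)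
        thus ?thesis using i by (cases "i = j") simp_all
      qed
      thus "w(k := i) \<in> {w \<in> words r d (Suc k). w k = i}"
        using w i by (auto simp: words_def PiE_iff extensional_def less_Suc_eq)
    qed
  qed
  have "(\<lambda>w. w k) ` words r d (Suc k) \<subseteq> ?I"
  proof (rule image_subsetI)
    fix w assume w: "w \<in> words r d (Suc k)"
    hence lt: "w k < r" unfolding words_def by (auto simp: PiE_iff)
    hence "card {a \<in> {..<Suc k}. w a = w k} = d (w k)" using w unfolding words_def by blast
    thus "w k \<in> ?I" using lt cnt[of w "w k"] by simp
  qed
  hence "card (words r d (Suc k)) = (\<Sum>i\<in>?I. \<Sum>w\<in>{w \<in> words r d (Suc k). w k = i}. 1)"
    using sum.group[OF finite_words[of r d "Suc k"], of ?I "\<lambda>w. w k" "\<lambda>_. 1 :: nat"] by simp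
  also have "\<dots> = (\<Sum>i\<in>?I. card (words r (d(i := d i - 1)) k))"
    by (intro sum.cong refl) (use fib in simp)
  finally show ?thesis .
qed

text \<open>The enumerative form of the Robinson--Schensted--Knuth correspondence; the factor with
  content \<open>\<lambda>_. 1\<close> counts standard tableaux. Removing the largest entry of the
  standard tableau, combined with Pieri's rule, gives the same recursion as removing the last letter
  of a word.\<close>

theorem sum_kostka_standard:
  "(\<Sum>\<mu>\<in>shapes k. kostka \<mu> r d * kostka \<mu> k (\<lambda>_. 1)) = card (words r d k)"
proof (induction k arbitrary: d)
  case 0
  have "shapes 0 = {\<lambda>_. 0}"
  proof (intro equalityI subsetI)
    fix f assume "f \<in> shapes 0"
    hence "is_part f" "f 0 = 0" using is_part_psize_zero[of f] unfolding shapes_def by auto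
    thus "f \<in> {\<lambda>_. 0}" using is_part_zero[of f 0] by auto
  qed (auto simp: shapes_def is_part_def psize_def antimono_def)
  moreover have "fcells (\<lambda>_. 0) = {}" by (auto simp: fcells_def)
  moreover have "card {T :: nat \<times> nat \<Rightarrow> nat. T = (\<lambda>x. undefined) \<and> P} = (if P then 1 else 0)" for P by auto
  moreover have "card {T :: nat \<Rightarrow> nat. T = (\<lambda>x. undefined) \<and> P} = (if P then 1 else 0)" for P by auto
  ultimately show ?case by (simp add: kostka_def ssyt_def words_def sstd_def)
next
  case (Suc k)
  let ?up = "\<lambda>\<nu>. {\<kappa>. hstrip \<nu> \<kappa> \<and> psize \<kappa> = psize \<nu> + 1}"
  have "(\<Sum>\<mu>\<in>shapes (Suc k). kostka \<mu> r d * kostka \<mu> (Suc k) (\<lambda>_. 1)) =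
    (\<Sum>\<mu>\<in>shapes (Suc k). \<Sum>\<nu> | \<nu> \<in> shapes k \<and> hstrip \<nu> \<mu>. kostka \<mu> r d * kostka \<nu> k (\<lambda>_. 1))"
  proof (intro sum.cong refl)
    fix \<mu> assume m: "\<mu> \<in> shapes (Suc k)"
    hence p: "is_part \<mu>" unfolding shapes_def by blast
    have "{\<nu>. hstrip \<nu> \<mu> \<and> psize \<nu> + 1 = psize \<mu>} = {\<nu>. \<nu> \<in> shapes k \<and> hstrip \<nu> \<mu>}"
      using m hstrip_is_part_lower[OF _ p] unfolding shapes_def by auto
    thus "kostka \<mu> r d * kostka \<mu> (Suc k) (\<lambda>_. 1) =
      (\<Sum>\<nu> | \<nu> \<in> shapes k \<and> hstrip \<nu> \<mu>. kostka \<mu> r d * kostka \<nu> k (\<lambda>_. 1))"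
      using kostka_Suc[OF p, of k "\<lambda>_. 1"] by (simp add: sum_distrib_left)
  qed
  also have "\<dots> = (\<Sum>\<nu>\<in>shapes k. \<Sum>\<mu> | \<mu> \<in> shapes (Suc k) \<and> hstrip \<nu> \<mu>. kostka \<mu> r d * kostka \<nu> k (\<lambda>_. 1))"
    by (rule sum.swap_restrict) auto
  also have "\<dots> = (\<Sum>\<nu>\<in>shapes k. \<Sum>i | i < r \<and> 0 < d i. kostka \<nu> r (d(i := d i - 1)) * kostka \<nu> k (\<lambda>_. 1))"
  proof (intro sum.cong refl)
    fix \<nu> assume n: "\<nu> \<in> shapes k"
    hence p: "is_part \<nu>" unfolding shapes_def by blast
    have "{\<mu>. \<mu> \<in> shapes (Suc k) \<and> hstrip \<nu> \<mu>} = ?up \<nu>"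
      using n hstrip_is_part_upper[OF _ p] unfolding shapes_def by auto
    thus "(\<Sum>\<mu> | \<mu> \<in> shapes (Suc k) \<and> hstrip \<nu> \<mu>. kostka \<mu> r d * kostka \<nu> k (\<lambda>_. 1)) =
      (\<Sum>i | i < r \<and> 0 < d i. kostka \<nu> r (d(i := d i - 1)) * kostka \<nu> k (\<lambda>_. 1))"
      using kostka_add_box[OF p, of r d] by (simp add: sum_distrib_right[symmetric])
  qed
  also have "\<dots> = (\<Sum>i | i < r \<and> 0 < d i. \<Sum>\<nu>\<in>shapes k. kostka \<nu> r (d(i := d i - 1)) * kostka \<nu> k (\<lambda>_. 1))"
    by (rule sum.swap)
  also have "\<dots> = card (words r d (Suc k))" unfolding card_words_Suc Suc.IH ..
  finally show ?case .
qed

section \<open>The group algebra\<close>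

text \<open>The product of finitely supported functions needs an addition on the type of indices, so
  the group has to be a type. All bijections of the naturals are taken at once, and the symmetric
  group on \<open>k\<close> points becomes the subset \<open>symb k\<close>.\<close>

typedef bijection = "{f :: nat \<Rightarrow> nat. bij f}" morphisms app Bij
  by (rule exI[of _ id]) simp

lemma bij_app [simp]: "bij (app g)"
  using app by blast

setup_lifting type_definition_bijection

text \<open>Written additively, so that the convolution product of \<open>bijection \<Rightarrow>\<^sub>0 complex\<close> is that of the group algebra.\<close>

instantiation bijection :: group_add
begin

lift_definition zero_bijection :: bijection is id by simp
lift_definition plus_bijection :: "bijection \<Rightarrow> bijection \<Rightarrow> bijection" is "(\<circ>)" by (rule bij_comp)
lift_definition uminus_bijection :: "bijection \<Rightarrow> bijection" is inv by (rule bij_imp_bij_inv)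
definition minus_bijection :: "bijection \<Rightarrow> bijection \<Rightarrow> bijection" where
  "minus_bijection g h = g + - h"

instance
proof
  fix a b c :: bijection
  show "a + b + c = a + (b + c)" by transfer (simp add: o_assoc)
  show "0 + a = a" "a + 0 = a" by (transfer, simp)+
  show "- a + a = 0" by transfer (simp add: bij_is_inj inv_o_cancel)
  show "a + - b = a - b" by (simp add: minus_bijection_def)
qed

end

lemma app_simps [simp]:
  "app 0 = id" "app (g + h) = app g \<circ> app h" "app (- g) = inv (app g)"
  by (transfer, simp)+

lemma app_eqI: "(\<And>a. app g a = app h a) \<Longrightarrow> g = h"
  by (metis app_inject ext)

lemma inv_app [simp]: "inv (app g) (app g a) = a" "app g (inv (app g) a) = a"
  by (auto simp: bij_is_inj bij_is_surj surj_f_inv_f)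

type_synonym galg = "bijection \<Rightarrow>\<^sub>0 complex"

abbreviation el :: "bijection \<Rightarrow> galg" where
  "el g \<equiv> Poly_Mapping.single g 1"

definition symb :: "nat \<Rightarrow> bijection set" where
  "symb k = {g. app g permutes {..<k}}"

definition galgs :: "nat \<Rightarrow> galg set" where
  "galgs k = {a. keys a \<subseteq> symb k}"

lemma symb_closed [simp]:
  "0 \<in> symb k" "g \<in> symb k \<Longrightarrow> h \<in> symb k \<Longrightarrow> g + h \<in> symb k" "g \<in> symb k \<Longrightarrow> - g \<in> symb k"
  unfolding symb_def by (auto simp: permutes_id permutes_compose permutes_inv)

lemma symb_diff [simp]: "g \<in> symb k \<Longrightarrow> h \<in> symb k \<Longrightarrow> g - h \<in> symb k"
  by (metis diff_conv_add_uminus symb_closed(2,3))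

lemma finite_symb [simp]: "finite (symb k)"
proof (rule finite_imageD)
  show "finite (app ` symb k)"
    by (rule finite_subset[of _ "perms k"]) (auto simp: symb_def)
qed (auto intro!: inj_onI simp: app_inject)

lemma symb_lt [simp]: "g \<in> symb k \<Longrightarrow> app g a < k \<longleftrightarrow> a < k"
  unfolding symb_def using permutes_in_image[of "app g" "{..<k}" a] by simp

lemma symb_inv_lt [simp]: "g \<in> symb k \<Longrightarrow> inv (app g) a < k \<longleftrightarrow> a < k"
  using symb_lt[of "- g" k a] by simp

lemma symb_fix: "g \<in> symb k \<Longrightarrow> \<not> a < k \<Longrightarrow> app g a = a"
  unfolding symb_def permutes_def by simp

lemma symb_eqI: "g \<in> symb k \<Longrightarrow> h \<in> symb k \<Longrightarrow> (\<And>a. a < k \<Longrightarrow> app g a = app h a) \<Longrightarrow> g = h"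
  by (rule app_eqI) (metis symb_fix)

lemma symb_bij_betw: "g \<in> symb k \<Longrightarrow> bij_betw (app g) {..<k} {..<k}"
  unfolding symb_def by (simp add: permutes_imp_bij)

lemma sum_symb: "g \<in> symb k \<Longrightarrow> (\<Sum>a<k. f (app g a)) = (\<Sum>a<k. f a)"
  by (rule sum.reindex_bij_betw[OF symb_bij_betw])

lemma perms_eq_app: "\<pi> \<in> perms k \<Longrightarrow> \<exists>g\<in>symb k. \<pi> = app g"
  by (rule bexI[of _ "Bij \<pi>"]) (auto simp: symb_def Bij_inverse permutes_bij)

lemma galg_expand: "a = (\<Sum>g\<in>keys a. cscale (lookup a g) (el g))"
  using poly_mapping_sum_single[of "keys a" a] by (simp add: cscale_single)

lemma clinear_eq_on:
  assumes "clinear F" "clinear F'" "keys a \<subseteq> H" "\<And>g. g \<in> H \<Longrightarrow> F (el g) = F' (el g)"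
  shows "F a = F' a"
proof -
  have "F (\<Sum>g\<in>keys a. cscale (lookup a g) (el g)) = F' (\<Sum>g\<in>keys a. cscale (lookup a g) (el g))"
    unfolding clinear_sum_scale[OF assms(1)] clinear_sum_scale[OF assms(2)]
    using assms(3,4) by (intro sum.cong refl) auto
  thus ?thesis using galg_expand[of a] by simp
qed

lemma cscale_conv_mult: "cscale c a = Poly_Mapping.single 0 c * (a :: galg)"
  unfolding cscale_def by (rule mult_map_scale_conv_mult)

lemma cscale_mult_left: "cscale c a * b = cscale c (a * b :: galg)"
  by (simp add: cscale_conv_mult mult.assoc)

lemma mult_linear_right: "clinear (\<lambda>x. x * b :: galg)"
  by (rule clinearI) (simp_all add: distrib_right cscale_mult_left)

lemma galg_mult_expand: "a * b = (\<Sum>g\<in>keys a. cscale (lookup a g) (el g * b))" for a b :: galg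
proof -
  have "a * b = (\<Sum>g\<in>keys a. cscale (lookup a g) (el g)) * b" using galg_expand[of a] by simp
  thus ?thesis by (simp add: sum_distrib_right cscale_mult_left)
qed

lemma single_central: "a * Poly_Mapping.single 0 c = Poly_Mapping.single 0 (c::complex) * a" for a :: galg
proof -
  have "a * Poly_Mapping.single 0 c = (\<Sum>g\<in>keys a. cscale (lookup a g) (el g * Poly_Mapping.single 0 c))"
    by (rule galg_mult_expand)
  also have "\<dots> = (\<Sum>g\<in>keys a. cscale c (cscale (lookup a g) (el g)))"
    by (intro sum.cong refl) (simp add: mult_single cscale_single mult.commute)
  also have "\<dots> = cscale c a"
    using galg_expand[of a] by (simp add: cvec.scale_sum_right[symmetric] del: cvec.scale_scale)
  finally show ?thesis by (simp add: cscale_conv_mult)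
qed

lemma cscale_mult_right: "a * cscale c b = cscale c (a * b :: galg)"
  by (simp add: cscale_conv_mult mult.assoc[symmetric] single_central)

lemma mult_linear_left: "clinear (\<lambda>x. b * x :: galg)"
  by (rule clinearI) (simp_all add: distrib_left cscale_mult_right)

lemma galg_mult_expand': "b * a = (\<Sum>g\<in>keys a. cscale (lookup a g) (b * el g))" for a b :: galg
proof -
  have "b * a = b * (\<Sum>g\<in>keys a. cscale (lookup a g) (el g))" using galg_expand[of a] by simp
  thus ?thesis by (simp add: sum_distrib_left cscale_mult_right)
qed

lemma el_mult: "el g * el h = el (g + h)"
  by (simp add: mult_single)

lemma galgs_subspace: "cvec.subspace (galgs k)"
  unfolding galgs_def by (rule subspace_supported)

lemma galgs_mult [simp]:
  assumes "a \<in> galgs k" "b \<in> galgs k"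
  shows "a * b \<in> galgs k"
  unfolding galgs_def
proof (intro CollectI subsetI)
  fix g assume "g \<in> keys (a * b)"
  then obtain x y where "g = x + y" "x \<in> keys a" "y \<in> keys b" using keys_mult[of a b] by blast
  thus "g \<in> symb k" using assms unfolding galgs_def by (auto intro: symb_closed)
qed

lemma galgs_el [simp]: "g \<in> symb k \<Longrightarrow> el g \<in> galgs k"
  unfolding galgs_def by simp

lemma galgs_1 [simp]: "1 \<in> galgs k"
  unfolding galgs_def by simp

lemma galgs_linear_eq:
  assumes "clinear F" "clinear F'" "a \<in> galgs k" "\<And>g. g \<in> symb k \<Longrightarrow> F (el g) = F' (el g)"
  shows "F a = F' a"
  using clinear_eq_on[OF assms(1,2) _ assms(4)] assms(3) unfolding galgs_def by blast

lemma clinear_zero: "clinear (\<lambda>_. 0)"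
  by (rule clinearI) auto

lemma clinear_compose: "clinear f \<Longrightarrow> clinear g \<Longrightarrow> clinear (\<lambda>x. f (g x))"
  by (rule clinearI) (simp_all add: cpair.linear_add cpair.linear_scale)

section \<open>Coefficients of products, the trace and the antipode\<close>

lemma lookup_el_mult: "lookup (el g * b) h = lookup b (- g + h)"
proof -
  have "lookup (el g * b) h = (\<Sum>x\<in>keys b. if x = - g + h then lookup b (- g + h) else 0)"
    unfolding galg_mult_expand'[of _ b] lookup_sum el_mult
    by (intro sum.cong refl) (auto simp: lookup_single when_def add.assoc[symmetric])
  thus ?thesis by (auto simp: in_keys_iff)
qed

lemma lookup_mult_el: "lookup (b * el g) h = lookup b (h - g)" for b :: galg
proof -
  have "lookup (b * el g) h = (\<Sum>x\<in>keys b. if x = h - g then lookup b (h - g) else 0)"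
    unfolding galg_mult_expand[of b] lookup_sum el_mult
    by (intro sum.cong refl) (auto simp: lookup_single when_def)
  thus ?thesis by (auto simp: in_keys_iff)
qed

lemma lookup_galg_mult: "lookup (a * b) h = (\<Sum>g\<in>keys a. lookup a g * lookup b (- g + h))" for a b :: galg
  unfolding galg_mult_expand[of a] by (simp add: lookup_sum lookup_el_mult)

lemma lookup_galg_mult': "lookup (b * a) h = (\<Sum>g\<in>keys a. lookup a g * lookup b (h - g))" for a b :: galg
  unfolding galg_mult_expand'[of b a] by (simp add: lookup_sum lookup_mult_el)

text \<open>On the group algebra of a finite group, the coefficient at the identity is the trace of
  the regular representation up to a factor.\<close>

lemma trace_commute: "lookup (a * b) 0 = lookup (b * a) (0 :: bijection)" for a b :: galg
  using lookup_galg_mult[of a b 0] lookup_galg_mult'[of b a 0] by simp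

text \<open>Inversion of group elements, extended linearly. It is an anti-automorphism that fixes
  symmetrizers and antisymmetrizers, so it turns statements about right multiplication into their
  mirror images.\<close>

definition antipode :: "galg \<Rightarrow> galg" where
  "antipode = pushforward uminus"

lemma lookup_antipode [simp]: "lookup (antipode a) g = lookup a (- g)"
  unfolding antipode_def by (rule lookup_pushforward) auto

lemma antipode_linear: "clinear antipode"
  by (rule clinearI) (auto intro!: poly_mapping_eqI simp: lookup_add)

lemma antipode_el: "antipode (el g) = el (- g)"
  unfolding antipode_def by (rule pushforward_single)

lemma antipode_mult: "antipode (a * b) = antipode b * antipode a"
proof (rule clinear_eq_on[of "\<lambda>a. antipode (a * b)" "\<lambda>a. antipode b * antipode a" a UNIV])
  fix g
  show "antipode (el g * b) = antipode b * antipode (el g)"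
    by (rule poly_mapping_eqI) (simp add: antipode_el lookup_el_mult lookup_mult_el minus_add)
qed (auto intro: clinear_compose[OF antipode_linear mult_linear_right]
       clinear_compose[OF mult_linear_left antipode_linear])

context perm_rep
begin

definition mact :: "galg \<Rightarrow> ('k \<Rightarrow>\<^sub>0 complex) \<Rightarrow> ('k \<Rightarrow>\<^sub>0 complex)" where
  "mact a v = (\<Sum>g\<in>keys a. cscale (lookup a g) (act (app g) v))"

lemma mact_superset: "finite A \<Longrightarrow> keys a \<subseteq> A \<Longrightarrow> mact a v = (\<Sum>g\<in>A. cscale (lookup a g) (act (app g) v))"
  unfolding mact_def by (rule sum.mono_neutral_left) (auto simp: in_keys_iff)

lemma mact_linear_left: "clinear (\<lambda>a. mact a v)"
proof (rule clinearI)
  show "mact (a + b) v = mact a v + mact b v" for a b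
  proof -
    let ?A = "keys a \<union> keys b"
    have k: "keys (a + b) \<subseteq> ?A" by (rule Poly_Mapping.keys_add)
    show ?thesis
      using mact_superset[OF _ k] mact_superset[of ?A a] mact_superset[of ?A b]
      by (simp add: lookup_add cvec.scale_left_distrib sum.distrib)
  qed
  show "mact (cscale c a) v = cscale c (mact a v)" for c a
    using mact_superset[of "keys a" "cscale c a"]
    by (simp add: mact_def cvec.scale_sum_right in_keys_iff subset_iff)
qed

lemma mact_linear: "clinear (mact a)"
proof (rule clinearI)
  show "mact a (u + v) = mact a u + mact a v" for u v
    unfolding mact_def by (simp add: act_add cvec.scale_right_distrib sum.distrib)
  show "mact a (cscale c u) = cscale c (mact a u)" for c u
    unfolding mact_def cvec.scale_sum_right by (intro sum.cong refl) (simp add: act_scale mult.commute)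
qed

lemmas mact_scale_left = cpair.linear_scale[OF mact_linear_left]
  and mact_sum_left = cpair.linear_sum[OF mact_linear_left]
  and mact_diff_left = cpair.linear_diff[OF mact_linear_left]
  and mact_0_left = cpair.linear_0[OF mact_linear_left]
  and mact_scale = cpair.linear_scale[OF mact_linear]
  and mact_sum = cpair.linear_sum[OF mact_linear]
  and mact_0 = cpair.linear_0[OF mact_linear]

lemma mact_el: "mact (el g) v = act (app g) v"
  unfolding mact_def by simp

lemma mact_1: "mact 1 v = v"
  using mact_el[of 0 v] by (simp add: act_id)

lemma mact_mult: "mact (a * b) v = mact a (mact b v)"
proof (rule clinear_eq_on[of "\<lambda>a. mact (a * b) v" "\<lambda>a. mact a (mact b v)" a UNIV])
  fix g
  show "mact (el g * b) v = mact (el g) (mact b v)"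
  proof (rule clinear_eq_on[of "\<lambda>b. mact (el g * b) v" "\<lambda>b. mact (el g) (mact b v)" b UNIV])
    show "mact (el g * el h) v = mact (el g) (mact (el h) v)" for h
      by (simp add: el_mult mact_el act_comp)
  qed (auto intro: clinear_compose[OF mact_linear_left mult_linear_left]
         clinear_compose[OF mact_linear mact_linear_left])
qed (auto intro: clinear_compose[OF mact_linear_left mult_linear_right] mact_linear_left)

lemma mact_closed:
  assumes "cvec.subspace N" "\<And>\<pi> v. \<pi> \<in> perms k \<Longrightarrow> v \<in> N \<Longrightarrow> act \<pi> v \<in> N" "a \<in> galgs k" "v \<in> N"
  shows "mact a v \<in> N"
  unfolding mact_def
  using assms(2,3,4) by (intro cvec.subspace_sum cvec.subspace_scale assms(1)) (auto simp: galgs_def symb_def)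

end

subsection \<open>Symmetrizers\<close>

text \<open>A Young subgroup. For \<open>trow \<mu>\<close>, \<open>tcol \<mu>\<close> or a word in
  place of \<open>q\<close> it is the row group, the column group or the stabilizer of the
  word.\<close>

definition stab :: "nat \<Rightarrow> (nat \<Rightarrow> 'a) \<Rightarrow> bijection set" where
  "stab k q = {g \<in> symb k. \<forall>a<k. q (app g a) = q a}"

definition sgnb :: "bijection \<Rightarrow> complex" where
  "sgnb g = of_int (sign (app g))"

definition symz :: "nat \<Rightarrow> (nat \<Rightarrow> 'a) \<Rightarrow> galg" where
  "symz k q = (\<Sum>g\<in>stab k q. el g)"

definition altz :: "nat \<Rightarrow> (nat \<Rightarrow> 'a) \<Rightarrow> galg" where
  "altz k q = (\<Sum>g\<in>stab k q. cscale (sgnb g) (el g))"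

lemma stab_symb: "g \<in> stab k q \<Longrightarrow> g \<in> symb k"
  unfolding stab_def by blast

lemma finite_stab [simp]: "finite (stab k q)"
  by (rule finite_subset[OF _ finite_symb[of k]]) (auto simp: stab_def)

lemma stab_closed [simp]:
  "0 \<in> stab k q" "g \<in> stab k q \<Longrightarrow> h \<in> stab k q \<Longrightarrow> g + h \<in> stab k q" "g \<in> stab k q \<Longrightarrow> - g \<in> stab k q"
proof -
  show "- g \<in> stab k q" if g: "g \<in> stab k q"
  proof -
    have gs: "g \<in> symb k" using stab_symb[OF g] .
    have "q (inv (app g) a) = q a" if "a < k" for a
    proof -
      have "inv (app g) a < k" using that gs by simp
      hence "q (app g (inv (app g) a)) = q (inv (app g) a)" using g unfolding stab_def by blast
      thus ?thesis by simp
    qed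
    thus ?thesis using gs unfolding stab_def by simp
  qed
qed (auto simp: stab_def)

lemma stab_diff [simp]: "g \<in> stab k q \<Longrightarrow> h \<in> stab k q \<Longrightarrow> g - h \<in> stab k q"
  by (metis diff_conv_add_uminus stab_closed(2,3))

lemma card_stab_pos: "card (stab k q) > 0"
  using stab_closed(1)[of k q] card_gt_0_iff finite_stab by blast

lemma symb_permutation: "g \<in> symb k \<Longrightarrow> permutation (app g)"
  unfolding symb_def permutation_permutes using finite_lessThan by blast

lemma sgnb_add: "g \<in> symb k \<Longrightarrow> h \<in> symb k \<Longrightarrow> sgnb (g + h) = sgnb g * sgnb h"
  unfolding sgnb_def by (simp add: sign_compose symb_permutation)

lemma sgnb_minus: "g \<in> symb k \<Longrightarrow> sgnb (- g) = sgnb g"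
  unfolding sgnb_def by (simp add: sign_inverse symb_permutation)

lemma sgnb_sq: "g \<in> symb k \<Longrightarrow> sgnb g * sgnb g = 1"
  using sgnb_add[of "- g" k g] sgnb_minus[of g k] by (simp add: sgnb_def sign_id)

lemma symz_galgs [simp]: "symz k q \<in> galgs k"
  unfolding symz_def by (intro cvec.subspace_sum galgs_subspace galgs_el stab_symb)

lemma altz_galgs [simp]: "altz k q \<in> galgs k"
  unfolding altz_def by (intro cvec.subspace_sum cvec.subspace_scale galgs_subspace galgs_el stab_symb)

lemma sum_stab_left: "r \<in> stab k q \<Longrightarrow> (\<Sum>g\<in>stab k q. f (r + g)) = (\<Sum>g\<in>stab k q. f g)"
  by (rule sum.reindex_bij_witness[of _ "\<lambda>g. - r + g" "\<lambda>g. r + g"]) (auto simp: add.assoc[symmetric])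

lemma sum_stab_right: "r \<in> stab k q \<Longrightarrow> (\<Sum>g\<in>stab k q. f (g + r)) = (\<Sum>g\<in>stab k q. f g)"
  by (rule sum.reindex_bij_witness[of _ "\<lambda>g. g + - r" "\<lambda>g. g + r"]) (auto simp: add.assoc)

lemma sum_stab_minus: "(\<Sum>g\<in>stab k q. f (- g)) = (\<Sum>g\<in>stab k q. f g)"
  by (rule sum.reindex_bij_witness[of _ uminus uminus]) auto

lemma el_symz: "r \<in> stab k q \<Longrightarrow> el r * symz k q = symz k q"
  using sum_stab_left[of r k q el] by (simp add: symz_def sum_distrib_left el_mult)

lemma symz_el: "r \<in> stab k q \<Longrightarrow> symz k q * el r = symz k q"
  using sum_stab_right[of r k q el] by (simp add: symz_def sum_distrib_right el_mult)

lemma el_altz: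
  assumes r: "r \<in> stab k q"
  shows "el r * altz k q = cscale (sgnb r) (altz k q)"
proof -
  have "el r * altz k q = (\<Sum>g\<in>stab k q. cscale (sgnb r) (cscale (sgnb (r + g)) (el (r + g))))"
    unfolding altz_def sum_distrib_left
  proof (intro sum.cong refl)
    fix g assume g: "g \<in> stab k q"
    have "sgnb g = sgnb r * sgnb (r + g)"
      using sgnb_add[OF stab_symb[OF r] stab_symb[OF g]] sgnb_sq[OF stab_symb[OF r]]
      by (simp add: mult.assoc[symmetric])
    thus "el r * cscale (sgnb g) (el g) = cscale (sgnb r) (cscale (sgnb (r + g)) (el (r + g)))"
      by (simp add: cscale_mult_right el_mult)
  qed
  also have "\<dots> = cscale (sgnb r) (altz k q)"
    unfolding altz_def cvec.scale_sum_right
    by (rule sum_stab_left[OF r, of "\<lambda>g. cscale (sgnb r) (cscale (sgnb g) (el g))"])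
  finally show ?thesis .
qed

lemma antipode_symz: "antipode (symz k q) = symz k q"
  unfolding symz_def cpair.linear_sum[OF antipode_linear] antipode_el by (rule sum_stab_minus)

lemma antipode_altz: "antipode (altz k q) = altz k q"
proof -
  have "antipode (altz k q) = (\<Sum>g\<in>stab k q. cscale (sgnb (- g)) (el (- g)))"
    unfolding altz_def clinear_sum_scale[OF antipode_linear] antipode_el
    by (intro sum.cong refl) (simp add: sgnb_minus[OF stab_symb])
  also have "\<dots> = altz k q"
    unfolding altz_def by (rule sum_stab_minus[of "\<lambda>g. cscale (sgnb g) (el g)"])
  finally show ?thesis .
qed

lemma altz_el: "r \<in> stab k q \<Longrightarrow> altz k q * el r = cscale (sgnb r) (altz k q)"
  using arg_cong[OF el_altz[of "- r" k q], of antipode]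
  by (simp add: antipode_mult antipode_altz antipode_el cpair.linear_scale[OF antipode_linear] sgnb_minus[OF stab_symb])

lemma altz_altz: "altz k q * altz k q = cscale (of_nat (card (stab k q))) (altz k q)"
proof -
  have "altz k q * altz k q = (\<Sum>g\<in>stab k q. cscale (sgnb g) (el g * altz k q))"
    by (subst altz_def) (simp add: sum_distrib_right cscale_mult_left)
  also have "\<dots> = (\<Sum>g\<in>stab k q. altz k q)"
    by (intro sum.cong refl) (simp add: el_altz sgnb_sq[OF stab_symb])
  finally show ?thesis by (simp only: cvec.sum_constant_scale)
qed

lemma lookup_symz: "lookup (symz k q) g = (if g \<in> stab k q then 1 else 0)"
  unfolding symz_def lookup_sum by (simp add: lookup_single when_def)

lemma lookup_altz: "lookup (altz k q) g = (if g \<in> stab k q then sgnb g else 0)"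
proof -
  have "lookup (altz k q) g = (\<Sum>h\<in>stab k q. if h = g then sgnb g else 0)"
    unfolding altz_def lookup_sum by (intro sum.cong) (auto simp: lookup_single when_def)
  thus ?thesis by simp
qed

section \<open>Transpositions, sign cancellation and rearrangements\<close>

definition transp :: "nat \<Rightarrow> nat \<Rightarrow> bijection" where
  "transp a b = Bij (transpose a b)"

lemma app_transp [simp]: "app (transp a b) = transpose a b"
  unfolding transp_def by (rule Bij_inverse) simp

lemma transp_stab: "a < k \<Longrightarrow> b < k \<Longrightarrow> q a = q b \<Longrightarrow> transp a b \<in> stab k q"
  unfolding stab_def symb_def by (auto simp: permutes_swap_id transpose_def)

lemma sgnb_transp: "a \<noteq> b \<Longrightarrow> sgnb (transp a b) = - 1"
  unfolding sgnb_def by (simp add: sign_swap_id)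

lemma add_transp: "g + transp a b = transp (app g a) (app g b) + g"
proof (rule app_eqI)
  fix x
  have "inj (app g)" by (simp add: bij_is_inj)
  thus "app (g + transp a b) x = app (transp (app g a) (app g b) + g) x"
    by (auto simp: transpose_def dest: injD)
qed

lemma eq_neg_imp_zero: "x = cscale (- 1) x \<Longrightarrow> x = 0"
proof (rule poly_mapping_eqI)
  fix k assume "x = cscale (- 1) x"
  hence "lookup x k = - lookup x k" by (metis lookup_cscale mult_minus1)
  thus "lookup x k = lookup 0 k" by simp
qed

text \<open>The transposition of \<open>a\<close> and \<open>b\<close> is absorbed by one outer
  factor and, once moved across \<open>el g\<close>, becomes a transposition absorbed by the other.
  Exactly one of them contributes a sign, so the product is its own negative.\<close>

lemma altz_symz_zero:
  assumes g: "g \<in> symb k" and ab: "a < k" "b < k" "a \<noteq> b" "q a = q b" "p (app g a) = p (app g b)"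
  shows "altz k p * el g * symz k q = 0" "symz k p * el g * altz k q = 0"
proof -
  let ?t = "transp a b" and ?t' = "transp (app g a) (app g b)"
  have t: "?t \<in> stab k q" using ab transp_stab by blast
  have t': "?t' \<in> stab k p" using ab g by (intro transp_stab) auto
  have s: "sgnb ?t = -1" using ab sgnb_transp by blast
  have "app g a \<noteq> app g b" using ab(3) inv_app(1) by metis
  hence s': "sgnb ?t' = -1" using sgnb_transp by blast
  have c: "el g * el ?t = el ?t' * el g" by (simp add: el_mult add_transp)
  have "altz k p * el g * symz k q = altz k p * (el g * el ?t) * symz k q"
    by (simp add: mult.assoc el_symz[OF t])
  also have "\<dots> = cscale (- 1) (altz k p * el g * symz k q)"
    unfolding c by (simp add: mult.assoc[symmetric] altz_el[OF t'] s' cscale_mult_left)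
  finally show "altz k p * el g * symz k q = 0" by (rule eq_neg_imp_zero)
  have "symz k p * el g * altz k q = symz k p * el ?t' * el g * altz k q"
    by (simp add: symz_el[OF t'])
  also have "\<dots> = symz k p * el g * (el ?t * altz k q)"
    using c by (metis mult.assoc)
  also have "\<dots> = cscale (- 1) (symz k p * el g * altz k q)"
    unfolding el_altz[OF t] s by (simp add: cscale_mult_right)
  finally show "symz k p * el g * altz k q = 0" by (rule eq_neg_imp_zero)
qed

lemma same_card_differ:
  assumes "finite A" "finite B" "card A = card B" "A \<noteq> B"
  obtains x y where "x \<in> A" "x \<notin> B" "y \<in> B" "y \<notin> A"
proof -
  have "\<not> A \<subseteq> B" "\<not> B \<subseteq> A"
    using card_subset_eq[OF assms(2), of A] card_subset_eq[OF assms(1), of B] assms(3,4) by auto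
  thus ?thesis using that by blast
qed

text \<open>An arrangement of maximal weight has no inversion within a fibre of \<open>q\<close>,
  since exchanging the two values would increase the sum, and two sorted arrangements of the same
  values coincide. This is the rearrangement inequality with its equality case.\<close>

lemma sum_rearrange:
  fixes q u w :: "nat \<Rightarrow> nat"
  assumes sorted: "\<And>a b. a < k \<Longrightarrow> b < k \<Longrightarrow> q a = q b \<Longrightarrow> u a < u b \<Longrightarrow> w a \<le> w b"
    and inj: "\<And>a b. a < k \<Longrightarrow> b < k \<Longrightarrow> q a = q b \<Longrightarrow> u a = u b \<Longrightarrow> a = b"
    and r: "r \<in> stab k q"
  shows "(\<Sum>a<k. u a * w (app r a)) \<le> (\<Sum>a<k. u a * w a)"
    and "(\<Sum>a<k. u a * w (app r a)) = (\<Sum>a<k. u a * w a) \<Longrightarrow> a < k \<Longrightarrow> w (app r a) = w a"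
proof -
  define \<psi> where "\<psi> = (\<lambda>r. \<Sum>a<k. u a * w (app r a))"
  have maximal: "w (app r a) = w a"
    if r: "r \<in> stab k q" and max: "\<And>r'. r' \<in> stab k q \<Longrightarrow> \<psi> r' \<le> \<psi> r" and a: "a < k" for r a
  proof -
    let ?v = "\<lambda>a. w (app r a)"
    have rs: "r \<in> symb k" using stab_symb[OF r] .
    have qr: "q (app r x) = q x" if "x < k" for x using r that unfolding stab_def by blast
    have vsorted: "?v a \<le> ?v b" if ab: "a < k" "b < k" "q a = q b" "u a < u b" for a b
    proof (rule ccontr)
      assume gt: "\<not> ?v a \<le> ?v b"
      let ?t = "transp a b"
      have t: "?t \<in> stab k q" using ab transp_stab by blast
      have ne: "a \<noteq> b" using ab(4) by auto
      have split: "(\<Sum>x<k. f x) = f a + f b + (\<Sum>x\<in>{..<k} - {a,b}. f x)" for f :: "nat \<Rightarrow> nat"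
        using ab(1,2) ne
        by (subst sum.subset_diff[of "{a,b}"]) auto
      have rest: "(\<Sum>x\<in>{..<k} - {a,b}. u x * w (app (r + ?t) x)) = (\<Sum>x\<in>{..<k} - {a,b}. u x * ?v x)"
        by (intro sum.cong refl) (auto simp: transpose_def)
      have 1: "\<psi> (r + ?t) = u a * ?v b + u b * ?v a + (\<Sum>x\<in>{..<k} - {a,b}. u x * ?v x)"
        unfolding \<psi>_def split[of "\<lambda>x. u x * w (app (r + ?t) x)"] rest by simp
      have 2: "\<psi> r = u a * ?v a + u b * ?v b + (\<Sum>x\<in>{..<k} - {a,b}. u x * ?v x)"
        unfolding \<psi>_def by (rule split)
      define p where "p = u b - u a"
      have p: "u b = u a + p" "p > 0" using ab(4) by (auto simp: p_def)
      have "p * ?v b < p * ?v a" using gt p(2) by simp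
      hence "u a * ?v a + u b * ?v b < u a * ?v b + u b * ?v a" unfolding p(1) by (simp add: algebra_simps)
      thus False using max[of "r + ?t"] r t 1 2 by simp
    qed
    \<comment> \<open>The two sublevel sets have the same size, and sortedness makes both initial
      segments with respect to \<open>u\<close>; a difference would produce a pair out of
      order.\<close>
    have "{x. x < k \<and> q x = q a \<and> ?v x < t} = {x. x < k \<and> q x = q a \<and> w x < t}" (is "?A = ?B") for t
    proof -
      have "bij_betw (app r) ?A ?B"
      proof (rule bij_betw_byWitness[where f' = "app (- r)"])
        show "app r ` ?A \<subseteq> ?B" using qr rs by auto
        show "app (- r) ` ?B \<subseteq> ?A"
        proof (rule image_subsetI)
          fix x assume x: "x \<in> ?B"
          hence "app (- r) x < k" using rs by simp
          thus "app (- r) x \<in> ?A" using qr[of "app (- r) x"] x by simp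
        qed
      qed simp_all
      hence card: "card ?A = card ?B" by (rule bij_betw_same_card)
      show ?thesis
      proof (rule ccontr)
        assume ne: "?A \<noteq> ?B"
        have fin: "finite ?A" "finite ?B" by auto
        obtain x y where x: "x \<in> ?A" "x \<notin> ?B" and y: "y \<in> ?B" "y \<notin> ?A"
          using same_card_differ[OF fin card ne] .
        have "u x \<noteq> u y" using inj[of x y] x y by auto
        thus False using x y sorted[of x y] vsorted[of y x] by (auto simp: neq_iff)
      qed
    qed
    hence "?v a < t \<longleftrightarrow> w a < t" for t using a by blast
    from this[of "Suc (w a)"] this[of "w a"] show ?thesis by simp
  qed
  \<comment> \<open>The maximum over the finite group is attained, and by \<open>maximal\<close> its
    value is the weight of \<open>w\<close> itself.\<close>
  have "\<psi> ` stab k q \<noteq> {}" "finite (\<psi> ` stab k q)" using stab_closed(1)[of k q] by (blast, simp)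
  from Max_in[OF this(2,1)] obtain r0 where r0: "r0 \<in> stab k q" "\<psi> r0 = Max (\<psi> ` stab k q)" by auto
  have max: "\<psi> r' \<le> \<psi> r0" if "r' \<in> stab k q" for r' unfolding r0(2) using that by simp
  have e: "\<psi> r0 = (\<Sum>a<k. u a * w a)"
    unfolding \<psi>_def using maximal[OF r0(1) max] by (intro sum.cong) auto
  show "(\<Sum>a<k. u a * w (app r a)) \<le> (\<Sum>a<k. u a * w a)" using max[OF r] unfolding e by (simp add: \<psi>_def)
  show "w (app r a) = w a" if "(\<Sum>a<k. u a * w (app r a)) = (\<Sum>a<k. u a * w a)" "a < k"
    using maximal[OF r, of a] max that e unfolding \<psi>_def by simp
qed

subsection \<open>A fixed tableau for each shape\<close>

text \<open>An arbitrary numbering of the cells by positions: the reference tableau of the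
  shape.\<close>

definition tcell :: "(nat \<Rightarrow> nat) \<Rightarrow> nat \<Rightarrow> nat \<times> nat" where
  "tcell \<mu> = (SOME f. bij_betw f {..<psize \<mu>} (fcells \<mu>))"

definition trow :: "(nat \<Rightarrow> nat) \<Rightarrow> nat \<Rightarrow> nat" where "trow \<mu> a = fst (tcell \<mu> a)"
definition tcol :: "(nat \<Rightarrow> nat) \<Rightarrow> nat \<Rightarrow> nat" where "tcol \<mu> a = snd (tcell \<mu> a)"

lemma shapesD: "\<mu> \<in> shapes k \<Longrightarrow> is_part \<mu>" "\<mu> \<in> shapes k \<Longrightarrow> psize \<mu> = k"
  unfolding shapes_def by auto

lemma tcell_bij:
  assumes "\<mu> \<in> shapes k"
  shows "bij_betw (tcell \<mu>) {..<k} (fcells \<mu>)"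
proof -
  have p: "is_part \<mu>" "psize \<mu> = k" using assms shapesD by auto
  have "\<exists>f. bij_betw f {..<psize \<mu>} (fcells \<mu>)"
    using finite_same_card_bij[of "{..<psize \<mu>}" "fcells \<mu>"] card_fcells p by auto
  thus ?thesis unfolding tcell_def p(2) by (rule someI_ex)
qed

lemma tcell_eq: "tcell \<mu> a = (trow \<mu> a, tcol \<mu> a)"
  unfolding trow_def tcol_def by simp

lemma tcol_less: "\<mu> \<in> shapes k \<Longrightarrow> a < k \<Longrightarrow> tcol \<mu> a < \<mu> (trow \<mu> a)"
  using bij_betwE[OF tcell_bij, of \<mu> k] by (auto simp: tcell_eq fcells_def)

lemma tcell_inj: "\<mu> \<in> shapes k \<Longrightarrow> a < k \<Longrightarrow> b < k \<Longrightarrow> trow \<mu> a = trow \<mu> b \<Longrightarrow> tcol \<mu> a = tcol \<mu> b \<Longrightarrow> a = b"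
  using inj_onD[OF bij_betw_imp_inj_on[OF tcell_bij], of \<mu> k a b] by (simp add: tcell_eq)

lemma tcell_surj:
  assumes "\<mu> \<in> shapes k" "j < \<mu> i"
  shows "\<exists>a<k. trow \<mu> a = i \<and> tcol \<mu> a = j"
proof -
  have "(i, j) \<in> tcell \<mu> ` {..<k}"
    using bij_betw_imp_surj_on[OF tcell_bij[OF assms(1)]] assms(2) by (simp add: fcells_def)
  thus ?thesis by (auto simp: tcell_eq)
qed

lemma card_trow_less:
  assumes "\<mu> \<in> shapes k"
  shows "card {a. a < k \<and> trow \<mu> a < m} = (\<Sum>i<m. \<mu> i)"
proof -
  have "bij_betw (tcell \<mu>) {a. a < k \<and> trow \<mu> a < m} (Sigma {..<m} (\<lambda>i. {..<\<mu> i}))"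
    unfolding bij_betw_def
  proof
    show "inj_on (tcell \<mu>) {a. a < k \<and> trow \<mu> a < m}"
      by (rule inj_on_subset[OF bij_betw_imp_inj_on[OF tcell_bij[OF assms]]]) auto
    show "tcell \<mu> ` {a. a < k \<and> trow \<mu> a < m} = (Sigma {..<m} (\<lambda>i. {..<\<mu> i}))"
      using tcol_less[OF assms] tcell_surj[OF assms] by (force simp: tcell_eq)
  qed
  from bij_betw_same_card[OF this] show ?thesis by simp
qed

lemma card_by_column:
  assumes "\<And>a. a < k \<Longrightarrow> c a < J"
  shows "card {a. a < k \<and> P a} = (\<Sum>j<J. card {a. a < (k::nat) \<and> P a \<and> c a = (j::nat)})"
proof -
  have "(\<Sum>j<J. \<Sum>a\<in>{x \<in> {a. a < k \<and> P a}. c x = j}. 1::nat) = (\<Sum>a\<in>{a. a < k \<and> P a}. 1)"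
    by (rule sum.group) (use assms in auto)
  thus ?thesis by (simp add: conj_assoc)
qed

text \<open>The classical alternative: if \<open>sep\<close> fails, a transposition annihilates the
  product of the antisymmetrizer of \<open>\<nu>\<close>, the element \<open>g\<close> and the
  symmetrizer of \<open>\<mu>\<close>; if it holds, \<open>\<nu>\<close> dominates
  \<open>\<mu>\<close>.\<close>

locale tableau_pair =
  fixes k :: nat and \<mu> \<nu> :: "nat \<Rightarrow> nat" and g :: bijection
  assumes \<mu>: "\<mu> \<in> shapes k" and \<nu>: "\<nu> \<in> shapes k" and g: "g \<in> symb k"
    and sep: "\<And>a b. a < k \<Longrightarrow> b < k \<Longrightarrow> a \<noteq> b \<Longrightarrow> trow \<mu> a = trow \<mu> b \<Longrightarrow> tcol \<nu> (app g a) \<noteq> tcol \<nu> (app g b)"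
begin

text \<open>By \<open>sep\<close>, each of the first \<open>m\<close> rows of \<open>\<mu>\<close>
  sends at most one entry into column \<open>j\<close> of \<open>\<nu>\<close>, and altogether no
  more arrive than the column holds. The smaller of these bounds is the number of cells of that
  column in the first \<open>m\<close> rows.\<close>

lemma column_count_le:
  "card {a. a < k \<and> trow \<mu> a < m \<and> tcol \<nu> (app g a) = j} \<le> card {a. a < k \<and> trow \<nu> a < m \<and> tcol \<nu> a = j}"
    (is "card ?H \<le> card ?N")
proof (cases "\<forall>i<m. j < \<nu> i")
  case True
  have "card ?H \<le> card {..<m}"
  proof (rule card_inj_on_le[of "trow \<mu>"])
    show "inj_on (trow \<mu>) ?H"
    proof (rule inj_onI, rule ccontr)
      fix x y assume "x \<in> ?H" "y \<in> ?H" "trow \<mu> x = trow \<mu> y" "x \<noteq> y"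
      thus False using sep[of x y] by simp
    qed
  qed auto
  also have "\<dots> \<le> card ?N"
  proof -
    have "{..<m} \<subseteq> trow \<nu> ` ?N"
    proof
      fix i assume "i \<in> {..<m}"
      then obtain a where "a < k" "trow \<nu> a = i" "tcol \<nu> a = j" using tcell_surj[OF \<nu>, of j i] True by auto
      thus "i \<in> trow \<nu> ` ?N" using \<open>i \<in> {..<m}\<close> by auto
    qed
    thus ?thesis by (rule surj_card_le[rotated]) simp
  qed
  finally show ?thesis .
next
  case False
  then obtain i0 where i0: "i0 < m" "\<nu> i0 \<le> j" by auto
  have "?N = {a. a < k \<and> tcol \<nu> a = j}"
  proof -
    have "trow \<nu> a < m" if "a < k" "tcol \<nu> a = j" for a
    proof (rule ccontr)
      assume "\<not> trow \<nu> a < m"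
      hence "\<nu> (trow \<nu> a) \<le> \<nu> i0" using is_part_antimono[OF shapesD(1)[OF \<nu>]] i0 by simp
      thus False using tcol_less[OF \<nu> that(1)] that i0 by simp
    qed
    thus ?thesis by auto
  qed
  moreover have "card ?H \<le> card {a. a < k \<and> tcol \<nu> a = j}"
    by (rule card_inj_on_le[of "app g"])
       (use g in \<open>auto intro: inj_on_subset[OF bij_is_inj[OF bij_app]]\<close>)
  ultimately show ?thesis by simp
qed

lemma dominance: "(\<Sum>i<m. \<mu> i) \<le> (\<Sum>i<m. \<nu> i)"
proof -
  define J where "J = Suc (Max (tcol \<nu> ` {..<k} \<union> {0}))"
  have J: "tcol \<nu> a < J" if "a < k" for a
    unfolding J_def using that by (auto simp: less_Suc_eq_le intro!: Max_ge)
  have "(\<Sum>i<m. \<mu> i) = (\<Sum>j<J. card {a. a < k \<and> trow \<mu> a < m \<and> tcol \<nu> (app g a) = j})"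
    unfolding card_trow_less[OF \<mu>, symmetric] by (rule card_by_column) (use J g in auto)
  also have "\<dots> \<le> (\<Sum>j<J. card {a. a < k \<and> trow \<nu> a < m \<and> tcol \<nu> a = j})"
    by (intro sum_mono column_count_le)
  also have "\<dots> = (\<Sum>i<m. \<nu> i)"
    unfolding card_trow_less[OF \<nu>, symmetric] by (rule card_by_column[symmetric]) (use J in auto)
  finally show ?thesis .
qed

text \<open>Equal shapes force equality in all column counts. Comparing consecutive values of
  \<open>m\<close> shows that the column of \<open>app g a\<close> has a cell in the row of
  \<open>a\<close>; sending \<open>a\<close> to that cell is the row permutation, and the rest of
  \<open>g\<close> preserves columns.\<close>

lemma factor:
  assumes eq: "\<mu> = \<nu>"
  obtains c r where "c \<in> stab k (tcol \<mu>)" "r \<in> stab k (trow \<mu>)" "g = c + r"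
proof -
  define J where "J = Suc (Max (tcol \<nu> ` {..<k} \<union> {0}))"
  have J: "tcol \<nu> a < J" if "a < k" for a
    unfolding J_def using that by (auto simp: less_Suc_eq_le intro!: Max_ge)
  have cnt: "card {a. a < k \<and> trow \<mu> a < m \<and> tcol \<nu> (app g a) = j} = card {a. a < k \<and> trow \<nu> a < m \<and> tcol \<nu> a = j}"
    if "j < J" for j m
  proof -
    have "(\<Sum>j<J. card {a. a < k \<and> trow \<mu> a < m \<and> tcol \<nu> (app g a) = j}) = (\<Sum>i<m. \<mu> i)"
      unfolding card_trow_less[OF \<mu>, symmetric] by (rule card_by_column[symmetric]) (use J g in auto)
    also have "\<dots> = (\<Sum>j<J. card {a. a < k \<and> trow \<nu> a < m \<and> tcol \<nu> a = j})"
      unfolding eq card_trow_less[OF \<nu>, symmetric] by (rule card_by_column) (use J in auto)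
    finally show ?thesis by (rule sum_mono_inv) (use column_count_le that in auto)
  qed
  have "\<exists>b<k. trow \<mu> b = trow \<mu> a \<and> tcol \<mu> b = tcol \<mu> (app g a)" if a: "a < k" for a
  proof -
    let ?i = "trow \<mu> a" and ?j = "tcol \<nu> (app g a)"
    let ?H = "\<lambda>m. {a. a < k \<and> trow \<mu> a < m \<and> tcol \<nu> (app g a) = ?j}"
    let ?N = "\<lambda>m. {a. a < k \<and> trow \<nu> a < m \<and> tcol \<nu> a = ?j}"
    have "?H ?i \<subset> ?H (Suc ?i)" using a by auto
    hence "card (?H ?i) < card (?H (Suc ?i))" by (intro psubset_card_mono) auto
    hence "card (?N ?i) < card (?N (Suc ?i))" using cnt J[of "app g a"] a g by simp
    hence "\<not> ?N (Suc ?i) \<subseteq> ?N ?i" using card_mono[of "?N ?i" "?N (Suc ?i)"] by auto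
    thus ?thesis unfolding eq by (auto simp: less_Suc_eq)
  qed
  then obtain f where f: "\<And>a. a < k \<Longrightarrow> f a < k" "\<And>a. a < k \<Longrightarrow> trow \<mu> (f a) = trow \<mu> a"
    "\<And>a. a < k \<Longrightarrow> tcol \<mu> (f a) = tcol \<mu> (app g a)" by metis
  define \<rho> where "\<rho> = (\<lambda>a. if a < k then f a else a)"
  have "inj_on f {..<k}"
  proof (rule inj_onI, rule ccontr)
    fix a b assume "a \<in> {..<k}" "b \<in> {..<k}" "f a = f b" "a \<noteq> b"
    thus False using sep[of a b] f(2)[of a] f(2)[of b] f(3)[of a] f(3)[of b] eq by auto
  qed
  moreover from this have "f ` {..<k} = {..<k}" using f(1) by (intro endo_inj_surj) auto
  ultimately have "bij_betw f {..<k} {..<k}" unfolding bij_betw_def by blast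
  hence "bij_betw \<rho> {..<k} {..<k}" by (subst bij_betw_cong[of _ _ f]) (auto simp: \<rho>_def)
  hence "\<rho> permutes {..<k}" by (rule bij_imp_permutes) (auto simp: \<rho>_def)
  then obtain r where r: "r \<in> symb k" "\<rho> = app r" using perms_eq_app by blast
  have ar: "app r a = f a" if "a < k" for a using that r(2) by (metis \<rho>_def)
  have rs: "r \<in> stab k (trow \<mu>)" using r(1) f(2) by (auto simp: stab_def ar)
  have "g - r \<in> stab k (tcol \<mu>)" unfolding stab_def
  proof (intro CollectI conjI allI impI)
    show "g - r \<in> symb k" using g r by simp
    fix b assume b: "b < k"
    let ?a = "inv (app r) b"
    have a: "?a < k" using b r by simp
    have "tcol \<mu> (app (g - r) b) = tcol \<mu> (app g ?a)"
      by (simp add: diff_conv_add_uminus del: add_uminus_conv_diff)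
    also have "\<dots> = tcol \<mu> b" using f(3)[OF a] ar[OF a] by simp
    finally show "tcol \<mu> (app (g - r) b) = tcol \<mu> b" .
  qed
  thus ?thesis using that[of "g - r" r] rs by simp
qed

end

section \<open>Young symmetrizers\<close>

definition young :: "nat \<Rightarrow> (nat \<Rightarrow> nat) \<Rightarrow> galg" where
  "young k \<mu> = altz k (tcol \<mu>) * symz k (trow \<mu>)"

lemma young_galgs [simp]: "young k \<mu> \<in> galgs k"
  unfolding young_def by simp

text \<open>Without dominance \<open>sep\<close> fails for every \<open>g\<close>, and the two
  offending positions trigger the sign cancellation.\<close>

lemma altz_galg_symz_zero:
  assumes x: "x \<in> galgs k" and \<mu>: "\<mu> \<in> shapes k" and \<nu>: "\<nu> \<in> shapes k" and m: "\<not> (\<Sum>i<m. \<mu> i) \<le> (\<Sum>i<m. \<nu> i)"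
  shows "altz k (tcol \<nu>) * x * symz k (trow \<mu>) = 0"
proof (rule galgs_linear_eq[OF _ clinear_zero x, of "\<lambda>x. altz k (tcol \<nu>) * x * symz k (trow \<mu>)"])
  fix g assume g: "g \<in> symb k"
  have "\<not> tableau_pair k \<mu> \<nu> g" using tableau_pair.dominance m by blast
  then obtain a b where "a < k" "b < k" "a \<noteq> b" "trow \<mu> a = trow \<mu> b" "tcol \<nu> (app g a) = tcol \<nu> (app g b)"
    unfolding tableau_pair_def using \<mu> \<nu> g by blast
  thus "altz k (tcol \<nu>) * el g * symz k (trow \<mu>) = 0" using altz_symz_zero(1)[OF g] by blast
qed (rule clinear_compose[OF mult_linear_right mult_linear_left])

lemma symz_galg_altz_zero:
  assumes x: "x \<in> galgs k" and \<mu>: "\<mu> \<in> shapes k" and \<nu>: "\<nu> \<in> shapes k" and m: "\<not> (\<Sum>i<m. \<mu> i) \<le> (\<Sum>i<m. \<nu> i)"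
  shows "symz k (trow \<mu>) * x * altz k (tcol \<nu>) = 0"
proof (rule galgs_linear_eq[OF _ clinear_zero x, of "\<lambda>x. symz k (trow \<mu>) * x * altz k (tcol \<nu>)"])
  fix g assume g: "g \<in> symb k"
  have "altz k (tcol \<nu>) * el (- g) * symz k (trow \<mu>) = 0"
    using altz_galg_symz_zero[OF _ \<mu> \<nu> m, of "el (- g)"] g by simp
  from arg_cong[OF this, of antipode]
  show "symz k (trow \<mu>) * el g * altz k (tcol \<nu>) = 0"
    by (simp add: antipode_mult antipode_symz antipode_altz antipode_el cpair.linear_0[OF antipode_linear] mult.assoc)
qed (rule clinear_compose[OF mult_linear_right mult_linear_left])

lemma shape_eqI:
  fixes \<mu> \<nu> :: "nat \<Rightarrow> nat"
  assumes "\<And>m. (\<Sum>i<m. \<mu> i) = (\<Sum>i<m. \<nu> i)"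
  shows "\<mu> = \<nu>"
proof
  fix i show "\<mu> i = \<nu> i" using assms[of i] assms[of "Suc i"] by simp
qed

text \<open>For distinct shapes dominance fails in at least one direction. Failure in one direction
  annihilates the outer pair of factors, failure in the other the inner pair.\<close>

lemma young_orthogonal:
  assumes "\<mu> \<in> shapes k" "\<nu> \<in> shapes k" "\<mu> \<noteq> \<nu>" "x \<in> galgs k"
  shows "young k \<nu> * x * young k \<mu> = 0"
proof -
  have "\<exists>m. \<not> (\<Sum>i<m. \<mu> i) \<le> (\<Sum>i<m. \<nu> i) \<or> \<not> (\<Sum>i<m. \<nu> i) \<le> (\<Sum>i<m. \<mu> i)"
    using shape_eqI[of \<mu> \<nu>] assms(3) by (meson antisym)
  then obtain m where "\<not> (\<Sum>i<m. \<mu> i) \<le> (\<Sum>i<m. \<nu> i) \<or> \<not> (\<Sum>i<m. \<nu> i) \<le> (\<Sum>i<m. \<mu> i)" by blast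
  thus ?thesis
  proof
    assume m: "\<not> (\<Sum>i<m. \<mu> i) \<le> (\<Sum>i<m. \<nu> i)"
    have "altz k (tcol \<nu>) * (symz k (trow \<nu>) * x * altz k (tcol \<mu>)) * symz k (trow \<mu>) = 0"
      by (rule altz_galg_symz_zero[OF _ assms(1,2) m]) (use assms(4) in simp)
    thus ?thesis by (simp add: young_def mult.assoc)
  next
    assume m: "\<not> (\<Sum>i<m. \<nu> i) \<le> (\<Sum>i<m. \<mu> i)"
    have "symz k (trow \<nu>) * x * altz k (tcol \<mu>) = 0"
      by (rule symz_galg_altz_zero[OF assms(4,2,1) m])
    hence "altz k (tcol \<nu>) * (symz k (trow \<nu>) * x * altz k (tcol \<mu>)) * symz k (trow \<mu>) = 0" by simp
    thus ?thesis by (simp add: young_def mult.assoc)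
  qed
qed

text \<open>A group element between the two factors either splits into a column and a row
  permutation, both absorbed up to sign, or is annihilated through a transposition.\<close>

lemma altz_galg_symz_scalar:
  assumes \<mu>: "\<mu> \<in> shapes k" and x: "x \<in> galgs k"
  shows "\<exists>s. altz k (tcol \<mu>) * x * symz k (trow \<mu>) = cscale s (young k \<mu>)"
proof -
  have "\<exists>s. altz k (tcol \<mu>) * el g * symz k (trow \<mu>) = cscale s (young k \<mu>)" if g: "g \<in> symb k" for g
  proof (cases "tableau_pair k \<mu> \<mu> g")
    case True
    then obtain c r where cr: "c \<in> stab k (tcol \<mu>)" "r \<in> stab k (trow \<mu>)" "g = c + r"
      using tableau_pair.factor by blast
    have "altz k (tcol \<mu>) * el g * symz k (trow \<mu>) = (altz k (tcol \<mu>) * el c) * (el r * symz k (trow \<mu>))"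
      unfolding cr(3) el_mult[symmetric] by (simp add: mult.assoc)
    also have "\<dots> = cscale (sgnb c) (young k \<mu>)"
      unfolding young_def by (simp add: altz_el[OF cr(1)] el_symz[OF cr(2)] cscale_mult_left)
    finally show ?thesis by blast
  next
    case False
    then obtain a b where "a < k" "b < k" "a \<noteq> b" "trow \<mu> a = trow \<mu> b" "tcol \<mu> (app g a) = tcol \<mu> (app g b)"
      unfolding tableau_pair_def using \<mu> g by blast
    hence "altz k (tcol \<mu>) * el g * symz k (trow \<mu>) = cscale 0 (young k \<mu>)"
      using altz_symz_zero(1)[OF g] by auto
    thus ?thesis by blast
  qed
  then obtain s where s: "\<And>g. g \<in> symb k \<Longrightarrow> altz k (tcol \<mu>) * el g * symz k (trow \<mu>) = cscale (s g) (young k \<mu>)"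
    by metis
  have "altz k (tcol \<mu>) * x * symz k (trow \<mu>) =
    (\<Sum>g\<in>keys x. cscale (lookup x g) (altz k (tcol \<mu>) * el g * symz k (trow \<mu>)))"
    by (subst galg_expand[of x]) (simp add: sum_distrib_left sum_distrib_right cscale_mult_left cscale_mult_right)
  also have "\<dots> = (\<Sum>g\<in>keys x. cscale (lookup x g * s g) (young k \<mu>))"
    using x unfolding galgs_def by (intro sum.cong refl) (auto simp: s)
  also have "\<dots> = cscale (\<Sum>g\<in>keys x. lookup x g * s g) (young k \<mu>)"
    by (rule cscale_sum_left[symmetric])
  finally show ?thesis by blast
qed

lemma stab_row_col:
  assumes "\<mu> \<in> shapes k" "g \<in> stab k (trow \<mu>)" "g \<in> stab k (tcol \<mu>)"
  shows "g = 0"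
proof (rule symb_eqI[OF stab_symb[OF assms(2)]])
  fix a assume a: "a < k"
  have "trow \<mu> (app g a) = trow \<mu> a" "tcol \<mu> (app g a) = tcol \<mu> a" using a assms unfolding stab_def by auto
  thus "app g a = app 0 a" using tcell_inj[OF assms(1), of "app g a" a] a stab_symb[OF assms(2)] by simp
qed simp

text \<open>The row group and the column group meet only in the identity, so a single product
  contributes.\<close>

lemma trace_young:
  assumes "\<mu> \<in> shapes k"
  shows "lookup (young k \<mu>) 0 = 1"
proof -
  have "lookup (young k \<mu>) 0 = (\<Sum>g\<in>keys (altz k (tcol \<mu>)). lookup (altz k (tcol \<mu>)) g * lookup (symz k (trow \<mu>)) (- g + 0))"
    unfolding young_def by (rule lookup_galg_mult)
  also have "\<dots> = (\<Sum>g\<in>stab k (tcol \<mu>). sgnb g * lookup (symz k (trow \<mu>)) (- g))"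
    by (intro sum.mono_neutral_cong_left) (auto simp: in_keys_iff lookup_altz split: if_splits)
  also have "\<dots> = (\<Sum>g\<in>stab k (tcol \<mu>). if g = 0 then 1 else 0)"
  proof (intro sum.cong refl)
    fix g assume g: "g \<in> stab k (tcol \<mu>)"
    have "- g \<in> stab k (trow \<mu>) \<longleftrightarrow> g = 0"
      using stab_row_col[OF assms _ g] stab_closed(3)[of "- g" k "trow \<mu>"] by auto
    thus "sgnb g * lookup (symz k (trow \<mu>)) (- g) = (if g = 0 then 1 else 0)"
      by (auto simp: lookup_symz sgnb_def sign_id)
  qed
  finally show ?thesis by simp
qed

definition real_coeffs :: "galg \<Rightarrow> bool" where
  "real_coeffs a \<longleftrightarrow> (\<forall>g. lookup a g \<in> \<real>)"

lemma real_coeffs_mult: "real_coeffs a \<Longrightarrow> real_coeffs b \<Longrightarrow> real_coeffs (a * b)"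
  unfolding real_coeffs_def by (simp add: lookup_galg_mult)

lemma real_coeffs_symz: "real_coeffs (symz k q)" and real_coeffs_altz: "real_coeffs (altz k q)"
  unfolding real_coeffs_def by (auto simp: lookup_symz lookup_altz sgnb_def)

text \<open>
  The scalar is nonzero because \<open>y = alt * sym * alt\<close> is a real element fixed by the antipode: the trace of
  \<open>y * y\<close> is a sum of squares, and up to a positive factor it is the trace of the square of the Young symmetrizer.
\<close>

lemma young_square:
  assumes \<mu>: "\<mu> \<in> shapes k"
  obtains c where "c \<noteq> 0" "young k \<mu> * young k \<mu> = cscale c (young k \<mu>)"
proof -
  let ?A = "altz k (tcol \<mu>)" and ?S = "symz k (trow \<mu>)"
  let ?n = "of_nat (card (stab k (tcol \<mu>))) :: complex"
  obtain c where c: "young k \<mu> * young k \<mu> = cscale c (young k \<mu>)"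
    using altz_galg_symz_scalar[OF \<mu>, of "?S * ?A"] by (auto simp: young_def mult.assoc)
  define y where "y = ?A * ?S * ?A"
  have n0: "?n \<noteq> 0" using card_stab_pos[of k "tcol \<mu>"] unfolding of_nat_eq_0_iff by linarith
  have "lookup y 0 = ?n"
  proof -
    \<comment> \<open>Cyclicity of the trace brings the two antisymmetrizers together.\<close>
    have "lookup y 0 = lookup (?A * ?A * ?S) 0"
      unfolding y_def mult.assoc by (subst trace_commute) (simp add: mult.assoc trace_commute[of ?S])
    also have "\<dots> = ?n" using trace_young[OF \<mu>] by (simp add: altz_altz cscale_mult_left young_def)
    finally show ?thesis .
  qed
  hence k0: "0 \<in> keys y" using n0 by (simp add: in_keys_iff)
  have anti: "lookup y (- g) = lookup y g" for g
  proof -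
    have "antipode y = y"
      unfolding y_def by (simp add: antipode_mult antipode_symz antipode_altz mult.assoc)
    thus ?thesis by (metis lookup_antipode)
  qed
  have re: "lookup y g = of_real (Re (lookup y g))" for g
  proof -
    have "real_coeffs y" unfolding y_def by (intro real_coeffs_mult real_coeffs_symz real_coeffs_altz)
    thus ?thesis unfolding real_coeffs_def by (simp add: of_real_Re)
  qed
  have "lookup (y * y) 0 = (\<Sum>g\<in>keys y. lookup y g * lookup y g)"
    by (simp add: lookup_galg_mult anti)
  also have "\<dots> = of_real (\<Sum>g\<in>keys y. (Re (lookup y g))\<^sup>2)"
    unfolding of_real_sum by (intro sum.cong refl) (subst (1 2) re, simp add: power2_eq_square)
  finally have tr: "lookup (y * y) 0 = of_real (\<Sum>g\<in>keys y. (Re (lookup y g))\<^sup>2)" .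
  have "(\<Sum>g\<in>keys y. (Re (lookup y g))\<^sup>2) > 0"
  proof (rule sum_pos2[OF _ k0])
    have "Re (lookup y 0) \<noteq> 0" using re[of 0] k0 by (metis in_keys_iff of_real_0)
    thus "0 < (Re (lookup y 0))\<^sup>2" by simp
  qed auto
  hence "lookup (y * y) 0 \<noteq> 0" unfolding tr by (simp only: of_real_eq_0_iff)
  moreover have "y * y = cscale (?n * c) (young k \<mu> * ?A)"
  proof -
    have "y * y = ?A * ?S * (?A * ?A) * ?S * ?A" unfolding y_def by (simp add: mult.assoc)
    also have "\<dots> = cscale ?n (young k \<mu> * young k \<mu> * ?A)"
      by (simp add: altz_altz cscale_mult_left cscale_mult_right young_def mult.assoc)
    finally show ?thesis by (simp add: c cscale_mult_left)
  qed
  ultimately have "c \<noteq> 0" by auto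
  thus ?thesis using that c by blast
qed

subsection \<open>Words and semistandard tableaux\<close>

text \<open>The letter at position \<open>a\<close> moves to position \<open>\<pi> a\<close>;
  composing with the inverse on the right makes this a left action.\<close>

definition wact :: "(nat \<Rightarrow> nat) \<Rightarrow> ((nat \<Rightarrow> nat) \<Rightarrow>\<^sub>0 complex) \<Rightarrow> ((nat \<Rightarrow> nat) \<Rightarrow>\<^sub>0 complex)" where
  "wact \<pi> = pushforward (\<lambda>w. w \<circ> inv \<pi>)"

interpretation wkey: key_action "\<lambda>\<pi> w. (w :: nat \<Rightarrow> nat) \<circ> inv \<pi>"
proof
  fix \<sigma> \<tau> w :: "nat \<Rightarrow> nat" assume "bij \<sigma>" "bij \<tau>"
  thus "w \<circ> inv (\<sigma> \<circ> \<tau>) = w \<circ> inv \<tau> \<circ> inv \<sigma>" by (simp add: o_inv_distrib o_assoc)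
qed simp

interpretation wrep: perm_rep wact
  unfolding wact_def by (rule wkey.perm_rep)

abbreviation wm where "wm \<equiv> wrep.mact"

lemma lookup_wact: "bij \<pi> \<Longrightarrow> lookup (wact \<pi> p) w = lookup p (w \<circ> \<pi>)"
  unfolding wact_def by (simp add: wkey.lookup_push bij_imp_bij_inv inv_inv_eq)

lemma wact_single: "wact \<pi> (Poly_Mapping.single w x) = Poly_Mapping.single (w \<circ> inv \<pi>) x"
  unfolding wact_def by (rule pushforward_single)

definition fill :: "nat \<Rightarrow> (nat \<Rightarrow> nat) \<Rightarrow> (nat \<times> nat \<Rightarrow> nat) \<Rightarrow> nat \<Rightarrow> nat" where
  "fill k \<mu> T = restrict (\<lambda>a. T (tcell \<mu> a)) {..<k}"

lemma fill_apply: "a < k \<Longrightarrow> fill k \<mu> T a = T (trow \<mu> a, tcol \<mu> a)"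
  unfolding fill_def by (simp add: tcell_eq)

lemma fill_words:
  assumes "\<mu> \<in> shapes k" "T \<in> ssyt \<mu> r d"
  shows "fill k \<mu> T \<in> words r d k"
proof -
  have T: "T \<in> fcells \<mu> \<rightarrow>\<^sub>E {..<r}" "\<And>i. i < r \<Longrightarrow> card {c \<in> fcells \<mu>. T c = i} = d i"
    using assms(2) unfolding ssyt_def by auto
  note bij = tcell_bij[OF assms(1)]
  have "card {a \<in> {..<k}. fill k \<mu> T a = i} = d i" if "i < r" for i
  proof -
    have "bij_betw (tcell \<mu>) {a \<in> {..<k}. fill k \<mu> T a = i} {c \<in> fcells \<mu>. T c = i}"
      unfolding bij_betw_def
    proof
      show "inj_on (tcell \<mu>) {a \<in> {..<k}. fill k \<mu> T a = i}"
        by (rule inj_on_subset[OF bij_betw_imp_inj_on[OF bij]]) auto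
      show "tcell \<mu> ` {a \<in> {..<k}. fill k \<mu> T a = i} = {c \<in> fcells \<mu>. T c = i}"
        unfolding bij_betw_imp_surj_on[OF bij, symmetric] by (auto simp: fill_def)
    qed
    from bij_betw_same_card[OF this] show ?thesis using T(2)[OF that] by simp
  qed
  moreover have "fill k \<mu> T a < r" if "a < k" for a
    using T(1) bij_betwE[OF bij] that by (auto simp: fill_def)
  ultimately show ?thesis unfolding words_def by (auto simp: fill_def)
qed

lemma fill_inj:
  assumes "\<mu> \<in> shapes k"
  shows "inj_on (fill k \<mu>) (ssyt \<mu> r d)"
proof (rule inj_onI)
  fix T T' assume T: "T \<in> ssyt \<mu> r d" "T' \<in> ssyt \<mu> r d" "fill k \<mu> T = fill k \<mu> T'"
  have "T c = T' c" if "c \<in> fcells \<mu>" for c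
  proof -
    have "c \<in> tcell \<mu> ` {..<k}" using bij_betw_imp_surj_on[OF tcell_bij[OF assms]] that by simp
    then obtain a where "a < k" "c = tcell \<mu> a" by auto
    thus ?thesis using fun_cong[OF T(3), of a] by (simp add: fill_def)
  qed
  thus "T = T'" using T(1,2) unfolding ssyt_def by (intro PiE_ext[of T "fcells \<mu>" "\<lambda>_. {..<r}" T']) auto
qed

lemma fill_row_sorted:
  assumes "\<mu> \<in> shapes k" "T \<in> ssyt \<mu> r d" "a < k" "b < k" "trow \<mu> a = trow \<mu> b" "tcol \<mu> a < tcol \<mu> b"
  shows "fill k \<mu> T a \<le> fill k \<mu> T b"
  using sstd_row_mono[of \<mu> T "tcol \<mu> a" "tcol \<mu> b" "trow \<mu> b"] tcol_less[OF assms(1,4)] assms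
  by (simp add: fill_apply ssyt_def)

lemma fill_col_sorted:
  assumes "\<mu> \<in> shapes k" "T \<in> ssyt \<mu> r d" "a < k" "b < k" "tcol \<mu> a = tcol \<mu> b" "trow \<mu> a < trow \<mu> b"
  shows "fill k \<mu> T a < fill k \<mu> T b"
  using sstd_col_mono[of \<mu> T "trow \<mu> a" "trow \<mu> b" "tcol \<mu> b"] tcol_less[OF assms(1,4)] assms shapesD(1)[OF assms(1)]
  by (simp add: fill_apply ssyt_def)

text \<open>The statistic for triangularity: unchanged by permutations within columns, and maximal
  among row rearrangements when the rows are sorted.\<close>

definition col_weight :: "nat \<Rightarrow> (nat \<Rightarrow> nat) \<Rightarrow> (nat \<Rightarrow> nat) \<Rightarrow> nat" where
  "col_weight k \<mu> w = (\<Sum>a<k. tcol \<mu> a * w a)"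

text \<open>Column permutations preserve \<open>col_weight\<close>, and row permutations of a
  filling with sorted rows can only lower it. In case of equality the row permutation leaves the
  word unchanged, so the two fillings are column rearrangements of each other, and strictly
  increasing columns leave no freedom.\<close>

lemma fill_triangular:
  assumes \<mu>: "\<mu> \<in> shapes k" and T: "T \<in> ssyt \<mu> r d" "T' \<in> ssyt \<mu> r d"
    and \<rho>: "\<rho> \<in> stab k (trow \<mu>)" and c: "c \<in> stab k (tcol \<mu>)"
    and eq: "fill k \<mu> T \<circ> inv (app \<rho>) \<circ> inv (app c) = fill k \<mu> T'"
  shows "col_weight k \<mu> (fill k \<mu> T') \<le> col_weight k \<mu> (fill k \<mu> T)"
    and "col_weight k \<mu> (fill k \<mu> T') = col_weight k \<mu> (fill k \<mu> T) \<Longrightarrow> T' = T \<and> c = 0"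
proof -
  let ?w = "fill k \<mu> T" and ?w' = "fill k \<mu> T'"
  have cs: "c \<in> symb k" and rs: "\<rho> \<in> symb k" using c \<rho> stab_symb by auto
  have e: "?w' (app c a) = ?w (app (- \<rho>) a)" for a using fun_cong[OF eq, of "app c a"] by simp
  have tc: "tcol \<mu> (app c a) = tcol \<mu> a" if "a < k" for a using c that unfolding stab_def by blast
  have cw: "col_weight k \<mu> ?w' = (\<Sum>a<k. tcol \<mu> a * ?w (app (- \<rho>) a))"
  proof -
    have "col_weight k \<mu> ?w' = (\<Sum>a<k. tcol \<mu> (app c a) * ?w' (app c a))"
      unfolding col_weight_def by (rule sum_symb[OF cs, symmetric])
    thus ?thesis by (simp add: e tc)
  qed
  have row: "(\<Sum>a<k. tcol \<mu> a * ?w (app (- \<rho>) a)) \<le> (\<Sum>a<k. tcol \<mu> a * ?w a)"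
    "\<And>a. (\<Sum>a<k. tcol \<mu> a * ?w (app (- \<rho>) a)) = (\<Sum>a<k. tcol \<mu> a * ?w a) \<Longrightarrow> a < k \<Longrightarrow> ?w (app (- \<rho>) a) = ?w a"
    by (rule sum_rearrange[of k "trow \<mu>" "tcol \<mu>" ?w "- \<rho>"]; (use fill_row_sorted[OF \<mu> T(1)] tcell_inj[OF \<mu>] stab_closed(3)[OF \<rho>] in blast)?)+
  show "col_weight k \<mu> ?w' \<le> col_weight k \<mu> ?w" unfolding cw unfolding col_weight_def by (rule row(1))
  assume "col_weight k \<mu> ?w' = col_weight k \<mu> ?w"
  hence eq1: "?w (app (- \<rho>) a) = ?w a" if "a < k" for a
    using row(2)[OF _ that] unfolding cw unfolding col_weight_def by blast
  have w'c: "?w' (app c a) = ?w a" if "a < k" for a using e eq1[OF that] by simp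
  have wc: "?w (app (- c) a) = ?w' a" if "a < k" for a
    using w'c[of "app (- c) a"] that cs by simp
  have inj: "a = b" if "a < k" "b < k" "tcol \<mu> a = tcol \<mu> b" "trow \<mu> a = trow \<mu> b" for a b
    using tcell_inj[OF \<mu>] that by blast
  have sorted: "fill k \<mu> U a \<le> fill k \<mu> U b"
    if "U \<in> ssyt \<mu> r d" "a < k" "b < k" "tcol \<mu> a = tcol \<mu> b" "trow \<mu> a < trow \<mu> b" for U a b
    using fill_col_sorted[OF \<mu> that] by simp
  \<comment> \<open>Both fillings are sorted down the columns and each is a rearrangement of the
    other, so the inequality holds in both directions and its equality case applies.\<close>
  have col': "(\<Sum>a<k. trow \<mu> a * ?w' (app c a)) \<le> (\<Sum>a<k. trow \<mu> a * ?w' a)"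
    "\<And>a. (\<Sum>a<k. trow \<mu> a * ?w' (app c a)) = (\<Sum>a<k. trow \<mu> a * ?w' a) \<Longrightarrow> a < k \<Longrightarrow> ?w' (app c a) = ?w' a"
    by (rule sum_rearrange[of k "tcol \<mu>" "trow \<mu>" ?w' c]; (use sorted[OF T(2)] inj c in blast)?)+
  have col: "(\<Sum>a<k. trow \<mu> a * ?w (app (- c) a)) \<le> (\<Sum>a<k. trow \<mu> a * ?w a)"
    "\<And>a. (\<Sum>a<k. trow \<mu> a * ?w (app (- c) a)) = (\<Sum>a<k. trow \<mu> a * ?w a) \<Longrightarrow> a < k \<Longrightarrow> ?w (app (- c) a) = ?w a"
    by (rule sum_rearrange[of k "tcol \<mu>" "trow \<mu>" ?w "- c"]; (use sorted[OF T(1)] inj stab_closed(3)[OF c] in blast)?)+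
  have "(\<Sum>a<k. trow \<mu> a * ?w' (app c a)) = (\<Sum>a<k. trow \<mu> a * ?w a)" using w'c by simp
  moreover have "(\<Sum>a<k. trow \<mu> a * ?w (app (- c) a)) = (\<Sum>a<k. trow \<mu> a * ?w' a)" using wc by simp
  ultimately have "(\<Sum>a<k. trow \<mu> a * ?w' (app c a)) = (\<Sum>a<k. trow \<mu> a * ?w' a)"
    using col'(1) col(1) by simp
  hence w'c': "?w' (app c a) = ?w' a" if "a < k" for a using col'(2) that by blast
  have "?w' = ?w"
  proof
    fix a show "?w' a = ?w a" using w'c[of a] w'c'[of a] by (cases "a < k") (auto simp: fill_def)
  qed
  hence "T' = T" using inj_onD[OF fill_inj[OF \<mu>]] T by blast
  moreover have "c = 0"
  proof (rule symb_eqI[OF cs])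
    fix a assume a: "a < k"
    have ca: "app c a < k" using a cs by simp
    \<comment> \<open>Entries of one column are distinct, so an unchanged entry means an unchanged
      row.\<close>
    have "trow \<mu> (app c a) = trow \<mu> a"
    proof (rule ccontr)
      assume "trow \<mu> (app c a) \<noteq> trow \<mu> a"
      thus False
        using fill_col_sorted[OF \<mu> T(2) ca a] fill_col_sorted[OF \<mu> T(2) a ca] tc[OF a] w'c'[OF a]
        by (auto simp: neq_iff)
    qed
    thus "app c a = app 0 a" using inj[OF ca a] tc[OF a] by simp
  qed simp
  ultimately show "T' = T \<and> c = 0" by blast
qed

lemma young_expand: "young k \<mu> = (\<Sum>c\<in>stab k (tcol \<mu>). \<Sum>\<rho>\<in>stab k (trow \<mu>). cscale (sgnb c) (el (c + \<rho>)))"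
  unfolding young_def altz_def symz_def sum_distrib_left sum_distrib_right
  by (subst sum.swap) (simp add: cscale_mult_left el_mult)

lemma lookup_young_single:
  "lookup (wm (young k \<mu>) (Poly_Mapping.single w 1)) w' =
    (\<Sum>c\<in>stab k (tcol \<mu>). \<Sum>\<rho>\<in>stab k (trow \<mu>). if w \<circ> inv (app \<rho>) \<circ> inv (app c) = w' then sgnb c else 0)"
  unfolding young_expand wrep.mact_sum_left wrep.mact_scale_left wrep.mact_el wact_single lookup_sum lookup_cscale
  by (intro sum.cong refl) (simp add: lookup_single when_def o_inv_distrib o_assoc)

text \<open>In a vanishing combination, let \<open>T0\<close> have maximal \<open>col_weight\<close>
  among the tableaux with nonzero coefficient. By \<open>fill_triangular\<close> the word of
  \<open>T0\<close> does not occur in the image of any other of them, and in its own image it arises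
  from the trivial column permutation only, so no cancellation is possible.\<close>

lemma young_fill_indep:
  assumes \<mu>: "\<mu> \<in> shapes k"
  shows "indep_fam (ssyt \<mu> r d) (\<lambda>T. wm (young k \<mu>) (Poly_Mapping.single (fill k \<mu> T) 1))"
  unfolding indep_fam_def
proof (intro allI impI, rule ccontr)
  let ?I = "ssyt \<mu> r d" and ?v = "\<lambda>T. wm (young k \<mu>) (Poly_Mapping.single (fill k \<mu> T) 1)"
  let ?W = "\<lambda>T. col_weight k \<mu> (fill k \<mu> T)"
  fix s assume s: "(\<Sum>T\<in>?I. cscale (s T) (?v T)) = 0" and "\<not> (\<forall>T\<in>?I. s T = 0)"
  have fin: "finite ?I" using finite_ssyt shapesD(1)[OF \<mu>] by blast
  let ?J = "{T \<in> ?I. s T \<noteq> 0}"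
  have "?J \<noteq> {}" "finite ?J" using fin \<open>\<not> (\<forall>T\<in>?I. s T = 0)\<close> by auto
  hence "?W ` ?J \<noteq> {}" "finite (?W ` ?J)" by auto
  from Max_in[OF this(2,1)] obtain T0 where T0: "T0 \<in> ?J" "?W T0 = Max (?W ` ?J)" by auto
  have max: "?W T \<le> ?W T0" if "T \<in> ?J" for T unfolding T0(2) using that \<open>finite ?J\<close> by (intro Max_ge) auto
  have z: "lookup (?v T) (fill k \<mu> T0) = 0" if T: "T \<in> ?J" "T \<noteq> T0" for T
    unfolding lookup_young_single
  proof (intro sum.neutral ballI)
    fix c \<rho> assume c: "c \<in> stab k (tcol \<mu>)" and \<rho>: "\<rho> \<in> stab k (trow \<mu>)"
    have "fill k \<mu> T \<circ> inv (app \<rho>) \<circ> inv (app c) \<noteq> fill k \<mu> T0"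
    proof
      assume eq: "fill k \<mu> T \<circ> inv (app \<rho>) \<circ> inv (app c) = fill k \<mu> T0"
      have TT: "T \<in> ?I" "T0 \<in> ?I" using T T0 by auto
      show False using fill_triangular[OF \<mu> TT \<rho> c eq] max[OF T(1)] T(2) by auto
    qed
    thus "(if fill k \<mu> T \<circ> inv (app \<rho>) \<circ> inv (app c) = fill k \<mu> T0 then sgnb c else 0) = 0" by simp
  qed
  have nz: "lookup (?v T0) (fill k \<mu> T0) \<noteq> 0"
  proof -
    \<comment> \<open>Each row permutation fixing the word counts 1, and the identity is one of
      them.\<close>
    let ?R = "{\<rho> \<in> stab k (trow \<mu>). fill k \<mu> T0 \<circ> inv (app \<rho>) = fill k \<mu> T0}"
    have TT: "T0 \<in> ?I" using T0 by auto
    have "lookup (?v T0) (fill k \<mu> T0) = (\<Sum>c\<in>stab k (tcol \<mu>). if c = 0 then of_nat (card ?R) else 0)"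
      unfolding lookup_young_single
    proof (intro sum.cong refl)
      fix c assume c: "c \<in> stab k (tcol \<mu>)"
      show "(\<Sum>\<rho>\<in>stab k (trow \<mu>). if fill k \<mu> T0 \<circ> inv (app \<rho>) \<circ> inv (app c) = fill k \<mu> T0 then sgnb c else 0) =
        (if c = 0 then of_nat (card ?R) else 0)"
      proof (cases "c = 0")
        case True
        thus ?thesis by (simp add: sgnb_def sign_id sum.inter_filter[symmetric])
      next
        case False
        have "fill k \<mu> T0 \<circ> inv (app \<rho>) \<circ> inv (app c) \<noteq> fill k \<mu> T0" if "\<rho> \<in> stab k (trow \<mu>)" for \<rho>
          using fill_triangular(2)[OF \<mu> TT TT that c] False by blast
        thus ?thesis using False by (simp add: sum.neutral)
      qed
    qed
    also have "\<dots> = of_nat (card ?R)" by simp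
    finally have "lookup (?v T0) (fill k \<mu> T0) = of_nat (card ?R)" .
    moreover have "0 \<in> ?R" by simp
    moreover have "finite ?R" by simp
    ultimately have "lookup (?v T0) (fill k \<mu> T0) = of_nat (card ?R)" "card ?R \<noteq> 0"
      by (blast, metis card_eq_0_iff empty_iff)
    thus ?thesis by simp
  qed
  have "0 = lookup (\<Sum>T\<in>?I. cscale (s T) (?v T)) (fill k \<mu> T0)" unfolding s by simp
  also have "\<dots> = (\<Sum>T\<in>?I. s T * lookup (?v T) (fill k \<mu> T0))" by (simp add: lookup_sum)
  also have "\<dots> = (\<Sum>T\<in>{T0}. s T * lookup (?v T) (fill k \<mu> T0))"
  proof (rule sum.mono_neutral_right)
    show "\<forall>T\<in>?I - {T0}. s T * lookup (?v T) (fill k \<mu> T0) = 0" using z by (metis (mono_tags, lifting) DiffE insertCI mem_Collect_eq mult_eq_0_iff)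
  qed (use fin T0 in auto)
  finally show False using nz T0 by simp
qed

lemma words_transitive:
  assumes "w \<in> words r d k" "w' \<in> words r d k"
  obtains g where "g \<in> symb k" "w \<circ> inv (app g) = w'"
proof -
  have cnt: "card {a \<in> {..<k}. w a = i} = card {a \<in> {..<k}. w' a = i}" for i
  proof (cases "i < r")
    case True
    thus ?thesis using assms unfolding words_def by simp
  next
    case False
    hence "{a \<in> {..<k}. w a = i} = {}" "{a \<in> {..<k}. w' a = i} = {}"
      using assms unfolding words_def by (auto simp: PiE_iff)
    thus ?thesis by (simp only:)
  qed
  have "image_mset w' (mset_set {..<k}) = image_mset w (mset_set {..<k})"
  proof (rule multiset_eqI)
    fix x show "count (image_mset w' (mset_set {..<k})) x = count (image_mset w (mset_set {..<k})) x"
      using cnt[of x] by (simp add: count_image_mset' eq_commute[of x])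
  qed
  from image_mset_eq_implies_permutes[OF _ this]
  obtain p where p: "p permutes {..<k}" "\<forall>a\<in>{..<k}. w' a = w (p a)" by auto
  obtain h where h: "h \<in> symb k" "p = app h" using perms_eq_app p(1) by blast
  have "w \<circ> app h = w'"
  proof
    fix a show "(w \<circ> app h) a = w' a"
      using p(2) h symb_fix[OF h(1), of a] assms unfolding words_def
      by (cases "a < k") (auto simp: PiE_iff extensional_def)
  qed
  thus ?thesis using that[of "- h"] h by (simp add: inv_inv_eq)
qed

lemma app_diff [simp]: "app (g - h) = app g \<circ> inv (app h)"
  by (simp add: diff_conv_add_uminus del: add_uminus_conv_diff)

subsection \<open>Decomposition of the permutation modules\<close>

text \<open>The left ideal generated by the Young symmetrizer, a copy of the irreducible module of
  the shape.\<close>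

definition yideal :: "nat \<Rightarrow> (nat \<Rightarrow> nat) \<Rightarrow> galg set" where
  "yideal k \<mu> = (\<lambda>x. x * young k \<mu>) ` galgs k"

lemma yideal_galgs: "x \<in> yideal k \<mu> \<Longrightarrow> x \<in> galgs k"
  unfolding yideal_def by auto

lemma yideal_subspace: "cvec.subspace (yideal k \<mu>)"
  unfolding yideal_def by (rule cpair.linear_subspace_image[OF mult_linear_right galgs_subspace])

lemma fd_yideal: "fd (yideal k \<mu>)"
  by (rule fd_supported[OF finite_symb[of k]]) (auto dest!: yideal_galgs simp: galgs_def)

lemma yideal_mult: "a \<in> galgs k \<Longrightarrow> x \<in> yideal k \<mu> \<Longrightarrow> a * x \<in> yideal k \<mu>"
  unfolding yideal_def by (auto intro!: image_eqI[where x = "a * _"] simp: mult.assoc)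

lemma yideal_galgs_young: "a \<in> galgs k \<Longrightarrow> a * young k \<mu> \<in> yideal k \<mu>"
  unfolding yideal_def by blast

lemma indep_fam_scale:
  assumes "c \<noteq> 0" "indep_fam I v"
  shows "indep_fam I (\<lambda>i. cscale c (v i))"
  unfolding indep_fam_def
proof (intro allI impI ballI)
  fix s i assume s: "(\<Sum>i\<in>I. cscale (s i) (cscale c (v i))) = 0" and i: "i \<in> I"
  have "(\<Sum>i\<in>I. cscale (s i * c) (v i)) = 0" using s by simp
  hence "s i * c = 0" by (rule indep_famD[OF assms(2) _ i])
  thus "s i = 0" using assms(1) by simp
qed

text \<open>Words with \<open>k\<close> distinct letters carry the regular representation, so
  \<open>young_fill_indep\<close> for standard tableaux gives independent elements of the right
  ideal of the Young symmetrizer. The antipode carries them over to the left ideal.\<close>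

lemma dim_yideal_ge:
  assumes \<mu>: "\<mu> \<in> shapes k"
  shows "kostka \<mu> k (\<lambda>_. 1) \<le> cvec.dim (yideal k \<mu>)"
proof -
  let ?I = "ssyt \<mu> k (\<lambda>_. 1)" and ?Y = "young k \<mu>"
  let ?w0 = "restrict (\<lambda>a. a) {..<k}"
  have w0: "?w0 \<in> words k (\<lambda>_. 1) k"
  proof -
    have "{a. a < k \<and> a = i} = {i}" if "i < k" for i using that by auto
    thus ?thesis by (auto simp: words_def cong: conj_cong)
  qed
  have "\<forall>T\<in>?I. \<exists>g. g \<in> symb k \<and> ?w0 \<circ> inv (app g) = fill k \<mu> T"
    using words_transitive[OF w0 fill_words[OF \<mu>]] by metis
  then obtain g where g: "\<And>T. T \<in> ?I \<Longrightarrow> g T \<in> symb k" "\<And>T. T \<in> ?I \<Longrightarrow> ?w0 \<circ> inv (app (g T)) = fill k \<mu> T"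
    by metis
  have fin: "finite ?I" using finite_ssyt shapesD(1)[OF \<mu>] by blast
  obtain c where c: "c \<noteq> 0" "?Y * ?Y = cscale c ?Y" using young_square[OF \<mu>] .
  have "indep_fam ?I (\<lambda>T. wm (?Y * el (g T)) (Poly_Mapping.single ?w0 1))"
    using young_fill_indep[OF \<mu>, of k "\<lambda>_. 1"] unfolding indep_fam_def
    by (simp add: wrep.mact_mult wrep.mact_el wact_single g(2) cong: sum.cong)
  from indep_fam_linear[OF wrep.mact_linear_left this]
  have 1: "indep_fam ?I (\<lambda>T. ?Y * el (g T))" .
  \<comment> \<open>Chosen so that multiplying by the antisymmetrizer and applying the antipode
    gives a nonzero multiple of the family in the right ideal; the extra \<open>symz\<close>
    supplies the factor that completes the square of the Young symmetrizer.\<close>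
  let ?v = "\<lambda>T. el (- g T) * symz k (trow \<mu>) * ?Y"
  have "antipode (?v T * altz k (tcol \<mu>)) = cscale c (?Y * el (g T))" for T
  proof -
    have "antipode (?v T * altz k (tcol \<mu>)) = ?Y * ?Y * el (g T)"
      by (simp add: young_def antipode_mult antipode_symz antipode_altz antipode_el mult.assoc)
    thus ?thesis by (simp add: c(2) cscale_mult_left)
  qed
  hence "indep_fam ?I (\<lambda>T. antipode (?v T * altz k (tcol \<mu>)))"
    using indep_fam_scale[OF c(1) 1] by simp
  from indep_fam_linear[OF clinear_compose[OF antipode_linear mult_linear_right] this]
  have "indep_fam ?I ?v" .
  moreover have "?v ` ?I \<subseteq> yideal k \<mu>" using g(1) by (auto intro!: yideal_galgs_young)
  ultimately have "card ?I \<le> cvec.dim (yideal k \<mu>)"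
    using indep_fam_card_le[OF fin _ _ fd_yideal] by blast
  thus ?thesis unfolding kostka_def .
qed

lemma yideal_young:
  assumes "\<mu> \<in> shapes k" "young k \<mu> * young k \<mu> = cscale c (young k \<mu>)" "x \<in> yideal k \<mu>"
  shows "x * young k \<mu> = cscale c x"
  using assms(2,3) unfolding yideal_def by (auto simp: mult.assoc cscale_mult_right)

text \<open>Nondegeneracy of the trace: up to the nonzero scalar of \<open>young_square\<close>, the
  coefficient of \<open>x\<close> at \<open>g\<close> is the trace of
  \<open>young k \<mu> * el (- g) * x\<close>.\<close>

lemma yideal_eq_0:
  assumes \<mu>: "\<mu> \<in> shapes k" and x: "x \<in> yideal k \<mu>"
    and ann: "\<And>a. a \<in> galgs k \<Longrightarrow> young k \<mu> * a * x = 0"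
  shows "x = 0"
proof (rule poly_mapping_eqI)
  fix g
  obtain c where c: "c \<noteq> 0" "young k \<mu> * young k \<mu> = cscale c (young k \<mu>)" using young_square[OF \<mu>] .
  show "lookup x g = lookup 0 g"
  proof (cases "g \<in> symb k")
    case True
    have "0 = lookup (young k \<mu> * (el (- g) * x)) 0"
      using ann[of "el (- g)"] True by (simp add: mult.assoc)
    also have "\<dots> = lookup (el (- g) * (x * young k \<mu>)) 0"
      by (subst trace_commute) (simp add: mult.assoc)
    also have "\<dots> = c * lookup x g"
      by (simp add: yideal_young[OF \<mu> c(2) x] cscale_mult_right lookup_el_mult)
    finally show ?thesis using c(1) by simp
  next
    case False
    thus ?thesis using yideal_galgs[OF x] unfolding galgs_def by (auto simp: in_keys_iff)
  qed
qed

text \<open>Multiplication by \<open>young k \<nu> * a\<close> removes all other shapes by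
  orthogonality and turns the remaining coefficients into scalar multiples of the Young symmetrizer,
  to which \<open>young_fill_indep\<close> applies. Letting \<open>a\<close> vary then gives
  \<open>x \<nu> U = 0\<close>.\<close>

lemma fill_combination_inj:
  assumes x: "\<And>\<mu> T. \<mu> \<in> shapes k \<Longrightarrow> T \<in> ssyt \<mu> r d \<Longrightarrow> x \<mu> T \<in> yideal k \<mu>"
    and sum: "(\<Sum>\<mu>\<in>shapes k. \<Sum>T\<in>ssyt \<mu> r d. wm (x \<mu> T) (Poly_Mapping.single (fill k \<mu> T) 1)) = 0"
    and \<nu>: "\<nu> \<in> shapes k" and U: "U \<in> ssyt \<nu> r d"
  shows "x \<nu> U = 0"
proof (rule yideal_eq_0[OF \<nu> x[OF \<nu> U]])
  fix a assume a: "a \<in> galgs k"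
  let ?f = "\<lambda>\<mu> T. Poly_Mapping.single (fill k \<mu> T) 1"
  have other: "young k \<nu> * a * x \<mu> T = 0" if m: "\<mu> \<in> shapes k" "T \<in> ssyt \<mu> r d" "\<mu> \<noteq> \<nu>" for \<mu> T
  proof -
    obtain y where "y \<in> galgs k" "x \<mu> T = y * young k \<mu>" using x[OF m(1,2)] unfolding yideal_def by blast
    thus ?thesis using young_orthogonal[OF m(1) \<nu> m(3), of "a * y"] a by (simp add: mult.assoc)
  qed
  have "\<exists>s. young k \<nu> * a * x \<nu> T = cscale s (young k \<nu>)" if T: "T \<in> ssyt \<nu> r d" for T
  proof -
    obtain y where y: "y \<in> galgs k" "x \<nu> T = y * young k \<nu>" using x[OF \<nu> T] unfolding yideal_def by blast
    have "\<exists>s. altz k (tcol \<nu>) * (symz k (trow \<nu>) * a * y * altz k (tcol \<nu>)) * symz k (trow \<nu>) = cscale s (young k \<nu>)"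
      by (rule altz_galg_symz_scalar[OF \<nu>]) (use a y in simp)
    thus ?thesis unfolding y(2) by (simp add: young_def mult.assoc)
  qed
  then obtain s where s: "\<And>T. T \<in> ssyt \<nu> r d \<Longrightarrow> young k \<nu> * a * x \<nu> T = cscale (s T) (young k \<nu>)" by metis
  have "0 = wm (young k \<nu> * a) (\<Sum>\<mu>\<in>shapes k. \<Sum>T\<in>ssyt \<mu> r d. wm (x \<mu> T) (?f \<mu> T))"
    unfolding sum by (simp add: wrep.mact_0)
  also have "\<dots> = (\<Sum>\<mu>\<in>shapes k. \<Sum>T\<in>ssyt \<mu> r d. wm (young k \<nu> * a * x \<mu> T) (?f \<mu> T))"
    by (simp add: wrep.mact_sum wrep.mact_mult)
  also have "\<dots> = (\<Sum>\<mu>\<in>{\<nu>}. \<Sum>T\<in>ssyt \<mu> r d. wm (young k \<nu> * a * x \<mu> T) (?f \<mu> T))"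
    using \<nu> other by (intro sum.mono_neutral_right) (auto simp: wrep.mact_0_left)
  also have "\<dots> = (\<Sum>T\<in>ssyt \<nu> r d. cscale (s T) (wm (young k \<nu>) (?f \<nu> T)))"
    by (simp add: s wrep.mact_scale_left)
  finally have e: "(\<Sum>T\<in>ssyt \<nu> r d. cscale (s T) (wm (young k \<nu>) (?f \<nu> T))) = 0" by (rule sym)
  have "s U = 0" by (rule indep_famD[OF young_fill_indep[OF \<nu>] e U])
  thus "young k \<nu> * a * x \<nu> U = 0" using s[OF U] by simp
qed

lemma words_inv_app:
  assumes "w \<in> words r d k" "g \<in> symb k"
  shows "w \<circ> inv (app g) \<in> words r d k"
proof -
  have "card {a \<in> {..<k}. (w \<circ> inv (app g)) a = i} = card {a \<in> {..<k}. w a = i}" for i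
    by (rule bij_betw_same_card[of "app (- g)"], rule bij_betw_byWitness[where f' = "app g"])
       (use assms(2) in auto)
  moreover have "(w \<circ> inv (app g)) a = undefined" if "\<not> a < k" for a
    using symb_fix[of "- g" k a] assms that unfolding words_def by (auto simp: PiE_iff extensional_def)
  moreover have "(w \<circ> inv (app g)) a < r" if "a < k" for a
    using assms that unfolding words_def by (auto simp: PiE_iff)
  ultimately show ?thesis using assms(1) unfolding words_def by (auto simp: PiE_iff extensional_def)
qed

text \<open>Bases of the ideals, one for each tableau, give independent vectors. By
  \<open>dim_yideal_ge\<close> and \<open>sum_kostka_standard\<close> they are at least as many as
  the words of content \<open>d\<close>, so they span.\<close>

lemma word_is_fill_combination:
  assumes w: "w \<in> words r d k"
  obtains y where "\<And>\<mu> T. \<mu> \<in> shapes k \<Longrightarrow> T \<in> ssyt \<mu> r d \<Longrightarrow> y \<mu> T \<in> yideal k \<mu>"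
    and "Poly_Mapping.single w 1 = (\<Sum>\<mu>\<in>shapes k. \<Sum>T\<in>ssyt \<mu> r d. wm (y \<mu> T) (Poly_Mapping.single (fill k \<mu> T) 1))"
proof -
  let ?f = "\<lambda>\<mu> T. Poly_Mapping.single (fill k \<mu> T) (1::complex)"
  let ?M = "{p :: (nat \<Rightarrow> nat) \<Rightarrow>\<^sub>0 complex. keys p \<subseteq> words r d k}"
  have "\<exists>B. finite B \<and> B \<subseteq> yideal k \<mu> \<and> cvec.independent B \<and> cvec.span B = yideal k \<mu> \<and> card B = cvec.dim (yideal k \<mu>)" for \<mu>
    using fd_basis[OF fd_yideal yideal_subspace] by metis
  then obtain B where B: "\<And>\<mu>. finite (B \<mu>)" "\<And>\<mu>. B \<mu> \<subseteq> yideal k \<mu>" "\<And>\<mu>. cvec.independent (B \<mu>)"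
    "\<And>\<mu>. card (B \<mu>) = cvec.dim (yideal k \<mu>)" by metis
  have finT: "finite (ssyt \<mu> r d)" if "\<mu> \<in> shapes k" for \<mu> using that finite_ssyt shapesD(1) by blast
  let ?J = "Sigma (shapes k) (\<lambda>\<mu>. ssyt \<mu> r d \<times> B \<mu>)"
  let ?v = "\<lambda>(\<mu>, T, b). wm b (?f \<mu> T)"
  have finJ: "finite ?J" using finT B(1) by auto
  let ?x = "\<lambda>s \<mu> T. \<Sum>b\<in>B \<mu>. cscale (s (\<mu>, T, b)) b"
  have x: "?x s \<mu> T \<in> yideal k \<mu>" for s \<mu> T
    using B(2) yideal_subspace by (intro cvec.subspace_sum cvec.subspace_scale) auto
  have split: "(\<Sum>j\<in>?J. cscale (s j) (?v j)) = (\<Sum>\<mu>\<in>shapes k. \<Sum>T\<in>ssyt \<mu> r d. wm (?x s \<mu> T) (?f \<mu> T))" for s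
  proof -
    have "(\<Sum>j\<in>?J. cscale (s j) (?v j)) =
      (\<Sum>\<mu>\<in>shapes k. \<Sum>p\<in>ssyt \<mu> r d \<times> B \<mu>. cscale (s (\<mu>, p)) (?v (\<mu>, p)))"
      using finT B(1) by (subst sum.Sigma) (auto intro!: sum.cong)
    also have "\<dots> = (\<Sum>\<mu>\<in>shapes k. \<Sum>T\<in>ssyt \<mu> r d. \<Sum>b\<in>B \<mu>. cscale (s (\<mu>, T, b)) (wm b (?f \<mu> T)))"
      by (intro sum.cong refl) (simp add: sum.cartesian_product split_def)
    finally show ?thesis by (simp add: wrep.mact_sum_left wrep.mact_scale_left)
  qed
  have ind: "indep_fam ?J ?v" unfolding indep_fam_def
  proof (intro allI impI ballI)
    fix s j assume s: "(\<Sum>j\<in>?J. cscale (s j) (?v j)) = 0" and "j \<in> ?J"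
    then obtain \<mu> T b where j: "j = (\<mu>, T, b)" "\<mu> \<in> shapes k" "T \<in> ssyt \<mu> r d" "b \<in> B \<mu>" by auto
    have "?x s \<mu> T = 0"
      by (rule fill_combination_inj[where x = "?x s" and r = r and d = d, OF x _ j(2,3)]) (use s split[of s] in simp)
    thus "s j = 0" using indep_famD[OF indep_fam_id_basis[OF B(1)[of \<mu>] B(3)[of \<mu>]], of "\<lambda>b. s (\<mu>, T, b)" b] j by simp
  qed
  have wact_M: "wact (app g) p \<in> ?M" if "g \<in> symb k" "p \<in> ?M" for g p
  proof
    show "keys (wact (app g) p) \<subseteq> words r d k"
    proof
      fix u assume "u \<in> keys (wact (app g) p)"
      hence "u \<circ> app g \<in> words r d k" using that(2) by (auto simp: in_keys_iff lookup_wact)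
      hence "(u \<circ> app g) \<circ> inv (app g) \<in> words r d k" by (rule words_inv_app[OF _ that(1)])
      moreover have "(u \<circ> app g) \<circ> inv (app g) = u" by (auto simp: fun_eq_iff)
      ultimately show "u \<in> words r d k" by simp
    qed
  qed
  have wm_M: "wm a p \<in> ?M" if "a \<in> galgs k" "p \<in> ?M" for a p
    using wrep.mact_closed[OF subspace_supported _ that] wact_M perms_eq_app by blast
  have im: "?v ` ?J \<subseteq> ?M"
  proof (rule image_subsetI)
    fix j assume "j \<in> ?J"
    then obtain \<mu> T b where j: "j = (\<mu>, T, b)" "\<mu> \<in> shapes k" "T \<in> ssyt \<mu> r d" "b \<in> B \<mu>" by auto
    have "wm b (?f \<mu> T) \<in> ?M"
    proof (rule wm_M)
      show "b \<in> galgs k" using yideal_galgs B(2) j(4) by blast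
    qed (use fill_words[OF j(2,3)] in simp)
    thus "?v j \<in> ?M" unfolding j(1) by simp
  qed
  have "cvec.dim ?M = card (words r d k)" by (rule dim_supported[OF finite_words])
  also have "\<dots> = (\<Sum>\<mu>\<in>shapes k. kostka \<mu> r d * kostka \<mu> k (\<lambda>_. 1))" by (rule sum_kostka_standard[symmetric])
  also have "\<dots> \<le> (\<Sum>\<mu>\<in>shapes k. kostka \<mu> r d * cvec.dim (yideal k \<mu>))"
    by (intro sum_mono mult_left_mono dim_yideal_ge) auto
  also have "\<dots> = card ?J"
    using finT B(1) by (subst card_SigmaI) (auto simp: card_cartesian_product kostka_def B(4))
  finally have le: "cvec.dim ?M \<le> card ?J" .
  have fdM: "fd ?M" by (rule fd_supported[OF finite_words]) auto
  have wM: "Poly_Mapping.single w 1 \<in> ?M" using w by auto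
  obtain s where s: "Poly_Mapping.single w 1 = (\<Sum>j\<in>?J. cscale (s j) (?v j))"
    by (rule indep_fam_spans[OF finJ ind im fdM subspace_supported le wM])
  show ?thesis by (rule that[of "?x s", OF x s[unfolded split]])
qed

text \<open>The coefficients of \<open>z\<close> applied to \<open>w\<close> are the sums of
  \<open>z\<close> over left cosets of the stabilizer of \<open>w\<close>, and so are those of
  \<open>z * symz k w\<close>. A relation satisfied by a word thus holds for every vector invariant
  under its stabilizer, in any representation.\<close>

lemma wm_stab_zero:
  assumes z: "z \<in> galgs k" and w: "w \<in> extensional {..<k}"
    and 0: "wm z (Poly_Mapping.single w 1) = 0"
  shows "z * symz k w = 0"
proof (rule poly_mapping_eqI)
  fix g
  have "lookup (z * symz k w) g = (\<Sum>h\<in>stab k w. lookup z (g - h))"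
    unfolding symz_def sum_distrib_left lookup_sum lookup_mult_el ..
  also have "\<dots> = 0"
  proof (cases "g \<in> symb k")
    case True
    \<comment> \<open>As \<open>h\<close> runs through the stabilizer, \<open>g - h\<close> runs
      through the elements that carry \<open>w\<close> to the same word as \<open>g\<close>.\<close>
    have "(\<Sum>h\<in>stab k w. lookup z (g - h)) = (\<Sum>h\<in>{h \<in> symb k. w \<circ> inv (app h) = w \<circ> inv (app g)}. lookup z h)"
    proof (rule sum.reindex_bij_witness[of _ "\<lambda>h. - h + g" "\<lambda>h. g - h"])
      fix h assume h: "h \<in> stab k w"
      have hs: "h \<in> symb k" using stab_symb[OF h] .
      have wh: "w (app h a) = w a" for a
        using h symb_fix[OF hs, of a] unfolding stab_def by (cases "a < k") auto
      show "g - h \<in> {h \<in> symb k. w \<circ> inv (app h) = w \<circ> inv (app g)}"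
      proof (intro CollectI conjI)
        show "g - h \<in> symb k" using True hs by simp
        show "w \<circ> inv (app (g - h)) = w \<circ> inv (app g)"
        proof
          fix a
          have "inv (app (g - h)) a = app (h - g) a" by (metis app_simps(3) minus_diff_eq)
          thus "(w \<circ> inv (app (g - h))) a = (w \<circ> inv (app g)) a" by (simp add: wh del: app_diff) (simp add: wh)
        qed
      qed
      show "- (g - h) + g = h" by (simp add: diff_conv_add_uminus minus_add add.assoc del: add_uminus_conv_diff)
    next
      fix h assume "h \<in> {h \<in> symb k. w \<circ> inv (app h) = w \<circ> inv (app g)}"
      hence h: "h \<in> symb k" "w \<circ> inv (app h) = w \<circ> inv (app g)" by auto
      show "- h + g \<in> stab k w" unfolding stab_def
      proof (intro CollectI conjI allI impI)
        show "- h + g \<in> symb k" using h True by simp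
        fix a
        show "w (app (- h + g) a) = w a" using fun_cong[OF h(2), of "app g a"] by simp
      qed
      show "g - (- h + g) = h" by (simp add: diff_conv_add_uminus minus_add add.assoc[symmetric] del: add_uminus_conv_diff)
    qed simp
    also have "\<dots> = (\<Sum>h\<in>symb k. if w \<circ> inv (app h) = w \<circ> inv (app g) then lookup z h else 0)"
      by (rule sum.inter_filter) simp
    also have "\<dots> = lookup (wm z (Poly_Mapping.single w 1)) (w \<circ> inv (app g))"
      using z unfolding galgs_def
      by (simp add: wrep.mact_superset[of "symb k"] lookup_sum wact_single)
         (intro sum.cong refl, simp add: lookup_single when_def)
    finally show ?thesis using 0 by simp
  next
    case False
    have "lookup z (g - h) = 0" if "h \<in> stab k w" for h
    proof (rule ccontr)
      assume "lookup z (g - h) \<noteq> 0"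
      hence "g - h \<in> symb k" using z unfolding galgs_def by (auto simp: in_keys_iff)
      hence "(g - h) + h \<in> symb k" using stab_symb[OF that] symb_closed(2) by blast
      thus False using False by simp
    qed
    thus ?thesis by (simp add: sum.neutral)
  qed
  finally show "lookup (z * symz k w) g = lookup 0 g" by simp
qed

context perm_rep
begin

text \<open>The invariants correspond to homomorphisms into \<open>N\<close> from the module of
  words of content \<open>d\<close>, which is a sum of ideals, one for each semistandard tableau. A
  homomorphism from the ideal of \<open>\<mu>\<close> amounts to a vector in the image of
  \<open>N\<close> under \<open>young k \<mu>\<close>. The proof writes this out with the
  coefficients \<open>y\<close> that express \<open>w\<close> through tableau words and the
  permutations \<open>g\<close> that carry \<open>w\<close> to these words.\<close>

theorem dim_invariants:
  assumes N: "cvec.subspace N" "fd N" "\<And>\<pi> v. \<pi> \<in> perms k \<Longrightarrow> v \<in> N \<Longrightarrow> act \<pi> v \<in> N"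
    and w: "w \<in> words r d k"
  shows "cvec.dim {v \<in> N. \<forall>g\<in>stab k w. act (app g) v = v} =
    (\<Sum>\<mu>\<in>shapes k. kostka \<mu> r d * cvec.dim (mact (young k \<mu>) ` N))"
proof -
  let ?V = "{v \<in> N. \<forall>g\<in>stab k w. act (app g) v = v}"
  let ?e = "symz k w" and ?n = "of_nat (card (stab k w)) :: complex"
  let ?f = "\<lambda>\<mu> T. Poly_Mapping.single (fill k \<mu> T) (1::complex)"
  have n0: "?n \<noteq> 0" using card_stab_pos[of k w] unfolding of_nat_eq_0_iff by linarith
  have wext: "w \<in> extensional {..<k}" using w unfolding words_def by (auto simp: PiE_iff)
  obtain y where y: "\<And>\<mu> T. \<mu> \<in> shapes k \<Longrightarrow> T \<in> ssyt \<mu> r d \<Longrightarrow> y \<mu> T \<in> yideal k \<mu>"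
    "Poly_Mapping.single w 1 = (\<Sum>\<mu>\<in>shapes k. \<Sum>T\<in>ssyt \<mu> r d. wm (y \<mu> T) (?f \<mu> T))"
    using word_is_fill_combination[OF w] by blast
  have "\<forall>\<mu> T. \<exists>g. \<mu> \<in> shapes k \<longrightarrow> T \<in> ssyt \<mu> r d \<longrightarrow> g \<in> symb k \<and> w \<circ> inv (app g) = fill k \<mu> T"
    using words_transitive[OF w fill_words] by metis
  then obtain g where g: "\<And>\<mu> T. \<mu> \<in> shapes k \<Longrightarrow> T \<in> ssyt \<mu> r d \<Longrightarrow> g \<mu> T \<in> symb k"
    "\<And>\<mu> T. \<mu> \<in> shapes k \<Longrightarrow> T \<in> ssyt \<mu> r d \<Longrightarrow> w \<circ> inv (app (g \<mu> T)) = fill k \<mu> T" by metis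
  have "\<forall>\<mu>. \<exists>c. \<mu> \<in> shapes k \<longrightarrow> c \<noteq> 0 \<and> young k \<mu> * young k \<mu> = cscale c (young k \<mu>)"
    using young_square by metis
  then obtain c where c: "\<And>\<mu>. \<mu> \<in> shapes k \<Longrightarrow> c \<mu> \<noteq> 0"
    "\<And>\<mu>. \<mu> \<in> shapes k \<Longrightarrow> young k \<mu> * young k \<mu> = cscale (c \<mu>) (young k \<mu>)" by metis
  have wmg: "wm (el (g \<mu> T)) (Poly_Mapping.single w 1) = ?f \<mu> T" if "\<mu> \<in> shapes k" "T \<in> ssyt \<mu> r d" for \<mu> T
    using g[OF that] by (simp add: wrep.mact_el wact_single)
  have wme: "wm ?e (Poly_Mapping.single w 1) = cscale ?n (Poly_Mapping.single w 1)"
  proof -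
    have "w \<circ> inv (app h) = w" if h: "h \<in> stab k w" for h
    proof
      fix a show "(w \<circ> inv (app h)) a = w a"
        using stab_closed(3)[OF h] symb_fix[OF stab_symb[OF stab_closed(3)[OF h]], of a]
        unfolding stab_def by (cases "a < k") auto
    qed
    hence "wm ?e (Poly_Mapping.single w 1) = (\<Sum>h\<in>stab k w. Poly_Mapping.single w 1)"
      unfolding symz_def wrep.mact_sum_left by (intro sum.cong refl) (simp add: wrep.mact_el wact_single)
    thus ?thesis by (simp only: cvec.sum_constant_scale)
  qed
  text \<open>Comparing coefficients in the unique expansion of a word, the maps below are mutually inverse.\<close>
  have key: "young k \<nu> * el (g \<nu> U) * ?e * y \<mu> T = (if (\<mu>, T) = (\<nu>, U) then cscale ?n (young k \<nu>) else 0)"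
    if \<nu>: "\<nu> \<in> shapes k" and U: "U \<in> ssyt \<nu> r d" and \<mu>: "\<mu> \<in> shapes k" and T: "T \<in> ssyt \<mu> r d" for \<mu> \<nu> T U
  proof -
    define a where "a = young k \<nu> * el (g \<nu> U) * ?e"
    have a: "a \<in> galgs k" unfolding a_def using g(1)[OF \<nu> U] by simp
    \<comment> \<open>The difference of two expansions of \<open>a\<close> applied to
      \<open>w\<close>: one obtained from the expansion of \<open>w\<close>, the other computed
      directly from the definition of \<open>a\<close>. \<open>fill_combination_inj\<close> makes it
      vanish.\<close>
    define x where "x = (\<lambda>\<mu> T. a * y \<mu> T - (if (\<mu>, T) = (\<nu>, U) then cscale ?n (young k \<nu>) else 0))"
    have xY: "x \<mu> T \<in> yideal k \<mu>" if "\<mu> \<in> shapes k" "T \<in> ssyt \<mu> r d" for \<mu> T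
      unfolding x_def using yideal_mult[OF a y(1)[OF that]] yideal_galgs_young[of 1 k \<nu>] yideal_subspace[of k]
      by (auto intro!: cvec.subspace_diff cvec.subspace_scale cvec.subspace_0)
    have "(\<Sum>\<mu>\<in>shapes k. \<Sum>T\<in>ssyt \<mu> r d. wm (x \<mu> T) (?f \<mu> T)) =
      (\<Sum>\<mu>\<in>shapes k. \<Sum>T\<in>ssyt \<mu> r d. wm a (wm (y \<mu> T) (?f \<mu> T))) -
      (\<Sum>\<mu>\<in>shapes k. \<Sum>T\<in>ssyt \<mu> r d. if (\<mu>, T) = (\<nu>, U) then wm (cscale ?n (young k \<nu>)) (?f \<nu> U) else 0)"
      unfolding sum_subtractf[symmetric] x_def wrep.mact_diff_left wrep.mact_mult
      by (intro sum.cong refl) (auto simp: wrep.mact_0_left)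
    also have "(\<Sum>\<mu>\<in>shapes k. \<Sum>T\<in>ssyt \<mu> r d. wm a (wm (y \<mu> T) (?f \<mu> T))) = wm a (Poly_Mapping.single w 1)"
      unfolding y(2) wrep.mact_sum ..
    also have "\<dots> = cscale ?n (wm (young k \<nu>) (?f \<nu> U))"
      unfolding a_def wrep.mact_mult wme by (simp add: wrep.mact_scale wmg[OF \<nu> U])
    also have "(\<Sum>\<mu>\<in>shapes k. \<Sum>T\<in>ssyt \<mu> r d. if (\<mu>, T) = (\<nu>, U) then wm (cscale ?n (young k \<nu>)) (?f \<nu> U) else 0) =
      (\<Sum>\<mu>\<in>shapes k. if \<mu> = \<nu> then wm (cscale ?n (young k \<nu>)) (?f \<nu> U) else 0)"
    proof (intro sum.cong refl)
      fix \<mu> assume "\<mu> \<in> shapes k"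
      show "(\<Sum>T\<in>ssyt \<mu> r d. if (\<mu>, T) = (\<nu>, U) then wm (cscale ?n (young k \<nu>)) (?f \<nu> U) else 0) =
        (if \<mu> = \<nu> then wm (cscale ?n (young k \<nu>)) (?f \<nu> U) else 0)"
        using U finite_ssyt[OF shapesD(1)[OF \<nu>], of r d] by (cases "\<mu> = \<nu>") auto
    qed
    also have "\<dots> = cscale ?n (wm (young k \<nu>) (?f \<nu> U))" using \<nu> by (simp add: wrep.mact_scale_left)
    finally have "(\<Sum>\<mu>\<in>shapes k. \<Sum>T\<in>ssyt \<mu> r d. wm (x \<mu> T) (?f \<mu> T)) = 0" by simp
    hence "x \<mu> T = 0" using fill_combination_inj[of k r d x \<mu> T] xY \<mu> T by blast
    thus ?thesis unfolding x_def a_def by simp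
  qed
  have closed: "mact a v \<in> N" if "a \<in> galgs k" "v \<in> N" for a v using mact_closed[OF N(1,3) that] .
  have mste: "mact ?e v = cscale ?n v" if "v \<in> ?V" for v
  proof -
    have "mact ?e v = (\<Sum>h\<in>stab k w. v)"
      unfolding symz_def mact_sum_left using that by (intro sum.cong refl) (simp add: mact_el)
    thus ?thesis by (simp only: cvec.sum_constant_scale)
  qed
  have recon: "(\<Sum>\<mu>\<in>shapes k. \<Sum>T\<in>ssyt \<mu> r d. mact (y \<mu> T * el (g \<mu> T)) v) = v" if v: "v \<in> ?V" for v
  proof -
    \<comment> \<open>The expansion of \<open>w\<close> says that \<open>z\<close> annihilates
      \<open>w\<close>; \<open>wm_stab_zero\<close> transports this to the invariant vector
      \<open>v\<close>.\<close>
    define z where "z = (\<Sum>\<mu>\<in>shapes k. \<Sum>T\<in>ssyt \<mu> r d. y \<mu> T * el (g \<mu> T)) - 1"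
    have zg: "z \<in> galgs k" unfolding z_def
      using yideal_galgs[OF y(1)] g(1) by (intro cvec.subspace_diff cvec.subspace_sum galgs_subspace) auto
    have "wm z (Poly_Mapping.single w 1) =
      (\<Sum>\<mu>\<in>shapes k. \<Sum>T\<in>ssyt \<mu> r d. wm (y \<mu> T) (?f \<mu> T)) - Poly_Mapping.single w 1"
      unfolding z_def wrep.mact_diff_left wrep.mact_sum_left wrep.mact_1 wrep.mact_mult
      by (simp add: wmg cong: sum.cong)
    hence "wm z (Poly_Mapping.single w 1) = 0" using y(2) by simp
    from wm_stab_zero[OF zg wext this] have "mact z (mact ?e v) = 0"
      by (simp add: mact_mult[symmetric] mact_0_left)
    hence "mact z v = 0" using n0 unfolding mste[OF v] by (simp add: mact_scale)
    thus ?thesis unfolding z_def mact_diff_left mact_sum_left mact_1 by simp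
  qed
  let ?I = "Sigma (shapes k) (\<lambda>\<mu>. ssyt \<mu> r d)"
  let ?U = "\<lambda>(\<mu>, T::nat \<times> nat \<Rightarrow> nat). mact (young k \<mu>) ` N"
  \<comment> \<open>The scalar compensates for \<open>c \<mu>\<close>, by which the Young
    symmetrizer multiplies its image, and for the order of the stabilizer, by which
    \<open>?e\<close> multiplies invariant vectors.\<close>
  let ?F = "\<lambda>(\<mu>, T) u. mact (cscale (1 / (c \<mu> * ?n)) (?e * y \<mu> T)) u"
  let ?G = "\<lambda>(\<mu>, T) v. mact (young k \<mu> * el (g \<mu> T)) v"
  have finT: "finite (ssyt \<mu> r d)" if "\<mu> \<in> shapes k" for \<mu> using that finite_ssyt shapesD(1) by blast
  have "cvec.dim ?V = (\<Sum>i\<in>?I. cvec.dim (?U i))"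
  proof (rule dim_direct[where f = ?F and g = ?G])
    show "finite ?I" using finT by auto
    show "cvec.subspace (?U i)" if "i \<in> ?I" for i
      using cpair.linear_subspace_image[OF mact_linear N(1)] by (auto split: prod.splits)
    show "fd (?U i)" if "i \<in> ?I" for i
      by (rule fd_subset[OF N(2)]) (auto split: prod.splits intro: closed)
    show "clinear (?F i)" "clinear (?G i)" if "i \<in> ?I" for i
      using mact_linear by (auto split: prod.splits)
    show "?F i u \<in> ?V" if "i \<in> ?I" "u \<in> ?U i" for i u
    proof -
      obtain \<mu> T where i: "i = (\<mu>, T)" "\<mu> \<in> shapes k" "T \<in> ssyt \<mu> r d" using \<open>i \<in> ?I\<close> by blast
      have uN: "u \<in> N" using that(2) closed unfolding i(1) by auto
      have yg: "y \<mu> T \<in> galgs k" using yideal_galgs[OF y(1)[OF i(2,3)]] .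
      have "?F i u = cscale (1 / (c \<mu> * ?n)) (mact (?e * y \<mu> T) u)" unfolding i(1) by (simp add: mact_scale_left)
      moreover have "mact (?e * y \<mu> T) u \<in> N" using closed uN yg by simp
      moreover have "act (app h) (mact (?e * y \<mu> T) u) = mact (?e * y \<mu> T) u" if "h \<in> stab k w" for h
        by (simp add: mact_el[symmetric] mact_mult[symmetric] mult.assoc[symmetric] el_symz[OF that])
      ultimately show ?thesis using N(1) by (simp add: cvec.subspace_scale act_scale)
    qed
    show "?G i v \<in> ?U i" if "i \<in> ?I" "v \<in> ?V" for i v
      using that g(1) by (auto simp: mact_mult intro!: imageI closed)
    show "?G i (?F j u) = (if i = j then u else 0)" if I: "i \<in> ?I" "j \<in> ?I" "u \<in> ?U j" for i j u
    proof -
      obtain \<nu> U where i: "i = (\<nu>, U)" "\<nu> \<in> shapes k" "U \<in> ssyt \<nu> r d" using \<open>i \<in> ?I\<close> by blast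
      obtain \<mu> T where j: "j = (\<mu>, T)" "\<mu> \<in> shapes k" "T \<in> ssyt \<mu> r d" using \<open>j \<in> ?I\<close> by blast
      obtain t where t: "u = mact (young k \<mu>) t" using I(3) unfolding j(1) by auto
      have "?G i (?F j u) = cscale (1 / (c \<mu> * ?n)) (mact (young k \<nu> * el (g \<nu> U) * ?e * y \<mu> T) u)"
        unfolding i(1) j(1) by (simp add: mact_scale_left mact_scale mact_mult)
      also have "\<dots> = (if i = j then u else 0)"
      proof (cases "i = j")
        case True
        have "mact (young k \<mu>) u = cscale (c \<mu>) u"
          unfolding t mact_mult[symmetric] c(2)[OF j(2)] mact_scale_left ..
        thus ?thesis using True key[OF i(2,3) j(2,3)] c(1)[OF j(2)] n0 i(1) j(1)
          by (simp add: mact_scale_left)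
      next
        case False
        thus ?thesis using key[OF i(2,3) j(2,3)] i(1) j(1) by (auto simp: mact_0_left)
      qed
      finally show ?thesis .
    qed
    show "v = (\<Sum>i\<in>?I. ?F i (?G i v))" if v: "v \<in> ?V" for v
    proof -
      have "?F (\<mu>, T) (?G (\<mu>, T) v) = cscale (1 / ?n) (mact ?e (mact (y \<mu> T * el (g \<mu> T)) v))"
        if i: "\<mu> \<in> shapes k" "T \<in> ssyt \<mu> r d" for \<mu> T
      proof -
        have "?F (\<mu>, T) (?G (\<mu>, T) v) = cscale (1 / (c \<mu> * ?n)) (mact (?e * (y \<mu> T * young k \<mu>) * el (g \<mu> T)) v)"
          by (simp add: mact_scale_left mact_mult)
        also have "\<dots> = cscale (1 / ?n) (mact ?e (mact (y \<mu> T * el (g \<mu> T)) v))"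
          unfolding yideal_young[OF i(1) c(2)[OF i(1)] y(1)[OF i]] using c(1)[OF i(1)]
          by (simp add: cscale_mult_left cscale_mult_right mact_scale_left mact_mult mact_scale)
        finally show ?thesis .
      qed
      hence "(\<Sum>i\<in>?I. ?F i (?G i v)) =
        (\<Sum>i\<in>?I. cscale (1 / ?n) (mact ?e (mact ((\<lambda>(\<mu>, T). y \<mu> T * el (g \<mu> T)) i) v)))"
        by (intro sum.cong refl) auto
      also have "\<dots> = cscale (1 / ?n) (mact ?e (\<Sum>i\<in>?I. mact ((\<lambda>(\<mu>, T). y \<mu> T * el (g \<mu> T)) i) v))"
        by (simp only: mact_sum cvec.scale_sum_right)
      also have "(\<Sum>i\<in>?I. mact ((\<lambda>(\<mu>, T). y \<mu> T * el (g \<mu> T)) i) v) = v"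
        using recon[OF v] finT by (subst (asm) sum.Sigma) (auto simp: split_def)
      also have "cscale (1 / ?n) (mact ?e v) = v" using mste[OF v] n0 by simp
      finally show ?thesis by simp
    qed
  qed
  also have "\<dots> = (\<Sum>\<mu>\<in>shapes k. \<Sum>T\<in>ssyt \<mu> r d. cvec.dim (mact (young k \<mu>) ` N))"
    using finT by (subst sum.Sigma) (auto simp: split_def)
  also have "\<dots> = (\<Sum>\<mu>\<in>shapes k. kostka \<mu> r d * cvec.dim (mact (young k \<mu>) ` N))"
    by (simp add: kostka_def)
  finally show ?thesis .
qed

end

text \<open>Rows are counted from 0, so \<open>\<mu> n \<noteq> 0\<close> gives at least
  \<open>n + 1\<close> rows. Two positions of the first column then carry the same letter, and their
  transposition fixes the word but reverses the sign of the antisymmetrizer.\<close>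

lemma wm_young_eq_0:
  assumes \<mu>: "\<mu> \<in> shapes k" and n: "\<mu> n \<noteq> 0"
    and p: "\<And>w a. w \<in> keys p \<Longrightarrow> a < k \<Longrightarrow> w a < n"
  shows "wm (young k \<mu>) p = 0"
proof -
  have alt: "wm (altz k (tcol \<mu>)) (Poly_Mapping.single w 1) = 0" if w: "\<And>a. a < k \<Longrightarrow> w a < n" for w
  proof -
    let ?C = "{a. a < k \<and> tcol \<mu> a = 0}"
    have "{..n} \<subseteq> trow \<mu> ` ?C"
    proof
      fix i assume "i \<in> {..n}"
      hence "0 < \<mu> i" using n is_part_antimono[OF shapesD(1)[OF \<mu>], of i n] by simp
      then obtain a where "a < k" "trow \<mu> a = i" "tcol \<mu> a = 0" using tcell_surj[OF \<mu>] by blast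
      thus "i \<in> trow \<mu> ` ?C" by auto
    qed
    hence "card {..n} \<le> card ?C" by (intro surj_card_le) auto
    moreover have "w ` ?C \<subseteq> {..<n}" using w by auto
    hence "card (w ` ?C) \<le> card {..<n}" by (intro card_mono) auto
    ultimately have "card (w ` ?C) < card ?C" by simp
    hence "\<not> inj_on w ?C" by (rule pigeonhole)
    then obtain a b where ab: "a < k" "b < k" "tcol \<mu> a = tcol \<mu> b" "w a = w b" "a \<noteq> b"
      unfolding inj_on_def by auto
    let ?t = "transp a b"
    have t: "?t \<in> stab k (tcol \<mu>)" using transp_stab ab by blast
    have "w \<circ> inv (app ?t) = w" using ab by (auto simp: transpose_def fun_eq_iff)
    hence wt: "wm (el ?t) (Poly_Mapping.single w 1) = Poly_Mapping.single w 1"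
      by (simp only: wrep.mact_el wact_single)
    have "wm (altz k (tcol \<mu>)) (Poly_Mapping.single w 1) =
      wm (altz k (tcol \<mu>) * el ?t) (Poly_Mapping.single w 1)"
      unfolding wrep.mact_mult wt ..
    also have "\<dots> = cscale (- 1) (wm (altz k (tcol \<mu>)) (Poly_Mapping.single w 1))"
      unfolding altz_el[OF t] sgnb_transp[OF ab(5)] wrep.mact_scale_left ..
    finally show ?thesis by (rule eq_neg_imp_zero)
  qed
  let ?P = "{p :: (nat \<Rightarrow> nat) \<Rightarrow>\<^sub>0 complex. keys p \<subseteq> {w. \<forall>a<k. w a < n}}"
  have "wm (symz k (trow \<mu>)) p \<in> ?P"
  proof (rule wrep.mact_closed[OF subspace_supported])
    show "symz k (trow \<mu>) \<in> galgs k" by simp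
    show "p \<in> ?P" using p by auto
    fix \<pi> q assume \<pi>: "\<pi> \<in> perms k" and q: "q \<in> ?P"
    show "wact \<pi> q \<in> ?P"
    proof (intro CollectI subsetI allI impI)
      fix u a assume "u \<in> keys (wact \<pi> q)" "a < k"
      hence "u \<circ> \<pi> \<in> keys q" using \<pi> by (simp add: in_keys_iff lookup_wact permutes_bij)
      moreover have "inv \<pi> a < k" using \<open>a < k\<close> \<pi> permutes_in_image[OF permutes_inv, of \<pi> "{..<k}" a] by simp
      ultimately have "(u \<circ> \<pi>) (inv \<pi> a) < n" using q by blast
      thus "u a < n" using \<pi> by (simp add: permutes_inverses)
    qed
  qed
  hence k: "\<And>w a. w \<in> keys (wm (symz k (trow \<mu>)) p) \<Longrightarrow> a < k \<Longrightarrow> w a < n" by blast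
  let ?q = "wm (symz k (trow \<mu>)) p"
  have "wm (young k \<mu>) p = wm (altz k (tcol \<mu>)) (\<Sum>w\<in>keys ?q. cscale (lookup ?q w) (Poly_Mapping.single w 1))"
    using poly_mapping_sum_single[of "keys ?q" ?q] by (simp add: young_def wrep.mact_mult cscale_single)
  also have "\<dots> = 0"
    unfolding wrep.mact_sum wrep.mact_scale using alt k by (intro sum.neutral) auto
  finally show ?thesis .
qed

section \<open>Harmonic functions on words\<close>

text \<open>
  A word of length \<open>k\<close> in \<open>n\<close> letters stands for a multilinear monomial: the letter at position \<open>a\<close> is
  the column of the variable taken from row \<open>a\<close>.  Words have the value \<open>n\<close>, fixed by all permutations of the letters, beyond \<open>k\<close>.
\<close>

definition lwords :: "nat \<Rightarrow> nat \<Rightarrow> (nat \<Rightarrow> nat) set" where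
  "lwords n k = {w. (\<forall>a<k. w a < n) \<and> (\<forall>a\<ge>k. w a = n)}"

definition upd :: "nat set \<Rightarrow> (nat \<Rightarrow> nat) \<Rightarrow> (nat \<Rightarrow> nat) \<Rightarrow> nat \<Rightarrow> nat" where
  "upd A \<sigma> w a = (if a \<in> A then \<sigma> (w a) else w a)"

text \<open>Harmonicity in polarized form: the positions in \<open>A\<close> carry the monomial
  \<open>b\<close> moved by the group, the other positions carry the shift \<open>m\<close>, and
  \<open>A \<noteq> {}\<close> stands for \<open>b \<noteq> 0\<close>.\<close>

definition hwords :: "nat \<Rightarrow> nat \<Rightarrow> ((nat \<Rightarrow> nat) \<Rightarrow>\<^sub>0 complex) set" where
  "hwords n k = {c. keys c \<subseteq> lwords n k \<and>
     (\<forall>A w. A \<subseteq> {..<k} \<longrightarrow> A \<noteq> {} \<longrightarrow> w \<in> lwords n k \<longrightarrow> (\<Sum>\<sigma>\<in>perms n. lookup c (upd A \<sigma> w)) = 0)}"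

lemma finite_lwords: "finite (lwords n k)"
  by (rule finite_subset[OF _ finite_set_of_finite_funs[of "{..<k}" "{..<n}" n]])
     (auto simp: lwords_def)

lemma perms_less [simp]: "\<sigma> \<in> perms n \<Longrightarrow> \<sigma> x < n \<longleftrightarrow> x < n"
  using permutes_in_image[of \<sigma> "{..<n}" x] by simp

lemma perms_fix [simp]: "\<sigma> \<in> perms n \<Longrightarrow> \<sigma> n = n"
  by (simp add: permutes_def)

lemma perms_inv: "\<sigma> \<in> perms n \<Longrightarrow> inv \<sigma> \<in> perms n"
  by (simp add: permutes_inv)

lemma lwords_comp: "\<sigma> \<in> perms n \<Longrightarrow> w \<in> lwords n k \<Longrightarrow> \<sigma> \<circ> w \<in> lwords n k"
  unfolding lwords_def by auto

lemma lwords_comp_right: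
  assumes "\<pi> \<in> perms k" "w \<in> lwords n k"
  shows "w \<circ> \<pi> \<in> lwords n k"
proof -
  have "\<pi> a \<ge> k" if "a \<ge> k" for a using assms(1) that by (simp add: not_less[symmetric])
  thus ?thesis using assms unfolding lwords_def by auto
qed

lemma lwords_upd: "\<sigma> \<in> perms n \<Longrightarrow> w \<in> lwords n k \<Longrightarrow> upd A \<sigma> w \<in> lwords n k"
  unfolding lwords_def upd_def by auto

definition lact :: "(nat \<Rightarrow> nat) \<Rightarrow> ((nat \<Rightarrow> nat) \<Rightarrow>\<^sub>0 complex) \<Rightarrow> ((nat \<Rightarrow> nat) \<Rightarrow>\<^sub>0 complex)" where
  "lact \<sigma> = pushforward (\<lambda>w. \<sigma> \<circ> w)"

interpretation lkey: key_action "\<lambda>\<sigma> w. \<sigma> \<circ> (w :: nat \<Rightarrow> nat)"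
  by unfold_locales (auto simp: o_assoc)

interpretation lrep: perm_rep lact
  unfolding lact_def by (rule lkey.perm_rep)

lemma lookup_lact: "bij \<sigma> \<Longrightarrow> lookup (lact \<sigma> p) w = lookup p (inv \<sigma> \<circ> w)"
  unfolding lact_def by (rule lkey.lookup_push)

lemma lact_wact: "bij \<sigma> \<Longrightarrow> bij \<pi> \<Longrightarrow> lact \<sigma> (wact \<pi> p) = wact \<pi> (lact \<sigma> p)"
  by (rule poly_mapping_eqI) (simp add: lookup_lact lookup_wact o_assoc)

lemma subspace_hwords: "cvec.subspace (hwords n k)"
proof (rule cvec.subspaceI)
  show "0 \<in> hwords n k" unfolding hwords_def by simp
  fix x y assume x: "x \<in> hwords n k" and y: "y \<in> hwords n k"
  show "x + y \<in> hwords n k" unfolding hwords_def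
  proof (intro CollectI conjI allI impI)
    show "keys (x + y) \<subseteq> lwords n k"
      using x y Poly_Mapping.keys_add[of x y] unfolding hwords_def by blast
    fix A w assume "A \<subseteq> {..<k}" "A \<noteq> {}" "w \<in> lwords n k"
    hence "(\<Sum>\<sigma>\<in>perms n. lookup x (upd A \<sigma> w)) = 0" "(\<Sum>\<sigma>\<in>perms n. lookup y (upd A \<sigma> w)) = 0"
      using x y unfolding hwords_def by blast+
    thus "(\<Sum>\<sigma>\<in>perms n. lookup (x + y) (upd A \<sigma> w)) = 0" by (simp add: lookup_add sum.distrib)
  qed
next
  fix c x assume x: "x \<in> hwords n k"
  show "cscale c x \<in> hwords n k" unfolding hwords_def
  proof (intro CollectI conjI allI impI)
    show "keys (cscale c x) \<subseteq> lwords n k" using x unfolding hwords_def by (auto simp: in_keys_iff)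
    fix A w assume "A \<subseteq> {..<k}" "A \<noteq> {}" "w \<in> lwords n k"
    hence "(\<Sum>\<sigma>\<in>perms n. lookup x (upd A \<sigma> w)) = 0" using x unfolding hwords_def by blast
    thus "(\<Sum>\<sigma>\<in>perms n. lookup (cscale c x) (upd A \<sigma> w)) = 0" by (simp add: sum_distrib_left[symmetric])
  qed
qed

lemma fd_hwords: "fd (hwords n k)"
  by (rule fd_supported[OF finite_lwords]) (auto simp: hwords_def)

lemma wact_hwords:
  assumes \<pi>: "\<pi> \<in> perms k" and c: "c \<in> hwords n k"
  shows "wact \<pi> c \<in> hwords n k"
proof -
  have b: "bij \<pi>" using \<pi> by (rule perms_bij)
  have "(\<Sum>\<sigma>\<in>perms n. lookup (wact \<pi> c) (upd A \<sigma> w)) = 0"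
    if A: "A \<subseteq> {..<k}" "A \<noteq> {}" and w: "w \<in> lwords n k" for A w
  proof -
    let ?A = "{a. \<pi> a \<in> A}"
    have "upd A \<sigma> w \<circ> \<pi> = upd ?A \<sigma> (w \<circ> \<pi>)" for \<sigma> by (auto simp: upd_def)
    hence "(\<Sum>\<sigma>\<in>perms n. lookup (wact \<pi> c) (upd A \<sigma> w)) = (\<Sum>\<sigma>\<in>perms n. lookup c (upd ?A \<sigma> (w \<circ> \<pi>)))"
      by (simp add: lookup_wact[OF b])
    moreover have "?A \<subseteq> {..<k}" using A(1) perms_less[OF \<pi>] by blast
    moreover have "?A \<noteq> {}"
    proof -
      obtain x where "x \<in> A" using A(2) by blast
      hence "inv \<pi> x \<in> ?A" using b by (simp add: bij_is_surj surj_f_inv_f)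
      thus ?thesis by blast
    qed
    ultimately show ?thesis using c lwords_comp_right[OF \<pi> w] unfolding hwords_def by simp
  qed
  moreover have "keys (wact \<pi> c) \<subseteq> lwords n k"
  proof
    fix u assume "u \<in> keys (wact \<pi> c)"
    hence "u \<circ> \<pi> \<in> lwords n k" using c by (auto simp: hwords_def in_keys_iff lookup_wact[OF b])
    from lwords_comp_right[OF perms_inv[OF \<pi>] this] show "u \<in> lwords n k"
      using b by (simp add: o_assoc[symmetric] bij_is_surj surj_iff[THEN iffD1])
  qed
  ultimately show ?thesis unfolding hwords_def by blast
qed

subsection \<open>The degree bound\<close>

lemma sum_lessThan_choose: "(\<Sum>i<n. i) = n choose 2"
  by (induction n) (auto simp: numeral_2_eq_2)

text \<open>If each letter \<open>i\<close> occurred at most \<open>n - 1 - i\<close> times, the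
  length would be at most \<open>n choose 2\<close>.\<close>

lemma pigeonhole_letters:
  assumes w: "w \<in> lwords n k" and k: "k > n choose 2"
  obtains i where "i < n" "n - i \<le> card {a. a < k \<and> w a = i}"
proof (rule ccontr)
  assume no: "\<not> thesis"
  note wit = that
  have "card {a. a < k \<and> w a = i} \<le> n - Suc i" if "i < n" for i
    using wit[OF that] no by linarith
  hence "(\<Sum>i<n. card {a. a < k \<and> w a = i}) \<le> (\<Sum>i<n. n - Suc i)" by (intro sum_mono) auto
  also have "\<dots> = n choose 2" using sum.nat_diff_reindex[of "\<lambda>i. i" n] sum_lessThan_choose by simp
  finally have "(\<Sum>i<n. card {a. a < k \<and> w a = i}) \<le> n choose 2" .
  moreover have "card {a. a < k \<and> True} = (\<Sum>i<n. card {a. a < k \<and> True \<and> w a = i})"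
    by (rule card_by_column) (use w in \<open>auto simp: lwords_def\<close>)
  ultimately show False using k by simp
qed

text \<open>Sums over injective fillings are polarized elementary symmetric functions in the letters
  of \<open>Q\<close>, up to a factorial.\<close>

definition injs :: "nat set \<Rightarrow> nat set \<Rightarrow> (nat \<Rightarrow> nat) \<Rightarrow> (nat \<Rightarrow> nat) set" where
  "injs B Q u = {v. (\<forall>a. a \<notin> B \<longrightarrow> v a = u a) \<and> inj_on v B \<and> v ` B \<subseteq> Q}"

lemma finite_injs:
  assumes "finite B" "finite Q"
  shows "finite (injs B Q u)"
proof (rule inj_on_finite[of "\<lambda>v. restrict v B"])
  show "inj_on (\<lambda>v. restrict v B) (injs B Q u)"
  proof (rule inj_onI, rule ext)
    fix v v' a assume "v \<in> injs B Q u" "v' \<in> injs B Q u" "restrict v B = restrict v' B"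
    thus "v a = v' a" unfolding injs_def by (cases "a \<in> B") (auto dest: fun_cong[of _ _ a])
  qed
  show "(\<lambda>v. restrict v B) ` injs B Q u \<subseteq> B \<rightarrow>\<^sub>E Q" unfolding injs_def by auto
qed (use assms in \<open>auto intro: finite_PiE\<close>)

lemma injs_empty [simp]: "injs {} Q u = {u}"
  unfolding injs_def by auto

lemma extend_to_perm:
  assumes "finite B" "inj_on v B" "inj_on v' B" "v ` B \<subseteq> {..<n}" "v' ` B \<subseteq> {..<n}"
  obtains \<sigma> where "\<sigma> \<in> perms n" "\<And>a. a \<in> B \<Longrightarrow> \<sigma> (v a) = v' a"
proof -
  let ?f = "\<lambda>x. v' (the_inv_into B v x)"
  have 1: "bij_betw ?f (v ` B) (v' ` B)"
    using bij_betw_trans[OF bij_betw_the_inv_into[OF inj_on_imp_bij_betw[OF assms(2)]] inj_on_imp_bij_betw[OF assms(3)]]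
    by (simp add: comp_def)
  have "card ({..<n} - v ` B) = card ({..<n} - v' ` B)"
    using assms by (simp add: card_Diff_subset card_image)
  then obtain h where 2: "bij_betw h ({..<n} - v ` B) ({..<n} - v' ` B)"
    using finite_same_card_bij[of "{..<n} - v ` B" "{..<n} - v' ` B"] by auto
  let ?\<sigma> = "\<lambda>x. if x \<in> v ` B then ?f x else if x < n then h x else x"
  have "bij_betw ?\<sigma> (v ` B \<union> ({..<n} - v ` B)) (v' ` B \<union> ({..<n} - v' ` B))"
  proof (rule bij_betw_combine)
    show "bij_betw ?\<sigma> (v ` B) (v' ` B)" by (rule iffD1[OF bij_betw_cong 1]) auto
    show "bij_betw ?\<sigma> ({..<n} - v ` B) ({..<n} - v' ` B)" by (rule iffD1[OF bij_betw_cong 2]) auto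
  qed auto
  moreover have "v ` B \<union> ({..<n} - v ` B) = {..<n}" "v' ` B \<union> ({..<n} - v' ` B) = {..<n}" using assms(4,5) by auto
  ultimately have "bij_betw ?\<sigma> {..<n} {..<n}" by simp
  hence "?\<sigma> permutes {..<n}" by (rule bij_imp_permutes) (use assms(4) in auto)
  thus ?thesis using that[of ?\<sigma>] the_inv_into_f_f[OF assms(2)] by auto
qed

text \<open>From one injective filling \<open>v0\<close> the group reaches every injective filling
  of \<open>B\<close>, each equally often because the fibres are translates of one another. The
  defining relation of \<open>hwords\<close> at \<open>v0\<close> is therefore a multiple of the sum
  over injections.\<close>

lemma sum_injs_all_eq_0:
  assumes c: "c \<in> hwords n k" and B: "B \<subseteq> {..<k}" "B \<noteq> {}" "card B \<le> n" and u: "u \<in> lwords n k"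
  shows "(\<Sum>v\<in>injs B {..<n} u. lookup c v) = 0"
proof -
  have finB: "finite B" using B(1) finite_subset by blast
  have "\<exists>f. inj_on f B \<and> f ` B \<subseteq> {..<n}" using card_le_inj[OF finB, of "{..<n}"] B(3) by auto
  then obtain f where f: "inj_on f B" "f ` B \<subseteq> {..<n}" by blast
  define v0 where "v0 = (\<lambda>a. if a \<in> B then f a else u a)"
  have v0: "v0 \<in> injs B {..<n} u" unfolding injs_def v0_def using f by (auto simp: inj_on_def)
  have v0W: "v0 \<in> lwords n k" using f(2) u B(1) unfolding v0_def lwords_def by auto
  have u0: "upd B \<sigma> v0 \<in> injs B {..<n} u" if s: "\<sigma> \<in> perms n" for \<sigma>
  proof -
    have "inj \<sigma>" using perms_bij[OF s] by (rule bij_is_inj)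
    have v: "\<And>a. a \<notin> B \<Longrightarrow> v0 a = u a" "inj_on v0 B" "v0 ` B \<subseteq> {..<n}" using v0 unfolding injs_def by auto
    have "inj_on (\<sigma> \<circ> v0) B" using v(2) inj_on_subset[OF \<open>inj \<sigma>\<close>] by (intro comp_inj_on) auto
    hence "inj_on (upd B \<sigma> v0) B" by (rule inj_on_cong[THEN iffD1, rotated]) (simp add: upd_def)
    moreover have "upd B \<sigma> v0 ` B \<subseteq> {..<n}" using v(3) s by (auto simp: upd_def)
    ultimately show ?thesis using v(1) unfolding injs_def by (auto simp: upd_def)
  qed
  let ?fib = "\<lambda>v. {\<sigma> \<in> perms n. upd B \<sigma> v0 = v}"
  have fib: "card (?fib v) = card (?fib v0)" if v: "v \<in> injs B {..<n} u" for v
  proof -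
    obtain \<tau> where \<tau>: "\<tau> \<in> perms n" "\<And>a. a \<in> B \<Longrightarrow> \<tau> (v0 a) = v a"
      by (rule extend_to_perm[OF finB, of v0 v n]) (use v v0 in \<open>auto simp: injs_def\<close>)
    have bt: "bij \<tau>" using perms_bij[OF \<tau>(1)] .
    have eqv: "upd B \<sigma> v0 = v \<longleftrightarrow> (\<forall>a\<in>B. \<sigma> (v0 a) = v a)" if "v \<in> injs B {..<n} u" for \<sigma> v
    proof
      show "upd B \<sigma> v0 = v" if e: "\<forall>a\<in>B. \<sigma> (v0 a) = v a"
      proof
        fix a show "upd B \<sigma> v0 a = v a"
          using e v0 \<open>v \<in> injs B {..<n} u\<close> unfolding upd_def injs_def by (cases "a \<in> B") auto
      qed
    qed (auto simp: upd_def)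
    have "bij_betw (\<lambda>\<sigma>. \<tau> \<circ> \<sigma>) (?fib v0) (?fib v)"
    proof (rule bij_betw_byWitness[where f' = "\<lambda>\<sigma>. inv \<tau> \<circ> \<sigma>"])
      show "(\<lambda>\<sigma>. \<tau> \<circ> \<sigma>) ` ?fib v0 \<subseteq> ?fib v"
      proof (rule image_subsetI)
        fix \<sigma> assume "\<sigma> \<in> ?fib v0"
        hence \<sigma>: "\<sigma> \<in> perms n" "\<forall>a\<in>B. \<sigma> (v0 a) = v0 a" using eqv[OF v0, of \<sigma>] by blast+
        have "\<forall>a\<in>B. (\<tau> \<circ> \<sigma>) (v0 a) = v a" using \<sigma>(2) \<tau>(2) by simp
        moreover have "\<tau> \<circ> \<sigma> \<in> perms n" using \<sigma>(1) \<tau>(1) by (simp add: permutes_compose)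
        ultimately show "\<tau> \<circ> \<sigma> \<in> ?fib v" using eqv[OF v] by blast
      qed
      show "(\<lambda>\<sigma>. inv \<tau> \<circ> \<sigma>) ` ?fib v \<subseteq> ?fib v0"
      proof (rule image_subsetI)
        fix \<sigma> assume "\<sigma> \<in> ?fib v"
        hence \<sigma>: "\<sigma> \<in> perms n" "\<forall>a\<in>B. \<sigma> (v0 a) = v a" using eqv[OF v, of \<sigma>] by blast+
        have "\<forall>a\<in>B. (inv \<tau> \<circ> \<sigma>) (v0 a) = v0 a"
          using \<sigma>(2) \<tau>(2) inv_f_f[OF bij_is_inj[OF bt]] by (metis comp_apply)
        moreover have "inv \<tau> \<circ> \<sigma> \<in> perms n" using \<sigma>(1) perms_inv[OF \<tau>(1)] by (simp add: permutes_compose)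
        ultimately show "inv \<tau> \<circ> \<sigma> \<in> ?fib v0" using eqv[OF v0] by blast
      qed
      show "\<forall>\<sigma>\<in>?fib v0. inv \<tau> \<circ> (\<tau> \<circ> \<sigma>) = \<sigma>" by (simp add: o_assoc inv_o_cancel[OF bij_is_inj[OF bt]])
      show "\<forall>\<sigma>\<in>?fib v. \<tau> \<circ> (inv \<tau> \<circ> \<sigma>) = \<sigma>"
        using bt by (simp add: o_assoc bij_is_surj surj_iff[THEN iffD1])
    qed
    thus ?thesis by (rule bij_betw_same_card[symmetric])
  qed
  have "id \<in> ?fib v0" by (auto simp: permutes_id upd_def)
  hence "?fib v0 \<noteq> {}" by blast
  moreover have "finite (?fib v0)" by simp
  ultimately have pos: "card (?fib v0) \<noteq> 0" unfolding card_eq_0_iff by blast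
  have "(\<Sum>\<sigma>\<in>perms n. lookup c (upd B \<sigma> v0)) = 0"
    using c B(1,2) v0W unfolding hwords_def by blast
  hence "0 = (\<Sum>\<sigma>\<in>perms n. lookup c (upd B \<sigma> v0))" by (rule sym)
  also have "\<dots> = (\<Sum>v\<in>injs B {..<n} u. \<Sum>\<sigma>\<in>?fib v. lookup c (upd B \<sigma> v0))"
    by (rule sum.group[symmetric]) (use finite_injs[OF finB] u0 in auto)
  also have "\<dots> = (\<Sum>v\<in>injs B {..<n} u. of_nat (card (?fib v0)) * lookup c v)"
    by (intro sum.cong refl) (use fib in simp)
  also have "\<dots> = of_nat (card (?fib v0)) * (\<Sum>v\<in>injs B {..<n} u. lookup c v)"
    by (rule sum_distrib_left[symmetric])
  finally have "of_nat (card (?fib v0)) * (\<Sum>v\<in>injs B {..<n} u. lookup c v) = 0" by (rule sym)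
  thus ?thesis using pos unfolding mult_eq_0_iff of_nat_eq_0_iff by blast
qed

text \<open>Fillings are grouped by the set \<open>C\<close> of positions that receive a letter at
  most \<open>i\<close> and by their values there.\<close>

lemma sum_injs_split:
  assumes "finite B" "i < n"
  shows "(\<Sum>v\<in>injs B {..<n} u. f v) =
    (\<Sum>p\<in>Sigma (Pow B) (\<lambda>C. injs C {..i} u). \<Sum>v\<in>injs (B - fst p) {Suc i..<n} (snd p). f v :: complex)"
proof -
  let ?S = "Sigma (Pow B) (\<lambda>C. injs C {..i} u)"
  let ?Q = "\<lambda>p. injs (B - fst p) {Suc i..<n} (snd p)"
  let ?C = "\<lambda>v. {a \<in> B. v a \<le> i}"
  let ?p = "\<lambda>v. (?C v, \<lambda>a. if a \<in> ?C v then v a else u a)"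
  have finS: "finite ?S" using assms by (intro finite_SigmaI finite_injs) (auto intro: finite_subset)
  have finQ: "finite (?Q p)" for p using assms by (intro finite_injs) auto
  have "(\<Sum>p\<in>?S. \<Sum>v\<in>?Q p. f v) = (\<Sum>(p, v)\<in>Sigma ?S ?Q. f v)"
    using finS finQ by (subst sum.Sigma) auto
  also have "\<dots> = (\<Sum>v\<in>injs B {..<n} u. f v)"
  proof (rule sum.reindex_bij_witness[of _ "\<lambda>v. (?p v, v)" snd])
    fix x assume x: "x \<in> Sigma ?S ?Q"
    then obtain C v' v where xd: "x = ((C, v'), v)" "C \<subseteq> B" "v' \<in> injs C {..i} u" "v \<in> injs (B - C) {Suc i..<n} v'"
      by auto
    have vC: "v a = v' a" "v a \<le> i" if "a \<in> C" for a using xd(3,4) that unfolding injs_def by auto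
    have vB: "Suc i \<le> v a" "v a < n" if "a \<in> B" "a \<notin> C" for a using xd(4) that unfolding injs_def by auto
    have vo: "v a = u a" if "a \<notin> B" for a using xd(2,3,4) that unfolding injs_def by auto
    have Cv: "?C v = C" using vC vB xd(2) by force
    have "v' = (\<lambda>a. if a \<in> C then v a else u a)" using vC(1) xd(3) unfolding injs_def by auto
    thus "(?p (snd x), snd x) = x" unfolding xd(1) snd_conv Cv by simp
    have "inj_on v B"
    proof (rule inj_onI)
      fix a b assume ab: "a \<in> B" "b \<in> B" "v a = v b"
      have "a \<in> C \<longleftrightarrow> b \<in> C" using ab vC(2)[of a] vC(2)[of b] vB(1)[of a] vB(1)[of b] by fastforce
      thus "a = b"
        using ab xd(3,4) vC(1)[of a] vC(1)[of b] unfolding injs_def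
        by (cases "a \<in> C") (auto dest: inj_onD)
    qed
    moreover have "v a < n" if "a \<in> B" for a
      using vC(2)[of a] vB(2)[of a] that assms(2) by (cases "a \<in> C") auto
    ultimately show "snd x \<in> injs B {..<n} u" using vo unfolding xd(1) injs_def by auto
    show "f (snd x) = (case x of (p, v) \<Rightarrow> f v)" by (simp add: xd(1))
  next
    fix v assume v: "v \<in> injs B {..<n} u"
    thus "(?p v, v) \<in> Sigma ?S ?Q" unfolding injs_def by (auto simp: inj_on_def not_le Suc_le_eq)
  qed auto
  finally show ?thesis by simp
qed

text \<open>Let the letter \<open>i\<close> occupy \<open>n - i\<close> positions \<open>A\<close>
  of \<open>w\<close>. Modulo words of smaller sum, a position filled with letters above
  \<open>i\<close> can be traded for the letter \<open>i\<close> at the cost of a sign. Trading all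
  positions of \<open>A\<close> shows that the sum over injective fillings of \<open>A\<close> by
  letters above \<open>i\<close> is \<open>fact (n - i)\<close> times the value at \<open>w\<close>,
  up to sign. Only \<open>n - i - 1\<close> letters are available, so that sum is empty.\<close>

theorem hwords_eq_0:
  assumes c: "c \<in> hwords n k" and k: "k > n choose 2"
  shows "c = 0"
proof -
  have "lookup c w = 0" if "w \<in> lwords n k" for w
    using that
  proof (induction "\<Sum>a<k. w a" arbitrary: w rule: less_induct)
    case less
    have IH: "lookup c v = 0" if "v \<in> lwords n k" "(\<Sum>a<k. v a) < (\<Sum>a<k. w a)" for v
      using less.hyps[OF that(2) that(1)] .
    obtain i where i: "i < n" "n - i \<le> card {a. a < k \<and> w a = i}" using pigeonhole_letters[OF less.prems k] .
    obtain A where A: "A \<subseteq> {a. a < k \<and> w a = i}" "card A = n - i" "finite A"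
      using obtain_subset_with_card_n[OF i(2)] by metis
    have Ak: "A \<subseteq> {..<k}" and Ai: "\<And>a. a \<in> A \<Longrightarrow> w a = i" using A(1) by auto
    define S where "S = (\<lambda>B u. \<Sum>v\<in>injs B {Suc i..<n} u. lookup c v)"
    have S0: "S {} u = lookup c u" for u unfolding S_def by simp
    have split: "(\<Sum>p\<in>Sigma (Pow B) (\<lambda>C. injs C {..i} u). S (B - fst p) (snd p)) = 0"
      if B: "B \<subseteq> A" "B \<noteq> {}" and u: "u \<in> lwords n k" for B u
    proof -
      have "card B \<le> card A" using card_mono[OF A(3) B(1)] .
      hence "card B \<le> n" using A(2) by simp
      hence "(\<Sum>v\<in>injs B {..<n} u. lookup c v) = 0" using sum_injs_all_eq_0[OF c _ B(2) _ u] B(1) Ak by blast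
      thus ?thesis unfolding S_def using sum_injs_split[OF finite_subset[OF B(1) A(3)] i(1), of "lookup c" u] by simp
    qed
    \<comment> \<open>With \<open>B\<close> empty, the letter below \<open>i\<close> makes the sum
      of \<open>u\<close> smaller than that of \<open>w\<close>. Otherwise every term of the split
      relation with nonempty \<open>C\<close> is of the same kind with fewer positions to fill, so
      the term \<open>C = {}\<close> vanishes as well.\<close>
    have hit: "S B u = 0"
      if "B \<subseteq> A" "u \<in> lwords n k" "\<And>a. a \<notin> A \<Longrightarrow> u a = w a" "\<And>a. a \<in> A - B \<Longrightarrow> u a \<le> i" "\<exists>a\<in>A - B. u a < i" for B u
      using that
    proof (induction "card B" arbitrary: B u rule: less_induct)
      case (less B u)
      have finB: "finite B" using finite_subset[OF less.prems(1) A(3)] .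
      show ?case
      proof (cases "B = {}")
        case True
        obtain a0 where a0: "a0 \<in> A" "u a0 < i" using less.prems(5) by blast
        have "(\<Sum>a<k. u a) < (\<Sum>a<k. w a)"
        proof (rule sum_strict_mono_ex1)
          show "\<forall>a\<in>{..<k}. u a \<le> w a" using less.prems(3,4) Ai True by (metis DiffI empty_iff order_refl)
          show "\<exists>a\<in>{..<k}. u a < w a" using a0 Ak Ai by auto
        qed simp
        thus ?thesis using IH[OF less.prems(2)] S0 True by simp
      next
        case False
        have "(\<Sum>p\<in>Sigma (Pow B) (\<lambda>C. injs C {..i} u). S (B - fst p) (snd p)) =
          (\<Sum>p\<in>{({}, u)}. S (B - fst p) (snd p))"
        proof (rule sum.mono_neutral_right)
          show "finite (Sigma (Pow B) (\<lambda>C. injs C {..i} u))"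
            using finB by (intro finite_SigmaI finite_injs) (auto intro: finite_subset)
          show "\<forall>p\<in>Sigma (Pow B) (\<lambda>C. injs C {..i} u) - {({}, u)}. S (B - fst p) (snd p) = 0"
          proof
            fix p assume p: "p \<in> Sigma (Pow B) (\<lambda>C. injs C {..i} u) - {({}, u)}"
            obtain C v where pd: "p = (C, v)" by (cases p)
            have C: "C \<subseteq> B" "v \<in> injs C {..i} u" "C \<noteq> {}" using p unfolding pd by auto
            have v: "\<And>a. a \<notin> C \<Longrightarrow> v a = u a" "\<And>a. a \<in> C \<Longrightarrow> v a \<le> i" using C(2) unfolding injs_def by auto
            have CA: "C \<subseteq> A" using C(1) less.prems(1) by blast
            have "S (B - C) v = 0"
            proof (rule less.hyps)
              show "card (B - C) < card B" using C finB by (intro psubset_card_mono) auto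
              show "B - C \<subseteq> A" using less.prems(1) by blast
              show "v \<in> lwords n k"
                unfolding lwords_def
              proof (intro CollectI conjI allI impI)
                fix a assume "a < k"
                thus "v a < n" using v[of a] i(1) less.prems(2) unfolding lwords_def by (cases "a \<in> C") auto
              next
                fix a assume "a \<ge> k"
                hence "a \<notin> C" using CA Ak by auto
                thus "v a = n" using v(1) less.prems(2) \<open>a \<ge> k\<close> unfolding lwords_def by auto
              qed
              show "v a = w a" if "a \<notin> A" for a using that v(1)[of a] CA less.prems(3)[of a] by auto
              show "v a \<le> i" if "a \<in> A - (B - C)" for a
                using that v[of a] less.prems(4)[of a] by (cases "a \<in> C") auto
              obtain a0 where "a0 \<in> A - B" "u a0 < i" using less.prems(5) by blast
              moreover from this have "v a0 = u a0" using v(1)[of a0] C(1) by blast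
              ultimately show "\<exists>a\<in>A - (B - C). v a < i" by (intro bexI[of _ a0]) auto
            qed
            thus "S (B - fst p) (snd p) = 0" by (simp add: pd)
          qed
        qed auto
        thus ?thesis using split[OF less.prems(1) False less.prems(2)] by simp
      qed
    qed
    \<comment> \<open>Only \<open>C = {}\<close> and the singletons carrying \<open>i\<close> itself
      survive: by injectivity, any other filling puts a letter below \<open>i\<close> somewhere and
      is removed by \<open>hit\<close>.\<close>
    have rec: "S B w = - (\<Sum>b\<in>B. S (B - {b}) w)" if B: "B \<subseteq> A" "B \<noteq> {}" for B
    proof -
      have finB: "finite B" using finite_subset[OF B(1) A(3)] .
      let ?P = "Sigma (Pow B) (\<lambda>C. injs C {..i} w)"
      let ?P1 = "(\<lambda>b. ({b}, w)) ` B"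
      have wC: "w \<in> injs {b} {..i} w" if "b \<in> B" for b using that Ai B(1) unfolding injs_def by auto
      have "(\<Sum>p\<in>?P. S (B - fst p) (snd p)) = (\<Sum>p\<in>insert ({}, w) ?P1. S (B - fst p) (snd p))"
      proof (rule sum.mono_neutral_right)
        show "finite ?P" using finB by (intro finite_SigmaI finite_injs) (auto intro: finite_subset)
        show "insert ({}, w) ?P1 \<subseteq> ?P" using wC by auto
        show "\<forall>p\<in>?P - insert ({}, w) ?P1. S (B - fst p) (snd p) = 0"
        proof
          fix p assume p: "p \<in> ?P - insert ({}, w) ?P1"
          obtain C v where pd: "p = (C, v)" by (cases p)
          have C: "C \<subseteq> B" "v \<in> injs C {..i} w" "C \<noteq> {}" using p unfolding pd by auto
          have v: "\<And>a. a \<notin> C \<Longrightarrow> v a = w a" "\<And>a. a \<in> C \<Longrightarrow> v a \<le> i" "inj_on v C"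
            using C(2) unfolding injs_def by auto
          have CA: "C \<subseteq> A" using C(1) B(1) by blast
          have "\<exists>a\<in>C. v a < i"
          proof (rule ccontr)
            assume "\<not> (\<exists>a\<in>C. v a < i)"
            hence vi: "v a = i" if "a \<in> C" for a using v(2)[OF that] that by force
            obtain b where b: "b \<in> C" using C(3) by blast
            have "C = {b}" using b vi v(3) by (auto dest: inj_onD)
            moreover have "v = w"
            proof
              fix a show "v a = w a" using v(1)[of a] vi[of a] Ai[of a] CA by (cases "a \<in> C") auto
            qed
            ultimately show False using p b C(1) unfolding pd by auto
          qed
          then obtain a0 where a0: "a0 \<in> C" "v a0 < i" by blast
          have "S (B - C) v = 0"
          proof (rule hit)
            show "B - C \<subseteq> A" using B(1) by blast
            show "v \<in> lwords n k"
              unfolding lwords_def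
            proof (intro CollectI conjI allI impI)
              fix a assume "a < k"
              thus "v a < n" using v(1)[of a] v(2)[of a] i(1) less.prems unfolding lwords_def by (cases "a \<in> C") auto
            next
              fix a assume "a \<ge> k"
              hence "a \<notin> C" using CA Ak by auto
              thus "v a = n" using v(1) less.prems \<open>a \<ge> k\<close> unfolding lwords_def by auto
            qed
            show "v a = w a" if "a \<notin> A" for a using that v(1)[of a] CA by auto
            show "v a \<le> i" if "a \<in> A - (B - C)" for a
              using that v(1)[of a] v(2)[of a] Ai[of a] by (cases "a \<in> C") auto
            show "\<exists>a\<in>A - (B - C). v a < i" using a0 CA by auto
          qed
          thus "S (B - fst p) (snd p) = 0" by (simp add: pd)
        qed
      qed
      also have "\<dots> = S B w + (\<Sum>p\<in>?P1. S (B - fst p) (snd p))"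
        using finB by (subst sum.insert) auto
      also have "(\<Sum>p\<in>?P1. S (B - fst p) (snd p)) = (\<Sum>b\<in>B. S (B - {b}) w)"
        by (subst sum.reindex) (auto intro: inj_onI)
      finally show ?thesis using split[OF B less.prems] by (simp add: add_eq_0_iff2)
    qed
    have fac: "S B w = (- 1) ^ card B * fact (card B) * lookup c w" if "B \<subseteq> A" for B
      using that
    proof (induction "card B" arbitrary: B)
      case 0
      hence "B = {}" using finite_subset[OF _ A(3), of B] by auto
      thus ?case using S0 by simp
    next
      case (Suc m)
      have B: "B \<noteq> {}" "finite B" using Suc.hyps(2) by (auto intro: card_ge_0_finite)
      have "S (B - {b}) w = (- 1) ^ m * fact m * lookup c w" if "b \<in> B" for b
      proof -
        have "card (B - {b}) = m" using that Suc.hyps(2) B(2) by simp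
        thus ?thesis using Suc.hyps(1)[of "B - {b}"] Suc.prems by auto
      qed
      hence "S B w = - (\<Sum>b\<in>B. (- 1) ^ m * fact m * lookup c w)" using rec[OF Suc.prems B(1)] by simp
      also have "\<dots> = (- 1) ^ Suc m * fact (Suc m) * lookup c w"
        by (simp add: Suc.hyps(2)[symmetric] algebra_simps)
      finally show ?case using Suc.hyps(2) by simp
    qed
    have "injs A {Suc i..<n} w = {}"
    proof (rule ccontr)
      assume "injs A {Suc i..<n} w \<noteq> {}"
      then obtain v where v: "inj_on v A" "v ` A \<subseteq> {Suc i..<n}" unfolding injs_def by auto
      have "card A \<le> card {Suc i..<n}" using card_inj_on_le[OF v] by simp
      thus False using A(2) i(1) by simp
    qed
    hence "S A w = 0" unfolding S_def by simp
    thus "lookup c w = 0" using fac[of A] by simp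
  qed
  moreover have "lookup c w = 0" if "w \<notin> lwords n k" for w
    using c that unfolding hwords_def by (auto simp: in_keys_iff)
  ultimately show ?thesis by (intro poly_mapping_eqI) (metis lookup_zero)
qed

section \<open>Polarization of harmonic polynomials\<close>

definition mfact :: "mono \<Rightarrow> complex" where
  "mfact m = (\<Prod>v\<in>keys m. fact (lookup m v))"

text \<open>
  The coefficient of \<open>g\<close> with respect to the divided powers \<open>x\<^sup>m / m!\<close>: on these coefficients, differentiation
  is a shift of the index.
\<close>

definition dpc :: "cpoly \<Rightarrow> mono \<Rightarrow> complex" where
  "dpc g m = mfact m * lookup g m"

lemma mfact_superset: "finite A \<Longrightarrow> keys m \<subseteq> A \<Longrightarrow> mfact m = (\<Prod>v\<in>A. fact (lookup m v))"
  unfolding mfact_def by (rule prod.mono_neutral_left) (auto simp: in_keys_iff)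

lemma mfact_nonzero: "mfact m \<noteq> 0"
  unfolding mfact_def by simp

lemma mfact_add_single: "mfact (m + Poly_Mapping.single v 1) = of_nat (lookup m v + 1) * mfact m"
proof -
  let ?A = "insert v (keys m)"
  have k: "keys (m + Poly_Mapping.single v 1) \<subseteq> ?A"
    using Poly_Mapping.keys_add[of m "Poly_Mapping.single v 1"] by (auto split: if_splits)
  have "mfact (m + Poly_Mapping.single v 1) = (\<Prod>u\<in>?A. fact (lookup (m + Poly_Mapping.single v 1) u))"
    by (rule mfact_superset[OF _ k]) simp
  also have "\<dots> = fact (lookup m v + 1) * (\<Prod>u\<in>?A - {v}. fact (lookup m u))"
    by (subst prod.remove[of _ v]) (auto simp: lookup_add lookup_single when_def split: if_splits intro!: prod.cong)
  also have "\<dots> = of_nat (lookup m v + 1) * (\<Prod>u\<in>?A. fact (lookup m u))"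
    by (subst (2) prod.remove[of _ v]) auto
  also have "(\<Prod>u\<in>?A. fact (lookup m u)) = mfact m" by (rule mfact_superset[symmetric]) auto
  finally show ?thesis .
qed

lemma dpc_partial: "dpc (partial v g) m = dpc g (m + Poly_Mapping.single v 1)"
  unfolding dpc_def by (simp add: lookup_partial mfact_add_single[simplified] algebra_simps)

lemma dpc_partial_pow: "dpc ((partial v ^^ e) g) m = dpc g (m + Poly_Mapping.single v e)"
proof (induction e arbitrary: m)
  case (Suc e)
  have "Poly_Mapping.single v (Suc e) = Poly_Mapping.single v 1 + Poly_Mapping.single v e"
    by (simp add: single_add[symmetric])
  thus ?case using Suc by (simp add: dpc_partial add.assoc)
qed simp

lemma dpc_fold:
  assumes "finite A"
  shows "dpc (Finite_Set.fold (\<lambda>v. partial v ^^ (e v :: nat)) g A) m = dpc g (m + (\<Sum>v\<in>A. Poly_Mapping.single v (e v)))"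
  using assms
proof (induction A arbitrary: m rule: finite_induct)
  case (insert v A)
  interpret comp_fun_commute "\<lambda>v. partial v ^^ (e v :: nat)" by (rule comp_fun_commute_partial)
  show ?case using insert by (simp add: dpc_partial_pow add.assoc)
qed simp

lemma dpc_diff_mono: "dpc (diff_mono b g) m = dpc g (m + b)"
  unfolding diff_mono_def using dpc_fold[of "keys b" "lookup b" g m] poly_mapping_sum_single[of "keys b" b] by simp

lemma dpc_add: "dpc (g + h) m = dpc g m + dpc h m"
  unfolding dpc_def by (simp add: lookup_add algebra_simps)

lemma dpc_cscale: "dpc (cscale c g) m = c * dpc g m"
  unfolding dpc_def by simp

lemma dpc_0: "dpc 0 m = 0"
  unfolding dpc_def by simp

lemma dpc_sum: "dpc (\<Sum>i\<in>I. g i) m = (\<Sum>i\<in>I. dpc (g i) m)"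
  unfolding dpc_def by (simp add: lookup_sum sum_distrib_left)

lemma dpc_eq_0_iff: "g = 0 \<longleftrightarrow> (\<forall>m. dpc g m = 0)"
  unfolding dpc_def using mfact_nonzero by (auto intro!: poly_mapping_eqI)

section \<open>Linear functionals on polynomials and differential operators\<close>

definition pair :: "('m \<Rightarrow> complex) \<Rightarrow> ('m \<Rightarrow>\<^sub>0 complex) \<Rightarrow> complex" where
  "pair h f = (\<Sum>m\<in>keys f. lookup f m * h m)"

lemma pair_superset: "finite A \<Longrightarrow> keys f \<subseteq> A \<Longrightarrow> pair h f = (\<Sum>m\<in>A. lookup f m * h m)"
  unfolding pair_def by (rule sum.mono_neutral_left) (auto simp: in_keys_iff)

lemma pair_add: "pair h (f + g) = pair h f + pair h g"
  using pair_superset[of "keys f \<union> keys g" "f + g" h] pair_superset[of "keys f \<union> keys g" f h]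
    pair_superset[of "keys f \<union> keys g" g h] Poly_Mapping.keys_add[of f g]
  by (simp add: lookup_add sum.distrib algebra_simps)

lemma pair_0: "pair h 0 = 0"
  unfolding pair_def by simp

lemma pair_sum: "pair h (\<Sum>i\<in>I. f i) = (\<Sum>i\<in>I. pair h (f i))"
  by (induction I rule: infinite_finite_induct) (auto simp: pair_0 pair_add)

lemma pair_single: "pair h (Poly_Mapping.single m x) = x * h m"
  unfolding pair_def by (cases "x = 0") auto

lemma pair_mult:
  fixes a f :: cpoly
  shows "pair h (a * f) = (\<Sum>m\<in>keys a. lookup a m * pair (\<lambda>m'. h (m + m')) f)"
proof -
  have "a * f = (\<Sum>m\<in>keys a. \<Sum>m'\<in>keys f. Poly_Mapping.single (m + m') (lookup a m * lookup f m'))"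
  proof -
    have "a * f = (\<Sum>m\<in>keys a. Poly_Mapping.single m (lookup a m)) * (\<Sum>m\<in>keys f. Poly_Mapping.single m (lookup f m))"
      using poly_mapping_sum_single[of "keys a" a] poly_mapping_sum_single[of "keys f" f] by simp
    thus ?thesis by (simp add: sum_product mult_single)
  qed
  hence "pair h (a * f) = (\<Sum>m\<in>keys a. \<Sum>m'\<in>keys f. lookup a m * lookup f m' * h (m + m'))"
    by (simp only: pair_sum pair_single)
  thus ?thesis by (simp add: pair_def sum_distrib_left mult.assoc)
qed

lemma dpc_diff_op: "dpc (diff_op f g) m = pair (\<lambda>b. dpc g (m + b)) f"
  unfolding diff_op_def pair_def by (simp add: dpc_sum dpc_cscale dpc_diff_mono)

section \<open>The group action on monomials and the harmonicity relations\<close>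

abbreviation ren :: "(nat \<Rightarrow> nat) \<Rightarrow> mono \<Rightarrow> mono" where
  "ren \<sigma> \<equiv> pushforward (\<lambda>(i, j). (i, \<sigma> j))"

lemma lookup_ren: "bij \<sigma> \<Longrightarrow> lookup (ren \<sigma> m) (i, j) = lookup m (i, inv \<sigma> j)"
  by (subst lookup_pushforward[where g = "\<lambda>(i, j). (i, inv \<sigma> j)"])
     (auto simp: bij_is_inj bij_is_surj surj_f_inv_f)

interpretation ckey: key_action ren
proof
  show "ren id m = m" for m by (rule poly_mapping_eqI, clarify, subst lookup_ren) auto
  show "ren (\<sigma> \<circ> \<tau>) m = ren \<sigma> (ren \<tau> m)" if "bij \<sigma>" "bij \<tau>" for \<sigma> \<tau> m
  proof (rule poly_mapping_eqI)
    fix v :: "nat \<times> nat"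
    obtain i j where v: "v = (i, j)" by (cases v)
    show "lookup (ren (\<sigma> \<circ> \<tau>) m) v = lookup (ren \<sigma> (ren \<tau> m)) v"
      unfolding v lookup_ren[OF bij_comp[OF that(2,1)]] lookup_ren[OF that(1)] lookup_ren[OF that(2)]
      by (simp add: o_inv_distrib that)
  qed
qed

interpretation crep: perm_rep act_poly
  unfolding act_poly_def by (rule ckey.perm_rep)

lemma lookup_act_poly: "bij \<sigma> \<Longrightarrow> lookup (act_poly \<sigma> g) m = lookup g (ren (inv \<sigma>) m)"
  unfolding act_poly_def by (rule ckey.lookup_push)

lemma ren_add: "bij \<sigma> \<Longrightarrow> ren \<sigma> (a + b) = ren \<sigma> a + ren \<sigma> b"
  by (rule poly_mapping_eqI) (auto simp: lookup_ren lookup_add)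

lemma ren_0: "ren \<sigma> 0 = 0"
  by (simp add: pushforward_def)

lemma ren_sum: "bij \<sigma> \<Longrightarrow> ren \<sigma> (\<Sum>i\<in>I. f i) = (\<Sum>i\<in>I. ren \<sigma> (f i))"
  by (induction I rule: infinite_finite_induct) (auto simp: ren_0 ren_add)

lemma ren_single: "ren \<sigma> (Poly_Mapping.single (i, j) x) = Poly_Mapping.single (i, \<sigma> j) x"
  by (simp add: pushforward_single)

lemma ren_eq_0: "bij \<sigma> \<Longrightarrow> ren \<sigma> m = 0 \<longleftrightarrow> m = 0"
  by (metis ckey.F_inv(1) ren_0)

lemma ren_box:
  assumes \<sigma>: "\<sigma> \<in> perms n" and m: "keys m \<subseteq> {..<r} \<times> {..<n}"
  shows "keys (ren \<sigma> m) \<subseteq> {..<r} \<times> {..<n}"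
proof
  fix v assume v: "v \<in> keys (ren \<sigma> m)"
  obtain i j where ij: "v = (i, j)" by (cases v)
  have "(i, inv \<sigma> j) \<in> keys m" using v unfolding ij by (simp add: in_keys_iff lookup_ren perms_bij[OF \<sigma>])
  hence "i < r" "inv \<sigma> j < n" using m by auto
  thus "v \<in> {..<r} \<times> {..<n}" using perms_less[OF perms_inv[OF \<sigma>]] unfolding ij by simp
qed

lemma mfact_ren:
  assumes b: "bij \<sigma>"
  shows "mfact (ren \<sigma> m) = mfact m"
  unfolding mfact_def
proof (rule prod.reindex_bij_witness[of _ "\<lambda>(i, j). (i, \<sigma> j)" "\<lambda>(i, j). (i, inv \<sigma> j)"])
  fix v :: "nat \<times> nat"
  obtain i j where v: "v = (i, j)" by (cases v)
  have inv: "inv \<sigma> (\<sigma> x) = x" "\<sigma> (inv \<sigma> x) = x" for x using b by (auto simp: bij_is_inj bij_is_surj surj_f_inv_f)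
  show "(case case v of (i, j) \<Rightarrow> (i, inv \<sigma> j) of (i, j) \<Rightarrow> (i, \<sigma> j)) = v"
    "(case case v of (i, j) \<Rightarrow> (i, \<sigma> j) of (i, j) \<Rightarrow> (i, inv \<sigma> j)) = v" by (auto simp: v inv)
  show "(case v of (i, j) \<Rightarrow> (i, inv \<sigma> j)) \<in> keys m" if "v \<in> keys (ren \<sigma> m)"
    using that by (simp add: v in_keys_iff lookup_ren[OF b])
  show "(case v of (i, j) \<Rightarrow> (i, \<sigma> j)) \<in> keys (ren \<sigma> m)" if "v \<in> keys m"
    using that by (simp add: v in_keys_iff lookup_ren[OF b] inv)
  show "fact (lookup m (case v of (i, j) \<Rightarrow> (i, inv \<sigma> j))) = fact (lookup (ren \<sigma> m) v)"
    by (simp add: v lookup_ren[OF b])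
qed

lemma dpc_act_poly: "bij \<sigma> \<Longrightarrow> dpc (act_poly \<sigma> g) m = dpc g (ren (inv \<sigma>) m)"
  unfolding dpc_def by (simp add: lookup_act_poly mfact_ren bij_imp_bij_inv)

lemma pair_act_poly: "pair h (act_poly \<sigma> f) = pair (\<lambda>m. h (ren \<sigma> m)) f"
  unfolding act_poly_def by (subst pushforward_def) (simp add: pair_sum pair_single, simp add: pair_def)

text \<open>Differentiation by an orbit sum gives the sum on the right, as it shifts indices.
  Conversely, an invariant is the average of its images and hence a combination of orbit sums, and a
  further polynomial factor only changes the shift \<open>m\<close>.\<close>

lemma harmonic_iff:
  assumes g: "g \<in> poly_ring r n"
  shows "g \<in> harmonics r n \<longleftrightarrow> (\<forall>b m. b \<noteq> 0 \<longrightarrow> keys b \<subseteq> {..<r} \<times> {..<n} \<longrightarrow> (\<Sum>\<sigma>\<in>perms n. dpc g (m + ren \<sigma> b)) = 0)"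
proof
  assume h: "g \<in> harmonics r n"
  show "\<forall>b m. b \<noteq> 0 \<longrightarrow> keys b \<subseteq> {..<r} \<times> {..<n} \<longrightarrow> (\<Sum>\<sigma>\<in>perms n. dpc g (m + ren \<sigma> b)) = 0"
  proof (intro allI impI)
    fix b m :: mono assume b: "b \<noteq> 0" "keys b \<subseteq> {..<r} \<times> {..<n}"
    define f :: cpoly where "f = (\<Sum>\<sigma>\<in>perms n. Poly_Mapping.single (ren \<sigma> b) 1)"
    have "act_poly \<tau> f = f" if \<tau>: "\<tau> \<in> perms n" for \<tau>
    proof -
      have "act_poly \<tau> f = (\<Sum>\<sigma>\<in>perms n. Poly_Mapping.single (ren (\<tau> \<circ> \<sigma>) b) 1)"
        unfolding f_def crep.act_sum[OF perms_bij[OF \<tau>]]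
      proof (intro sum.cong refl)
        fix \<sigma> assume "\<sigma> \<in> perms n"
        thus "act_poly \<tau> (Poly_Mapping.single (ren \<sigma> b) 1) = Poly_Mapping.single (ren (\<tau> \<circ> \<sigma>) b) 1"
          by (simp only: act_poly_def pushforward_single ckey.F_comp[OF perms_bij[OF \<tau>] perms_bij])
      qed
      thus ?thesis unfolding f_def by (simp only: sum_perms_comp[OF \<tau>, of "\<lambda>\<sigma>. Poly_Mapping.single (ren \<sigma> b) 1"])
    qed
    moreover have "f \<in> poly_ring r n" unfolding poly_ring_def
    proof (intro CollectI ballI)
      fix m' assume "m' \<in> keys f"
      hence "\<exists>\<sigma>\<in>perms n. m' \<in> keys (Poly_Mapping.single (ren \<sigma> b) (1::complex))"
        unfolding f_def in_keys_iff lookup_sum by (metis (no_types, lifting) sum.neutral)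
      thus "keys m' \<subseteq> {..<r} \<times> {..<n}" using ren_box[OF _ b(2)] by auto
    qed
    moreover have "lookup f 0 = 0"
      unfolding f_def lookup_sum
      by (intro sum.neutral ballI) (auto simp: lookup_single when_def ren_eq_0 perms_bij b(1))
    ultimately have "f \<in> invariants_pos r n" unfolding invariants_pos_def by blast
    hence "f \<in> invariant_ideal r n" unfolding invariant_ideal_def
      by (auto intro!: exI[of _ "{f}"] exI[of _ "\<lambda>_. 1"] simp: poly_ring_def)
    hence "diff_op f g = 0" using h unfolding harmonics_def by blast
    hence "pair (\<lambda>b. dpc g (m + b)) f = 0" using dpc_diff_op[of f g m] by (simp add: dpc_0)
    thus "(\<Sum>\<sigma>\<in>perms n. dpc g (m + ren \<sigma> b)) = 0" unfolding f_def by (simp add: pair_sum pair_single)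
  qed
next
  assume R: "\<forall>b m. b \<noteq> 0 \<longrightarrow> keys b \<subseteq> {..<r} \<times> {..<n} \<longrightarrow> (\<Sum>\<sigma>\<in>perms n. dpc g (m + ren \<sigma> b)) = 0"
  have inv: "pair (\<lambda>b. dpc g (m + b)) f = 0" if f: "f \<in> invariants_pos r n" for f m
  proof -
    \<comment> \<open>By invariance of \<open>f\<close>, all summands on the right are
      equal.\<close>
    have "of_nat (card (perms n)) * pair (\<lambda>b. dpc g (m + b)) f = (\<Sum>\<sigma>\<in>perms n. pair (\<lambda>b. dpc g (m + ren \<sigma> b)) f)"
    proof -
      have "pair (\<lambda>b. dpc g (m + ren \<sigma> b)) f = pair (\<lambda>b. dpc g (m + b)) f" if "\<sigma> \<in> perms n" for \<sigma>
      proof -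
        have "act_poly \<sigma> f = f" using f that unfolding invariants_pos_def by blast
        thus ?thesis using pair_act_poly[of "\<lambda>b. dpc g (m + b)" \<sigma> f] by simp
      qed
      thus ?thesis by simp
    qed
    also have "\<dots> = (\<Sum>b\<in>keys f. lookup f b * (\<Sum>\<sigma>\<in>perms n. dpc g (m + ren \<sigma> b)))"
      unfolding pair_def sum_distrib_left by (rule sum.swap)
    also have "\<dots> = 0"
    proof (intro sum.neutral ballI)
      fix b assume b: "b \<in> keys f"
      have "b \<noteq> 0" using b f unfolding invariants_pos_def by (auto simp: in_keys_iff)
      moreover have "keys b \<subseteq> {..<r} \<times> {..<n}" using b f unfolding invariants_pos_def poly_ring_def by blast
      ultimately show "lookup f b * (\<Sum>\<sigma>\<in>perms n. dpc g (m + ren \<sigma> b)) = 0" using R by simp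
    qed
    finally show ?thesis using card_perms[of n] by simp
  qed
  show "g \<in> harmonics r n" unfolding harmonics_def
  proof (intro CollectI conjI ballI g)
    fix f assume "f \<in> invariant_ideal r n"
    then obtain F a where F: "f = (\<Sum>f\<in>F. a f * f)" "F \<subseteq> invariants_pos r n"
      unfolding invariant_ideal_def by blast
    have "dpc (diff_op f g) m = 0" for m
      unfolding dpc_diff_op F(1) pair_sum pair_mult
    proof (intro sum.neutral ballI)
      fix f b assume "f \<in> F" "b \<in> keys (a f)"
      hence "pair (\<lambda>m'. dpc g (m + b + m')) f = 0" using inv F(2) by blast
      thus "lookup (a f) b * pair (\<lambda>m'. dpc g (m + (b + m'))) f = 0" by (simp add: add.assoc)
    qed
    thus "diff_op f g = 0" using dpc_eq_0_iff by blast
  qed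
qed

section \<open>Monomials of fixed multidegree as orbits of words\<close>

lemma lookup_sum_unit_single:
  "finite A \<Longrightarrow> lookup (\<Sum>a\<in>A. Poly_Mapping.single (f a) (1::nat)) x = card {a \<in> A. f a = x}"
  unfolding lookup_sum by (simp add: lookup_single when_def sum.inter_filter[symmetric])

lemma exists_with_fibres:
  assumes "finite A" "finite J" "(\<Sum>j\<in>J. f j) = card A"
  shows "\<exists>w. (\<forall>a\<in>A. w a \<in> J) \<and> (\<forall>j\<in>J. card {a \<in> A. w a = j} = f j)"
  using assms(2,1,3)
proof (induction J arbitrary: A rule: finite_induct)
  case (insert j J)
  obtain B where B: "B \<subseteq> A" "card B = f j" "finite B"
    using obtain_subset_with_card_n[of "f j" A] insert by auto
  have "(\<Sum>j\<in>J. f j) = card (A - B)" using insert B by (simp add: card_Diff_subset)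
  then obtain w where w: "\<forall>a\<in>A - B. w a \<in> J" "\<forall>i\<in>J. card {a \<in> A - B. w a = i} = f i"
    using insert.IH[of "A - B"] insert.prems by auto
  let ?w = "\<lambda>a. if a \<in> B then j else w a"
  have "{a \<in> A. ?w a = j} = B" using B(1) w(1) insert.hyps(2) by auto
  moreover have "{a \<in> A. ?w a = i} = {a \<in> A - B. w a = i}" if "i \<in> J" for i using that insert.hyps(2) by auto
  ultimately show ?case using w B(2) by (intro exI[of _ ?w]) auto
qed auto

text \<open>A divisor of a product of variables indexed by positions is the product over a subset of
  the positions, which is chosen separately over each variable.\<close>

lemma sub_sum_single:
  fixes f :: "'a \<Rightarrow> 'b"
  assumes A: "finite A" and eq: "(\<Sum>a\<in>A. Poly_Mapping.single (f a) (1::nat)) = c + b"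
  obtains B where "B \<subseteq> A" "(\<Sum>a\<in>B. Poly_Mapping.single (f a) (1::nat)) = b"
proof -
  have "\<exists>B. B \<subseteq> {a \<in> A. f a = x} \<and> card B = lookup b x" for x
  proof -
    have "lookup b x \<le> card {a \<in> A. f a = x}"
      using arg_cong[OF eq, of "\<lambda>m. lookup m x"] lookup_sum_unit_single[OF A, of f x] by (simp add: lookup_add)
    thus ?thesis using obtain_subset_with_card_n by metis
  qed
  then obtain B where B: "\<And>x. B x \<subseteq> {a \<in> A. f a = x}" "\<And>x. card (B x) = lookup b x" by metis
  let ?B = "\<Union>x. B x"
  have sub: "?B \<subseteq> A" using B(1) by blast
  have fx: "{a \<in> ?B. f a = x} = B x" for x
  proof
    show "{a \<in> ?B. f a = x} \<subseteq> B x" using B(1) by fastforce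
  qed (use B(1) in auto)
  have "(\<Sum>a\<in>?B. Poly_Mapping.single (f a) (1::nat)) = b"
    by (rule poly_mapping_eqI) (simp only: lookup_sum_unit_single[OF finite_subset[OF sub A]] fx B(2))
  thus ?thesis using that sub by blast
qed

locale polarization =
  fixes r n k :: nat and d :: "nat \<Rightarrow>\<^sub>0 nat" and row :: "nat \<Rightarrow> nat"
  assumes row: "row \<in> words r (lookup d) k"
begin

definition box :: "(nat \<times> nat) set" where "box = {..<r} \<times> {..<n}"

definition dmonos :: "mono set" where
  "dmonos = {m. keys m \<subseteq> box \<and> (\<forall>i<r. (\<Sum>j<n. lookup m (i, j)) = lookup d i)}"

definition pmon :: "nat set \<Rightarrow> (nat \<Rightarrow> nat) \<Rightarrow> mono" where
  "pmon A w = (\<Sum>a\<in>A. Poly_Mapping.single (row a, w a) 1)"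

abbreviation mon :: "(nat \<Rightarrow> nat) \<Rightarrow> mono" where
  "mon \<equiv> pmon {..<k}"

lemma row_less: "a < k \<Longrightarrow> row a < r"
  using row unfolding words_def by (auto simp: PiE_iff)

lemma card_row: "i < r \<Longrightarrow> card {a. a < k \<and> row a = i} = lookup d i"
  using row unfolding words_def by auto

lemma lookup_pmon: "finite A \<Longrightarrow> lookup (pmon A w) (i, j) = card {a \<in> A. row a = i \<and> w a = j}"
  unfolding pmon_def by (subst lookup_sum_unit_single) auto

lemma pmon_box:
  assumes "A \<subseteq> {..<k}" "w \<in> lwords n k"
  shows "keys (pmon A w) \<subseteq> box"
proof
  fix v assume v: "v \<in> keys (pmon A w)"
  have fin: "finite A" using finite_subset[OF assms(1)] by simp
  obtain i j where ij: "v = (i, j)" by (cases v)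
  have "card {a \<in> A. row a = i \<and> w a = j} \<noteq> 0"
    using v fin unfolding ij by (simp add: in_keys_iff lookup_pmon)
  hence "{a \<in> A. row a = i \<and> w a = j} \<noteq> {}" by (metis card.empty)
  then obtain a where "a \<in> A" "row a = i" "w a = j" by blast
  thus "v \<in> box" using assms row_less unfolding ij box_def lwords_def by auto
qed

lemma mon_monos:
  assumes "w \<in> lwords n k"
  shows "mon w \<in> dmonos"
  unfolding dmonos_def
proof (intro CollectI conjI allI impI)
  show "keys (mon w) \<subseteq> box" by (rule pmon_box[OF order_refl assms])
  fix i assume i: "i < r"
  have "card {a. a < k \<and> row a = i} = (\<Sum>j<n. card {a. a < k \<and> row a = i \<and> w a = j})"
    by (rule card_by_column) (use assms in \<open>auto simp: lwords_def\<close>)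
  thus "(\<Sum>j<n. lookup (mon w) (i, j)) = lookup d i" using card_row[OF i] by (simp add: lookup_pmon)
qed

text \<open>The positions belonging to row \<open>i\<close> are distributed over the columns in the
  numbers prescribed by the exponents.\<close>

lemma mon_surj:
  assumes "m \<in> dmonos"
  obtains w where "w \<in> lwords n k" "mon w = m"
proof -
  have "\<forall>i\<in>{..<r}. \<exists>w. (\<forall>a<k. row a = i \<longrightarrow> w a < n) \<and> (\<forall>j<n. card {a. a < k \<and> row a = i \<and> w a = j} = lookup m (i, j))"
  proof
    fix i assume i: "i \<in> {..<r}"
    let ?A = "{a. a < k \<and> row a = i}"
    have "(\<Sum>j\<in>{..<n}. lookup m (i, j)) = card ?A" using i assms card_row[of i] unfolding dmonos_def by simp
    then obtain w where w: "\<forall>a\<in>?A. w a \<in> {..<n}" "\<forall>j\<in>{..<n}. card {a \<in> ?A. w a = j} = lookup m (i, j)"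
      using exists_with_fibres[of ?A "{..<n}" "\<lambda>j. lookup m (i, j)"] by auto
    have "{a \<in> ?A. w a = j} = {a. a < k \<and> row a = i \<and> w a = j}" for j by auto
    thus "\<exists>w. (\<forall>a<k. row a = i \<longrightarrow> w a < n) \<and> (\<forall>j<n. card {a. a < k \<and> row a = i \<and> w a = j} = lookup m (i, j))"
      using w by (intro exI[of _ w]) auto
  qed
  from bchoice[OF this] obtain f
    where "\<forall>i\<in>{..<r}. (\<forall>a<k. row a = i \<longrightarrow> f i a < n) \<and> (\<forall>j<n. card {a. a < k \<and> row a = i \<and> f i a = j} = lookup m (i, j))"
    by blast
  hence f: "\<And>i a. i < r \<Longrightarrow> a < k \<Longrightarrow> row a = i \<Longrightarrow> f i a < n"
    "\<And>i j. i < r \<Longrightarrow> j < n \<Longrightarrow> card {a. a < k \<and> row a = i \<and> f i a = j} = lookup m (i, j)"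
    by auto
  define w where "w = (\<lambda>a. if a < k then f (row a) a else n)"
  have w: "w \<in> lwords n k" unfolding lwords_def w_def using f(1) row_less by auto
  moreover have "mon w = m"
  proof (rule poly_mapping_eqI)
    fix v :: "nat \<times> nat"
    obtain i j where v: "v = (i, j)" by (cases v)
    show "lookup (mon w) v = lookup m v"
    proof (cases "v \<in> box")
      case True
      hence ij: "i < r" "j < n" unfolding v box_def by auto
      have "{a \<in> {..<k}. row a = i \<and> w a = j} = {a. a < k \<and> row a = i \<and> f i a = j}" by (auto simp: w_def)
      thus ?thesis using f(2)[OF ij] unfolding v by (simp add: lookup_pmon)
    next
      case False
      hence "v \<notin> keys (mon w)" "v \<notin> keys m" using pmon_box[OF order_refl w] assms unfolding dmonos_def by auto
      thus ?thesis by (simp add: in_keys_iff)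
    qed
  qed
  ultimately show ?thesis using that by blast
qed

lemma monos_eq: "dmonos = mon ` lwords n k"
  using mon_monos mon_surj by blast

lemma finite_monos: "finite dmonos"
  unfolding monos_eq using finite_lwords by simp

lemma mon_stab:
  assumes "h \<in> stab k row"
  shows "mon (w \<circ> app h) = mon w"
proof -
  have "mon (w \<circ> app h) = (\<Sum>a<k. Poly_Mapping.single (row (app h a), w (app h a)) 1)"
    unfolding pmon_def using assms by (intro sum.cong refl) (auto simp: stab_def)
  also have "\<dots> = mon w"
    unfolding pmon_def by (rule sum_symb[OF stab_symb[OF assms], of "\<lambda>a. Poly_Mapping.single (row a, w a) 1"])
  finally show ?thesis .
qed

text \<open>Equal monomials have equal multisets of row-column pairs, so a permutation matching the
  pairs preserves \<open>row\<close>. Together with \<open>mon_stab\<close>, monomials are the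
  orbits of words under the stabilizer of \<open>row\<close>.\<close>

lemma mon_eqD:
  assumes w: "w \<in> lwords n k" "w' \<in> lwords n k" and eq: "mon w = mon w'"
  obtains h where "h \<in> stab k row" "w' = w \<circ> app h"
proof -
  have "image_mset (\<lambda>a. (row a, w' a)) (mset_set {..<k}) = image_mset (\<lambda>a. (row a, w a)) (mset_set {..<k})"
  proof (rule multiset_eqI)
    fix v :: "nat \<times> nat"
    obtain i j where v: "v = (i, j)" by (cases v)
    have "card {a \<in> {..<k}. row a = i \<and> w a = j} = card {a \<in> {..<k}. row a = i \<and> w' a = j}"
      using arg_cong[OF eq, of "\<lambda>m. lookup m (i, j)"] by (simp add: lookup_pmon)
    thus "count (image_mset (\<lambda>a. (row a, w' a)) (mset_set {..<k})) v =
      count (image_mset (\<lambda>a. (row a, w a)) (mset_set {..<k})) v"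
      unfolding v by (simp add: count_image_mset' eq_commute[of i] eq_commute[of j])
  qed
  from image_mset_eq_implies_permutes[OF _ this]
  obtain p where p: "p permutes {..<k}" "\<forall>a\<in>{..<k}. (row a, w' a) = (row (p a), w (p a))" by auto
  obtain h where h: "h \<in> symb k" "p = app h" using perms_eq_app p(1) by blast
  have hp: "row (app h a) = row a" "w' a = w (app h a)" if "a < k" for a
    using bspec[OF p(2), of a] that unfolding h(2) by (simp_all only: lessThan_iff prod.inject simp_thms)
  have "h \<in> stab k row" unfolding stab_def using hp(1) h(1) by blast
  moreover have "w' = w \<circ> app h"
  proof
    fix a show "w' a = (w \<circ> app h) a"
      using hp(2) symb_fix[OF h(1), of a] w unfolding lwords_def by (cases "a < k") auto
  qed
  ultimately show ?thesis using that by blast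
qed

lemma mon_comp: "\<sigma> \<in> perms n \<Longrightarrow> mon (\<sigma> \<circ> w) = ren \<sigma> (mon w)"
  unfolding pmon_def by (simp add: ren_sum perms_bij[of _ n] ren_single)

lemma mon_split: "A \<subseteq> {..<k} \<Longrightarrow> mon w = pmon ({..<k} - A) w + pmon A w"
  unfolding pmon_def by (rule sum.subset_diff) auto

lemma mon_upd:
  assumes A: "A \<subseteq> {..<k}" and \<sigma>: "\<sigma> \<in> perms n"
  shows "mon (upd A \<sigma> w) = pmon ({..<k} - A) w + ren \<sigma> (pmon A w)"
proof -
  have "pmon ({..<k} - A) (upd A \<sigma> w) = pmon ({..<k} - A) w"
    unfolding pmon_def by (intro sum.cong refl) (auto simp: upd_def)
  moreover have "pmon A (upd A \<sigma> w) = ren \<sigma> (pmon A w)"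
    unfolding pmon_def ren_sum[OF perms_bij[OF \<sigma>]] ren_single by (intro sum.cong refl) (auto simp: upd_def)
  ultimately show ?thesis using mon_split[OF A, of "upd A \<sigma> w"] by simp
qed

abbreviation H :: "cpoly set" where "H \<equiv> harmonics_deg r n d"

lemma harmonics_deg_iff:
  "g \<in> H \<longleftrightarrow> keys g \<subseteq> dmonos \<and> (\<forall>b m. b \<noteq> 0 \<longrightarrow> keys b \<subseteq> box \<longrightarrow> (\<Sum>\<sigma>\<in>perms n. dpc g (m + ren \<sigma> b)) = 0)"
proof -
  have "g \<in> H \<longleftrightarrow> g \<in> poly_ring r n \<and> keys g \<subseteq> dmonos \<and> g \<in> harmonics r n"
    unfolding harmonics_deg_def dmonos_def poly_ring_def harmonics_def box_def by auto
  also have "\<dots> \<longleftrightarrow> keys g \<subseteq> dmonos \<and> (\<forall>b m. b \<noteq> 0 \<longrightarrow> keys b \<subseteq> box \<longrightarrow> (\<Sum>\<sigma>\<in>perms n. dpc g (m + ren \<sigma> b)) = 0)"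
  proof -
    have "keys g \<subseteq> dmonos \<Longrightarrow> g \<in> poly_ring r n" unfolding dmonos_def poly_ring_def box_def by auto
    thus ?thesis using harmonic_iff[of g r n] unfolding box_def by blast
  qed
  finally show ?thesis .
qed

lemma dpc_monos: "keys g \<subseteq> dmonos \<Longrightarrow> m \<notin> dmonos \<Longrightarrow> dpc g m = 0"
  unfolding dpc_def by (auto simp: in_keys_iff)

lemma ren_monos:
  assumes \<sigma>: "\<sigma> \<in> perms n" and m: "m \<in> dmonos"
  shows "ren \<sigma> m \<in> dmonos"
proof -
  obtain w where w: "w \<in> lwords n k" "mon w = m" using mon_surj[OF m] .
  thus ?thesis using mon_comp[OF \<sigma>, of w] mon_monos[OF lwords_comp[OF \<sigma> w(1)]] by simp
qed

lemma submodule_H: "submodule n act_poly H"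
  unfolding submodule_def
proof (intro conjI allI impI ballI)
  show "cvec.subspace H"
  proof (rule cvec.subspaceI)
    show "0 \<in> H" unfolding harmonics_deg_iff by (simp add: dpc_0)
    show "x + y \<in> H" if x: "x \<in> H" and y: "y \<in> H" for x y
      unfolding harmonics_deg_iff
    proof (intro conjI allI impI)
      show "keys (x + y) \<subseteq> dmonos"
        using x y Poly_Mapping.keys_add[of x y] unfolding harmonics_deg_iff by blast
      fix b m :: mono assume "b \<noteq> 0" "keys b \<subseteq> box"
      hence "(\<Sum>\<sigma>\<in>perms n. dpc x (m + ren \<sigma> b)) = 0" "(\<Sum>\<sigma>\<in>perms n. dpc y (m + ren \<sigma> b)) = 0"
        using x y unfolding harmonics_deg_iff by blast+
      thus "(\<Sum>\<sigma>\<in>perms n. dpc (x + y) (m + ren \<sigma> b)) = 0" by (simp add: dpc_add sum.distrib)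
    qed
    show "cscale c x \<in> H" if x: "x \<in> H" for c x
      unfolding harmonics_deg_iff
    proof (intro conjI allI impI)
      show "keys (cscale c x) \<subseteq> dmonos" using x unfolding harmonics_deg_iff by (auto simp: in_keys_iff)
      fix b m :: mono assume "b \<noteq> 0" "keys b \<subseteq> box"
      hence "(\<Sum>\<sigma>\<in>perms n. dpc x (m + ren \<sigma> b)) = 0" using x unfolding harmonics_deg_iff by blast
      thus "(\<Sum>\<sigma>\<in>perms n. dpc (cscale c x) (m + ren \<sigma> b)) = 0" by (simp add: dpc_cscale sum_distrib_left[symmetric])
    qed
  qed
next
  fix \<tau> g assume "\<tau> permutes {..<n}" and g: "g \<in> H"
  hence \<tau>: "\<tau> \<in> perms n" by simp
  note b\<tau> = perms_bij[OF \<tau>] and i\<tau> = perms_inv[OF \<tau>]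
  show "act_poly \<tau> g \<in> H"
    unfolding harmonics_deg_iff
  proof (intro conjI allI impI subsetI)
    fix m assume "m \<in> keys (act_poly \<tau> g)"
    hence "ren (inv \<tau>) m \<in> dmonos" using g unfolding harmonics_deg_iff by (auto simp: in_keys_iff lookup_act_poly[OF b\<tau>])
    hence "ren \<tau> (ren (inv \<tau>) m) \<in> dmonos" by (rule ren_monos[OF \<tau>])
    thus "m \<in> dmonos" using ckey.F_inv(2)[OF b\<tau>] by simp
  next
    fix b m :: mono assume b: "b \<noteq> 0" "keys b \<subseteq> box"
    have "(\<Sum>\<sigma>\<in>perms n. dpc (act_poly \<tau> g) (m + ren \<sigma> b)) =
      (\<Sum>\<sigma>\<in>perms n. dpc g (ren (inv \<tau>) m + ren (inv \<tau> \<circ> \<sigma>) b))"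
    proof (intro sum.cong refl)
      fix \<sigma> assume "\<sigma> \<in> perms n"
      hence "ren (inv \<tau>) (m + ren \<sigma> b) = ren (inv \<tau>) m + ren (inv \<tau> \<circ> \<sigma>) b"
        by (simp only: ren_add[OF perms_bij[OF i\<tau>]] ckey.F_comp[OF perms_bij[OF i\<tau>] perms_bij])
      thus "dpc (act_poly \<tau> g) (m + ren \<sigma> b) = dpc g (ren (inv \<tau>) m + ren (inv \<tau> \<circ> \<sigma>) b)"
        by (simp only: dpc_act_poly[OF b\<tau>])
    qed
    also have "\<dots> = (\<Sum>\<sigma>\<in>perms n. dpc g (ren (inv \<tau>) m + ren \<sigma> b))"
      by (rule sum_perms_comp[OF i\<tau>, of "\<lambda>\<sigma>. dpc g (ren (inv \<tau>) m + ren \<sigma> b)"])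
    also have "\<dots> = 0" using g b unfolding harmonics_deg_iff by blast
    finally show "(\<Sum>\<sigma>\<in>perms n. dpc (act_poly \<tau> g) (m + ren \<sigma> b)) = 0" .
  qed
qed

lemma fd_H: "fd H"
  by (rule fd_supported[OF finite_monos]) (auto simp: harmonics_deg_iff)

text \<open>Polarization in coordinates. With divided powers, the coefficient at a word equals that
  at its monomial, and no multinomial factors appear.\<close>

definition pol :: "cpoly \<Rightarrow> ((nat \<Rightarrow> nat) \<Rightarrow>\<^sub>0 complex)" where
  "pol g = (\<Sum>w\<in>lwords n k. Poly_Mapping.single w (dpc g (mon w)))"

lemma lookup_pol: "lookup (pol g) w = (if w \<in> lwords n k then dpc g (mon w) else 0)"
proof -
  have "lookup (pol g) w = (\<Sum>u\<in>lwords n k. if u = w then dpc g (mon w) else 0)"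
    unfolding pol_def lookup_sum by (intro sum.cong) (auto simp: lookup_single when_def)
  thus ?thesis using finite_lwords by simp
qed

lemma pol_linear: "clinear pol"
  by (rule clinearI) (auto intro!: poly_mapping_eqI simp: lookup_pol lookup_add dpc_add dpc_cscale)

lemma pol_inj: "inj_on pol H"
proof (rule inj_onI)
  fix g g' assume g: "g \<in> H" "g' \<in> H" "pol g = pol g'"
  show "g = g'"
  proof (rule poly_mapping_eqI)
    fix m show "lookup g m = lookup g' m"
    proof (cases "m \<in> dmonos")
      case True
      then obtain w where w: "w \<in> lwords n k" "mon w = m" using mon_surj by blast
      have "dpc g m = dpc g' m" using arg_cong[OF g(3), of "\<lambda>c. lookup c w"] w by (simp add: lookup_pol)
      thus ?thesis unfolding dpc_def using mfact_nonzero by simp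
    next
      case False
      thus ?thesis using g(1,2) unfolding harmonics_deg_iff by (metis in_keys_iff subsetD)
    qed
  qed
qed

lemma pol_act:
  assumes \<sigma>: "\<sigma> \<in> perms n"
  shows "pol (act_poly \<sigma> g) = lact \<sigma> (pol g)"
proof (rule poly_mapping_eqI)
  fix w
  note b = perms_bij[OF \<sigma>] and i = perms_inv[OF \<sigma>]
  have "inv \<sigma> \<circ> w \<in> lwords n k \<longleftrightarrow> w \<in> lwords n k"
  proof
    assume "inv \<sigma> \<circ> w \<in> lwords n k"
    from lwords_comp[OF \<sigma> this] show "w \<in> lwords n k" using b by (simp add: o_assoc bij_is_surj surj_iff[THEN iffD1])
  qed (rule lwords_comp[OF i])
  thus "lookup (pol (act_poly \<sigma> g)) w = lookup (lact \<sigma> (pol g)) w"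
    by (simp add: lookup_lact[OF b] lookup_pol dpc_act_poly[OF b] mon_comp[OF i])
qed

definition invariant_words :: "((nat \<Rightarrow> nat) \<Rightarrow>\<^sub>0 complex) set \<Rightarrow> ((nat \<Rightarrow> nat) \<Rightarrow>\<^sub>0 complex) set" where
  "invariant_words N = {c \<in> N. \<forall>h\<in>stab k row. wact (app h) c = c}"

text \<open>The relation of \<open>hwords\<close> for \<open>A\<close> and \<open>w\<close> is the
  harmonicity relation with \<open>b\<close> the monomial on the positions of \<open>A\<close> and
  \<open>m\<close> the monomial on the remaining ones.\<close>

lemma pol_invariant:
  assumes g: "g \<in> H"
  shows "pol g \<in> invariant_words (hwords n k)"
  unfolding invariant_words_def hwords_def
proof (intro CollectI conjI allI impI ballI)
  show "keys (pol g) \<subseteq> lwords n k" by (auto simp: in_keys_iff lookup_pol split: if_splits)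
  fix A w assume A: "A \<subseteq> {..<k}" "A \<noteq> {}" and w: "w \<in> lwords n k"
  have finA: "finite A" using finite_subset[OF A(1)] by simp
  have "pmon A w \<noteq> 0"
  proof -
    obtain a where a: "a \<in> A" using A(2) by blast
    have "card {b \<in> A. row b = row a \<and> w b = w a} \<noteq> 0" using a finA by auto
    hence "lookup (pmon A w) (row a, w a) \<noteq> 0" using finA by (simp add: lookup_pmon)
    thus ?thesis by auto
  qed
  moreover have "keys (pmon A w) \<subseteq> box" by (rule pmon_box[OF A(1) w])
  ultimately have "(\<Sum>\<sigma>\<in>perms n. dpc g (pmon ({..<k} - A) w + ren \<sigma> (pmon A w))) = 0"
    using g unfolding harmonics_deg_iff by blast
  moreover have "lookup (pol g) (upd A \<sigma> w) = dpc g (pmon ({..<k} - A) w + ren \<sigma> (pmon A w))" if "\<sigma> \<in> perms n" for \<sigma>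
    by (simp add: lookup_pol lwords_upd[OF that w] mon_upd[OF A(1) that])
  ultimately show "(\<Sum>\<sigma>\<in>perms n. lookup (pol g) (upd A \<sigma> w)) = 0" by simp
next
  fix h assume h: "h \<in> stab k row"
  have hk: "app h \<in> perms k" "inv (app h) \<in> perms k"
    using stab_symb[OF h] stab_symb[OF stab_closed(3)[OF h]] unfolding symb_def by auto
  show "wact (app h) (pol g) = pol g"
  proof (rule poly_mapping_eqI)
    fix w
    have "w \<circ> app h \<in> lwords n k \<longleftrightarrow> w \<in> lwords n k"
    proof
      assume "w \<circ> app h \<in> lwords n k"
      from lwords_comp_right[OF hk(2) this] show "w \<in> lwords n k"
        by (simp add: o_assoc[symmetric] bij_is_surj surj_iff[THEN iffD1])
    qed (rule lwords_comp_right[OF hk(1)])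
    thus "lookup (wact (app h) (pol g)) w = lookup (pol g) w"
      by (simp add: lookup_wact lookup_pol mon_stab[OF h])
  qed
qed

text \<open>A function invariant under the stabilizer of \<open>row\<close> descends to monomials
  through representatives \<open>wof m\<close>; dividing by \<open>mfact m\<close> undoes the
  divided powers.\<close>

lemma pol_surj:
  assumes c: "c \<in> invariant_words (hwords n k)"
  shows "c \<in> pol ` H"
proof -
  have "\<forall>m\<in>dmonos. \<exists>w. w \<in> lwords n k \<and> mon w = m" using mon_surj by metis
  then obtain wof where wof: "\<And>m. m \<in> dmonos \<Longrightarrow> wof m \<in> lwords n k" "\<And>m. m \<in> dmonos \<Longrightarrow> mon (wof m) = m" by metis
  define g :: cpoly where "g = (\<Sum>m\<in>dmonos. Poly_Mapping.single m (lookup c (wof m) / mfact m))"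
  have lg: "lookup g m = (if m \<in> dmonos then lookup c (wof m) / mfact m else 0)" for m
  proof -
    have "lookup g m = (\<Sum>u\<in>dmonos. if u = m then lookup c (wof m) / mfact m else 0)"
      unfolding g_def lookup_sum by (intro sum.cong) (auto simp: lookup_single when_def)
    thus ?thesis using finite_monos by simp
  qed
  have kg: "keys g \<subseteq> dmonos" by (auto simp: in_keys_iff lg split: if_splits)
  have dg: "dpc g (mon w) = lookup c w" if w: "w \<in> lwords n k" for w
  proof -
    have m: "mon w \<in> dmonos" by (rule mon_monos[OF w])
    obtain h where h: "h \<in> stab k row" "wof (mon w) = w \<circ> app h"
      using mon_eqD[OF w wof(1)[OF m] wof(2)[OF m, symmetric]] .
    have "lookup c (w \<circ> app h) = lookup (wact (app h) c) w" by (simp add: lookup_wact)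
    also have "\<dots> = lookup c w" using c h(1) unfolding invariant_words_def by simp
    finally show ?thesis using m mfact_nonzero[of "mon w"] by (simp add: dpc_def lg h(2))
  qed
  have "g \<in> H" unfolding harmonics_deg_iff
  proof (intro conjI kg allI impI)
    fix b m :: mono assume b: "b \<noteq> 0" "keys b \<subseteq> box"
    show "(\<Sum>\<sigma>\<in>perms n. dpc g (m + ren \<sigma> b)) = 0"
    proof (cases "m + b \<in> dmonos")
      case True
      let ?w = "wof (m + b)"
      have w: "?w \<in> lwords n k" "mon ?w = m + b" using wof True by auto
      \<comment> \<open>The factor \<open>b\<close> occupies a set of positions of the word
        representing \<open>m + b\<close>.\<close>
      obtain A where A: "A \<subseteq> {..<k}" "pmon A ?w = b"
        using sub_sum_single[of "{..<k}" "\<lambda>a. (row a, ?w a)" m b] w(2) unfolding pmon_def by auto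
      have m: "pmon ({..<k} - A) ?w = m" using mon_split[OF A(1), of ?w] A(2) w(2) by simp
      have "A \<noteq> {}" using A(2) b(1) by (auto simp: pmon_def)
      hence "(\<Sum>\<sigma>\<in>perms n. lookup c (upd A \<sigma> ?w)) = 0"
        using c A(1) w(1) unfolding invariant_words_def hwords_def by blast
      moreover have "dpc g (m + ren \<sigma> b) = lookup c (upd A \<sigma> ?w)" if "\<sigma> \<in> perms n" for \<sigma>
        using mon_upd[OF A(1) that, of ?w] dg[OF lwords_upd[OF that w(1), of A]] unfolding A(2) m by simp
      ultimately show ?thesis by simp
    next
      case False
      \<comment> \<open>Renaming columns preserves the multidegree and the box, so either all terms
        of the sum lie in \<open>dmonos\<close> or none does.\<close>
      have "m + ren \<sigma> b \<notin> dmonos" if \<sigma>: "\<sigma> \<in> perms n" for \<sigma>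
      proof
        assume mm: "m + ren \<sigma> b \<in> dmonos"
        have "keys m \<subseteq> keys (m + ren \<sigma> b)" by (auto simp: in_keys_iff lookup_add)
        hence "keys m \<subseteq> box" using mm unfolding dmonos_def by blast
        hence "keys (m + b) \<subseteq> box" using b(2) Poly_Mapping.keys_add[of m b] by blast
        moreover have "(\<Sum>j<n. lookup (m + b) (i, j)) = lookup d i" if "i < r" for i
        proof -
          have "(\<Sum>j<n. lookup b (i, inv \<sigma> j)) = (\<Sum>j<n. lookup b (i, j))"
            using perms_inv[OF \<sigma>]
            by (intro sum.reindex_bij_betw permutes_imp_bij) simp
          moreover have "(\<Sum>j<n. lookup (m + ren \<sigma> b) (i, j)) = lookup d i" using mm that unfolding dmonos_def by blast
          ultimately show ?thesis by (simp add: lookup_add sum.distrib lookup_ren[OF perms_bij[OF \<sigma>]])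
        qed
        ultimately show False using False unfolding dmonos_def by blast
      qed
      thus ?thesis using dpc_monos[OF kg] by (intro sum.neutral) blast
    qed
  qed
  moreover have "pol g = c"
  proof (rule poly_mapping_eqI)
    fix w show "lookup (pol g) w = lookup c w"
      using dg[of w] c unfolding invariant_words_def hwords_def by (auto simp: lookup_pol in_keys_iff)
  qed
  ultimately show ?thesis by blast
qed

text \<open>\<open>pol\<close> is an equivariant isomorphism of \<open>H\<close> onto the invariants
  in \<open>hwords n k\<close>, so an annihilator condition on \<open>g\<close> is the same
  condition on \<open>pol g\<close>.\<close>

theorem dim_hom_image_harmonics:
  "cvec.dim (hom_image n actS s act_poly H) = cvec.dim (invariant_words (hom_image n actS s lact (hwords n k)))"
proof -
  have gp: "pol (gact n act_poly x g) = gact n lact x (pol g)" for x g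
    unfolding gact_def clinear_sum_scale[OF pol_linear] by (intro sum.cong refl) (simp add: pol_act)
  have iff: "gact n act_poly x g = 0 \<longleftrightarrow> gact n lact x (pol g) = 0" if g: "g \<in> H" for x g
  proof -
    have "gact n act_poly x g \<in> H" using crep.submodule_gact[OF submodule_H g] .
    moreover have "0 \<in> H" using submodule_H cvec.subspace_0 unfolding submodule_def by blast
    ultimately have "gact n act_poly x g = 0 \<longleftrightarrow> pol (gact n act_poly x g) = pol 0"
      using inj_on_eq_iff[OF pol_inj] by blast
    thus ?thesis by (simp add: gp cpair.linear_0[OF pol_linear])
  qed
  have "pol ` hom_image n actS s act_poly H = invariant_words (hom_image n actS s lact (hwords n k))"
  proof (intro equalityI subsetI)
    fix c assume "c \<in> pol ` hom_image n actS s act_poly H"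
    then obtain g where g: "g \<in> hom_image n actS s act_poly H" "c = pol g" by blast
    have gH: "g \<in> H" using g(1) unfolding hom_image_def by blast
    show "c \<in> invariant_words (hom_image n actS s lact (hwords n k))"
      using pol_invariant[OF gH] g(1) iff[OF gH] unfolding g(2) invariant_words_def hom_image_def by simp
  next
    fix c assume c: "c \<in> invariant_words (hom_image n actS s lact (hwords n k))"
    hence "c \<in> invariant_words (hwords n k)" unfolding invariant_words_def hom_image_def by blast
    then obtain g where g: "g \<in> H" "c = pol g" using pol_surj by blast
    have "g \<in> hom_image n actS s act_poly H"
      using c g iff[OF g(1)] unfolding invariant_words_def hom_image_def by simp
    thus "c \<in> pol ` hom_image n actS s act_poly H" using g(2) by blast
  qed
  moreover have "cvec.subspace (hom_image n actS s act_poly H)"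
    by (rule crep.subspace_hom_image) (use submodule_H in \<open>auto simp: submodule_def\<close>)
  moreover have "inj_on pol (hom_image n actS s act_poly H)"
    by (rule inj_on_subset[OF pol_inj]) (auto simp: hom_image_def)
  ultimately show ?thesis using dim_linear_inj[OF pol_linear] by metis
qed

end

section \<open>The graded Frobenius characteristic\<close>

definition row_lengths :: "nat list \<Rightarrow> nat \<Rightarrow> nat" where
  "row_lengths \<mu> i = (if i < length \<mu> then \<mu> ! i else 0)"

lemma partitionsD:
  assumes "\<mu> \<in> partitions k"
  shows "\<And>i j. i < j \<Longrightarrow> j < length \<mu> \<Longrightarrow> \<mu> ! j \<le> \<mu> ! i" "\<And>i. i < length \<mu> \<Longrightarrow> \<mu> ! i \<noteq> 0" "sum_list \<mu> = k"
proof -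
  have p: "sorted_wrt (\<ge>) \<mu>" "0 \<notin> set \<mu>" "sum_list \<mu> = k" using assms unfolding partitions_def by auto
  show "\<mu> ! j \<le> \<mu> ! i" if "i < j" "j < length \<mu>" for i j
    using p(1) that by (simp add: sorted_wrt_iff_nth_less)
  show "\<mu> ! i \<noteq> 0" if "i < length \<mu>" for i using p(2) nth_mem[OF that] by metis
  show "sum_list \<mu> = k" by (rule p(3))
qed

lemma row_lengths_shapes:
  assumes "\<mu> \<in> partitions k"
  shows "row_lengths \<mu> \<in> shapes k"
proof -
  have "antimono (row_lengths \<mu>)"
  proof (rule antimonoI)
    fix i j :: nat assume "i \<le> j"
    thus "row_lengths \<mu> j \<le> row_lengths \<mu> i"
      using partitionsD(1)[OF assms, of i j] by (cases "i = j") (auto simp: row_lengths_def)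
  qed
  hence p: "is_part (row_lengths \<mu>)"
    unfolding is_part_def by (auto simp: row_lengths_def intro!: exI[of _ "length \<mu>"])
  have "psize (row_lengths \<mu>) = (\<Sum>i<length \<mu>. row_lengths \<mu> i)"
    by (rule psize_eq[OF p]) (simp add: row_lengths_def)
  also have "\<dots> = k"
    using partitionsD(3)[OF assms] by (simp add: row_lengths_def sum_list_sum_nth atLeast0LessThan)
  finally show ?thesis using p unfolding shapes_def by blast
qed

lemma row_lengths_bij: "bij_betw row_lengths (partitions k) (shapes k)"
  unfolding bij_betw_def
proof (intro conjI equalityI subsetI)
  show "inj_on row_lengths (partitions k)"
  proof (rule inj_onI)
    fix \<mu> \<nu> assume m: "\<mu> \<in> partitions k" "\<nu> \<in> partitions k" "row_lengths \<mu> = row_lengths \<nu>"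
    have "i < length \<mu> \<longleftrightarrow> i < length \<nu>" for i
      using fun_cong[OF m(3), of i] partitionsD(2)[OF m(1), of i] partitionsD(2)[OF m(2), of i]
      by (auto simp: row_lengths_def split: if_splits)
    hence len: "length \<mu> = length \<nu>" by (metis less_irrefl nat_neq_iff)
    show "\<mu> = \<nu>"
    proof (rule nth_equalityI[OF len])
      fix i assume "i < length \<mu>"
      thus "\<mu> ! i = \<nu> ! i" using fun_cong[OF m(3), of i] len by (simp add: row_lengths_def)
    qed
  qed
  show "f \<in> shapes k" if "f \<in> row_lengths ` partitions k" for f using that row_lengths_shapes by blast
  fix f assume f: "f \<in> shapes k"
  note p = shapesD(1)[OF f]
  define N where "N = (LEAST N. f N = 0)"
  have N0: "f N = 0" unfolding N_def by (rule LeastI_ex) (use p in \<open>auto simp: is_part_def\<close>)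
  have nz: "f i \<noteq> 0" if "i < N" for i using not_less_Least[of i "\<lambda>N. f N = 0"] that unfolding N_def by blast
  let ?\<mu> = "map f [0..<N]"
  have "row_lengths ?\<mu> = f" using is_part_zero[OF p N0] by (auto simp: row_lengths_def fun_eq_iff)
  moreover have "?\<mu> \<in> partitions k" unfolding partitions_def
  proof (intro CollectI conjI)
    show "sorted_wrt (\<ge>) ?\<mu>"
      using is_part_antimono[OF p] by (auto simp: sorted_wrt_iff_nth_less)
    show "0 \<notin> set ?\<mu>" using nz by force
    show "sum_list ?\<mu> = k"
      using psize_eq[OF p N0] shapesD(2)[OF f] by (simp add: sum_list_sum_nth atLeast0LessThan)
  qed
  ultimately show "f \<in> row_lengths ` partitions k" by (metis imageI)
qed

lemma length_le_iff: "\<mu> \<in> partitions k \<Longrightarrow> length \<mu> \<le> n \<longleftrightarrow> row_lengths \<mu> n = 0"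
  using partitionsD(2)[of \<mu> k n] by (auto simp: row_lengths_def not_less)

lemma finite_partitions: "finite (partitions k)"
  using bij_betw_finite[OF row_lengths_bij] by simp

lemma cells_row_lengths: "cells \<mu> = fcells (row_lengths \<mu>)"
  unfolding cells_def fcells_def row_lengths_def by (auto split: if_splits)

lemma schur_polynomial_kostka:
  assumes \<mu>: "\<mu> \<in> partitions k"
  shows "schur_polynomial r \<mu> d = (if keys d \<subseteq> {..<r} then kostka (row_lengths \<mu>) r (lookup d) else 0)"
proof -
  note p = shapesD(1)[OF row_lengths_shapes[OF \<mu>]]
  have "j < row_lengths \<mu> i \<and> j < row_lengths \<mu> (Suc i) \<longleftrightarrow> j < row_lengths \<mu> (Suc i)" for i j
    using is_part_antimono[OF p, of i "Suc i"] by auto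
  moreover have "j < row_lengths \<mu> i \<and> Suc j < row_lengths \<mu> i \<longleftrightarrow> Suc j < row_lengths \<mu> i" for i j
    by auto
  ultimately have sem: "semistandard \<mu> T \<longleftrightarrow> sstd (row_lengths \<mu>) T" for T
    unfolding semistandard_def sstd_def cells_row_lengths fcells_def mem_Collect_eq case_prod_conv by (simp only:)
  have con: "(\<forall>i. card {c \<in> fcells (row_lengths \<mu>). T c = i} = lookup d i) \<longleftrightarrow>
      keys d \<subseteq> {..<r} \<and> (\<forall>i<r. card {c \<in> fcells (row_lengths \<mu>). T c = i} = lookup d i)"
    if T: "T \<in> fcells (row_lengths \<mu>) \<rightarrow>\<^sub>E {..<r}" for T
  proof -
    have lt: "T c < r" if "c \<in> fcells (row_lengths \<mu>)" for c using PiE_mem[OF T that] by simp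
    have z: "card {c \<in> fcells (row_lengths \<mu>). T c = i} = 0" if "\<not> i < r" for i
    proof -
      have "{c \<in> fcells (row_lengths \<mu>). T c = i} = {}" using lt that by blast
      thus ?thesis by (simp only: card.empty)
    qed
    show ?thesis
    proof (intro iffI conjI allI impI subsetI)
      fix i assume "\<forall>i. card {c \<in> fcells (row_lengths \<mu>). T c = i} = lookup d i" "i \<in> keys d"
      thus "i \<in> {..<r}" using z[of i] by (auto simp: in_keys_iff)
    next
      fix i assume "keys d \<subseteq> {..<r} \<and> (\<forall>i<r. card {c \<in> fcells (row_lengths \<mu>). T c = i} = lookup d i)"
      thus "card {c \<in> fcells (row_lengths \<mu>). T c = i} = lookup d i"
        using z[of i] by (cases "i < r") (auto simp: in_keys_iff subset_iff)
    qed auto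
  qed
  have "{T \<in> cells \<mu> \<rightarrow>\<^sub>E {..<r}. semistandard \<mu> T \<and> (\<forall>i. card {c \<in> cells \<mu>. T c = i} = lookup d i)} =
    (if keys d \<subseteq> {..<r} then ssyt (row_lengths \<mu>) r (lookup d) else {})" (is "?L = ?R")
  proof (rule set_eqI)
    fix T show "T \<in> ?L \<longleftrightarrow> T \<in> ?R"
    proof (cases "T \<in> fcells (row_lengths \<mu>) \<rightarrow>\<^sub>E {..<r}")
      case True
      thus ?thesis unfolding ssyt_def cells_row_lengths mem_Collect_eq sem con[OF True] by simp
    qed (simp add: ssyt_def cells_row_lengths)
  qed
  thus ?thesis unfolding schur_polynomial_def schur_def kostka_def by simp
qed

lemma kostka_size:
  assumes f: "is_part f" and nz: "kostka f r d \<noteq> 0"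
  shows "psize f = (\<Sum>i<r. d i)"
proof -
  have "ssyt f r d \<noteq> {}" using nz unfolding kostka_def by auto
  then obtain T where T: "T \<in> fcells f \<rightarrow>\<^sub>E {..<r}" "\<forall>i<r. card {c \<in> fcells f. T c = i} = d i"
    unfolding ssyt_def by auto
  have "(\<Sum>i<r. \<Sum>c\<in>{c \<in> fcells f. T c = i}. 1::nat) = (\<Sum>c\<in>fcells f. 1)"
    by (rule sum.group) (use T(1) finite_fcells[OF f] in auto)
  thus ?thesis using T(2) card_fcells[OF f] by simp
qed

section \<open>Coefficients independent of \<open>r\<close> and the final formula\<close>

interpretation tkey: key_action "\<lambda>\<sigma> (t :: nat \<Rightarrow> nat set) i. \<sigma> ` t i"
  by unfold_locales (auto simp: image_comp)

interpretation trep: perm_rep act_tabloids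
  unfolding act_tabloids_def by (rule tkey.perm_rep)

interpretation trep_poly: perm_rep_pair act_tabloids act_poly ..

lemma hom_image_wact:
  assumes \<pi>: "\<pi> \<in> perms k" and v: "v \<in> hom_image n actS s lact (hwords n k)"
  shows "wact \<pi> v \<in> hom_image n actS s lact (hwords n k)"
proof -
  have b: "bij \<pi>" using \<pi> by (rule perms_bij)
  have "gact n lact x (wact \<pi> v) = wact \<pi> (gact n lact x v)" for x
    unfolding gact_def clinear_sum_scale[OF wrep.lin[OF b]]
    by (intro sum.cong refl) (simp add: lact_wact[OF perms_bij b])
  thus ?thesis using v wact_hwords[OF \<pi>] wrep.act_0[OF b] unfolding hom_image_def by auto
qed

text \<open>With \<open>s\<close> in the Specht module of \<open>\<lambda>\<close>, this is the
  candidate for the coefficient of \<open>\<lambda>\<close> and \<open>\<mu>\<close>; neither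
  \<open>r\<close> nor the multidegree enters.\<close>

definition mult_coeff :: "nat \<Rightarrow> ((nat \<Rightarrow> nat set) \<Rightarrow>\<^sub>0 complex) \<Rightarrow> nat \<Rightarrow> (nat \<Rightarrow> nat) \<Rightarrow> nat" where
  "mult_coeff n s k \<mu> = cvec.dim (wm (young k \<mu>) ` hom_image n act_tabloids s lact (hwords n k))"

lemma mult_coeff_eq_0:
  assumes \<mu>: "\<mu> \<in> shapes k" and "\<mu> n \<noteq> 0 \<or> k > n choose 2"
  shows "mult_coeff n s k \<mu> = 0"
proof -
  let ?N = "hom_image n act_tabloids s lact (hwords n k)"
  have "wm (young k \<mu>) c = 0" if c: "c \<in> ?N" for c
    using assms(2)
  proof
    assume n: "\<mu> n \<noteq> 0"
    show ?thesis
      by (rule wm_young_eq_0[OF \<mu> n]) (use c in \<open>auto simp: hom_image_def hwords_def lwords_def\<close>)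
  next
    assume "k > n choose 2"
    hence "c = 0" using hwords_eq_0[of c n k] c unfolding hom_image_def by blast
    thus ?thesis by (simp add: wrep.mact_0)
  qed
  hence "wm (young k \<mu>) ` ?N \<subseteq> cvec.span {}" by auto
  from cvec.dim_le_card[OF this] show ?thesis unfolding mult_coeff_def by simp
qed

lemma words_nonempty: "\<exists>w. w \<in> words r d (\<Sum>i<r. d i)"
proof -
  let ?k = "\<Sum>i<r. d i"
  have "\<exists>w. (\<forall>a\<in>{..<?k}. w a \<in> {..<r}) \<and> (\<forall>i\<in>{..<r}. card {a \<in> {..<?k}. w a = i} = d i)"
    by (rule exists_with_fibres) simp_all
  then obtain w where w: "\<forall>a\<in>{..<?k}. w a \<in> {..<r}" "\<forall>i\<in>{..<r}. card {a \<in> {..<?k}. w a = i} = d i" by blast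
  have "{a \<in> {..<?k}. restrict w {..<?k} a = i} = {a \<in> {..<?k}. w a = i}" for i by auto
  hence "restrict w {..<?k} \<in> words r d ?k"
    using w unfolding words_def by (simp add: PiE_iff)
  thus ?thesis by blast
qed

lemma multiplicity_harmonics:
  assumes S: "irreducible_module n act_tabloids S" "s \<in> S" "s \<noteq> 0" and d: "keys d \<subseteq> {..<r}"
    and k: "k = (\<Sum>i<r. lookup d i)"
  shows "multiplicity_in n act_tabloids S act_poly (harmonics_deg r n d) =
    (\<Sum>\<mu>\<in>shapes k. kostka \<mu> r (lookup d) * mult_coeff n s k \<mu>)"
proof -
  obtain row where row: "row \<in> words r (lookup d) k" using words_nonempty[of r "lookup d"] k by blast
  interpret polarization r n k d row by unfold_locales (rule row)
  let ?N = "hom_image n act_tabloids s lact (hwords n k)"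
  have N: "cvec.subspace ?N" by (rule lrep.subspace_hom_image[OF subspace_hwords])
  have "fd ?N" by (rule fd_subset[OF fd_hwords]) (auto simp: hom_image_def)
  have "multiplicity_in n act_tabloids S act_poly (harmonics_deg r n d) = cvec.dim (hom_image n act_tabloids s act_poly H)"
    by (rule trep_poly.multiplicity_in_eq_dim[OF S submodule_H fd_H])
  also have "\<dots> = cvec.dim (invariant_words ?N)" by (rule dim_hom_image_harmonics)
  also have "\<dots> = (\<Sum>\<mu>\<in>shapes k. kostka \<mu> r (lookup d) * mult_coeff n s k \<mu>)"
    unfolding invariant_words_def mult_coeff_def
    by (rule wrep.dim_invariants[OF N \<open>fd ?N\<close> hom_image_wact row])
  finally show ?thesis .
qed

theorem theorem2:
  fixes n :: nat
  assumes "n \<ge> 1"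
  shows "\<exists>b :: nat list \<Rightarrow> nat list \<Rightarrow> nat. \<forall>r\<ge>1. \<forall>d \<alpha>.
           graded_frobenius r n d \<alpha> =
             (\<Sum>\<nu>\<in>partitions n.
                (\<Sum>\<mu> | length \<mu> \<le> n \<and> (\<exists>k\<le>n choose 2. \<mu> \<in> partitions k).
                   b \<nu> \<mu> * schur_polynomial r \<mu> d) * schur_function \<nu> \<alpha>)"
proof -
  let ?irr = "\<lambda>\<nu>. irreducible_module n act_tabloids (specht n \<nu>)"
  let ?M = "{\<mu>. length \<mu> \<le> n \<and> (\<exists>k\<le>n choose 2. \<mu> \<in> partitions k)}"
  \<comment> \<open>Any nonzero vector generates an irreducible module, so any choice of
    \<open>s\<close> serves.\<close>
  have "\<exists>s. ?irr \<nu> \<longrightarrow> s \<in> specht n \<nu> \<and> s \<noteq> 0" for \<nu>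
  proof (cases "?irr \<nu>")
    case True
    hence "specht n \<nu> \<noteq> {0}" "0 \<in> specht n \<nu>"
      unfolding irreducible_module_def submodule_def using cvec.subspace_0 by auto
    thus ?thesis by blast
  qed blast
  then obtain s where s: "\<And>\<nu>. ?irr \<nu> \<Longrightarrow> s \<nu> \<in> specht n \<nu>" "\<And>\<nu>. ?irr \<nu> \<Longrightarrow> s \<nu> \<noteq> 0" by metis
  \<comment> \<open>A module that is not irreducible is isomorphic to no irreducible summand, so its
    multiplicity is 0, which accounts for the second branch. In the first branch the degree
    \<open>k\<close> is recovered as the size of \<open>\<mu>\<close>.\<close>
  define b where "b = (\<lambda>\<nu> \<mu>. if ?irr \<nu> then mult_coeff n (s \<nu>) (sum_list \<mu>) (row_lengths \<mu>) else 0)"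
  have main: "multiplicity_in n act_tabloids (specht n \<nu>) act_poly (harmonics_deg r n d) =
      (\<Sum>\<mu>\<in>?M. b \<nu> \<mu> * schur_polynomial r \<mu> d)" if d: "keys d \<subseteq> {..<r}" for r d \<nu>
  proof (cases "?irr \<nu>")
    case False
    obtain w where w: "w \<in> words r (lookup d) (\<Sum>i<r. lookup d i)" using words_nonempty by blast
    interpret polarization r n "\<Sum>i<r. lookup d i" d w by unfold_locales (rule w)
    show ?thesis using trep_poly.multiplicity_in_eq_0[OF False submodule_H fd_H] False by (simp add: b_def)
  next
    case True
    define k where "k = (\<Sum>i<r. lookup d i)"
    let ?f = "\<lambda>\<mu>. kostka (row_lengths \<mu>) r (lookup d) * mult_coeff n (s \<nu>) k (row_lengths \<mu>)"
    have "multiplicity_in n act_tabloids (specht n \<nu>) act_poly (harmonics_deg r n d) =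
      (\<Sum>\<mu>\<in>shapes k. kostka \<mu> r (lookup d) * mult_coeff n (s \<nu>) k \<mu>)"
      by (rule multiplicity_harmonics[OF True s(1)[OF True] s(2)[OF True] d k_def])
    also have "\<dots> = (\<Sum>\<mu>\<in>partitions k. ?f \<mu>)"
      by (rule sum.reindex_bij_betw[OF row_lengths_bij, symmetric])
    also have "\<dots> = (\<Sum>\<mu>\<in>partitions k \<inter> ?M. ?f \<mu>)"
    proof (rule sum.mono_neutral_right[OF finite_partitions])
      show "\<forall>\<mu>\<in>partitions k - partitions k \<inter> ?M. ?f \<mu> = 0"
      proof
        fix \<mu> assume "\<mu> \<in> partitions k - partitions k \<inter> ?M"
        hence m: "\<mu> \<in> partitions k" "\<not> (length \<mu> \<le> n \<and> k \<le> n choose 2)" by auto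
        thus "?f \<mu> = 0"
          using mult_coeff_eq_0[OF row_lengths_shapes[OF m(1)], of n "s \<nu>"] length_le_iff[OF m(1), of n] by auto
      qed
    qed auto
    \<comment> \<open>A partition whose size differs from the total degree has no tableau of content
      \<open>d\<close>, so the range may be extended to all admissible sizes.\<close>
    also have "\<dots> = (\<Sum>\<mu>\<in>?M. b \<nu> \<mu> * schur_polynomial r \<mu> d)"
    proof (rule sum.mono_neutral_cong_left)
      have "?M \<subseteq> (\<Union>k\<in>{..n choose 2}. partitions k)" by auto
      thus "finite ?M" by (rule finite_subset) (simp add: finite_partitions)
      show "\<forall>\<mu>\<in>?M - partitions k \<inter> ?M. b \<nu> \<mu> * schur_polynomial r \<mu> d = 0"
      proof
        fix \<mu> assume m: "\<mu> \<in> ?M - partitions k \<inter> ?M"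
        then obtain l where l: "\<mu> \<in> partitions l" by blast
        hence "l \<noteq> k" using m by blast
        hence "kostka (row_lengths \<mu>) r (lookup d) = 0"
          using kostka_size[of "row_lengths \<mu>" r "lookup d"] shapesD[OF row_lengths_shapes[OF l]] k_def by auto
        thus "b \<nu> \<mu> * schur_polynomial r \<mu> d = 0" using schur_polynomial_kostka[OF l] by simp
      qed
      fix \<mu> assume m: "\<mu> \<in> partitions k \<inter> ?M"
      hence mk: "\<mu> \<in> partitions k" by blast
      show "?f \<mu> = b \<nu> \<mu> * schur_polynomial r \<mu> d"
        using schur_polynomial_kostka[OF mk, of r d] d True partitionsD(3)[OF mk] by (simp add: b_def)
    qed auto
    finally show ?thesis .
  qed
  have "graded_frobenius r n d \<alpha> = (\<Sum>\<nu>\<in>partitions n. (\<Sum>\<mu>\<in>?M. b \<nu> \<mu> * schur_polynomial r \<mu> d) * schur_function \<nu> \<alpha>)"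
    for r d \<alpha>
  proof (cases "keys d \<subseteq> {..<r}")
    case True
    thus ?thesis unfolding graded_frobenius_def frobenius_def using main[OF True] by simp
  next
    case False
    have "b \<nu> \<mu> * schur_polynomial r \<mu> d = 0" if m: "\<mu> \<in> ?M" for \<nu> \<mu>
    proof -
      obtain k where "\<mu> \<in> partitions k" using m by blast
      thus ?thesis using schur_polynomial_kostka[of \<mu> k r d] False by simp
    qed
    thus ?thesis using False unfolding graded_frobenius_def by (simp add: sum.neutral)
  qed
  thus ?thesis by blast
qed

end
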